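(* Let $n$ be an odd natural number, $h_n:=\frac{n-1}{2}$, and let $\beta\ge1$, $m\ge0$ be integers with $\beta+m\le h_n$. Let $U\subset\mathbb{R}^{n+1}$ be a bounded slice Cauchy domain, $I\in\mathbb{S}$, $ds_I=ds(-I)$. Let $f$ be a left (resp. right) slice hyperholomorphic function on an (axially symmetric, open) set containing $\overline U$ and put $f_{\beta,m}(x):=D^\beta\Delta_{n+1}^mf(x)$ (resp. $f_{\beta,m}(x):=f(x)D^\beta\Delta_{n+1}^m$). Then: (1) if $\beta=1$, $f_{\beta,m}$ is left (resp. right) axially poly-harmonic of order $h_n-m$ on $U$; (2) $f_{\beta,m}$ is left (resp. right) axially Anti-Analytic-Harmonic of type $(\beta-1,\,h_n-m-\beta+1)$ on $U$. Moreover, in the left case, for every $x\in U$, $$f_{\beta,m}(x)=\frac{1}{2\pi}\int_{\partial(U\cap\mathbb{C}_I)}S^{-1}_{L,D^\beta\Delta^m}(s,x)\,ds_I\,f(s)$$ (resp., in the right case, $f_{\beta,m}(x)=\frac1{2\pi}\int_{\partial(U\cap\mathbb{C}_I)}f(s)\,ds_I\,\big(S^{-1}_R(s,x)D^\beta\Delta^m_{n+1}\big)$). The integral depends neither on $U$ nor on $I\in\mathbb{S}$, and it is independent of the kernel of $D^\beta\Delta_{n+1}^m$: if $f_1$ is another left (resp. right) slice hyperholomorphic function on a set containing $\overline U$ with $D^\beta\Delta_{n+1}^mf_1=f_{\beta,m}$ (resp. $f_1D^\beta\Delta_{n+1}^m=f_{\beta,m}$), then replacing $f$ by $f_1$ in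 the integral does not change its value.
   Context: $\mathbb{R}_n$ is the real Clifford algebra generated by $e_1,\dots,e_n$, $e_ie_j+e_je_i=-2\delta_{ij}$; $x=(x_0,\dots,x_n)\in\mathbb{R}^{n+1}$ is identified with the paravector $x=x_0+\underline x$, $\underline x=\sum_{j=1}^nx_je_j$; $\bar x=x_0-\underline x$, $|x|^2=\sum_{j=0}^nx_j^2$. $\mathbb{S}=\{\underline x:|\underline x|=1\}$; $\mathbb{C}_I=\mathbb{R}+I\mathbb{R}$; $[x]=\{x_0+I|\underline x|:I\in\mathbb{S}\}$. $U$ is axially symmetric if $[x]\subset U$ for all $x\in U$. A slice Cauchy domain is an axially symmetric open set $U$ such that for every $I\in\mathbb{S}$ the boundary of $U\cap\mathbb{C}_I$ in $\mathbb{C}_I$ is a finite union of non-intersecting piecewise continuously differentiable Jordan curves. $D=\partial_{x_0}+\sum_ie_i\partial_{x_i}$, $\overline D=\partial_{x_0}-\sum_ie_i\partial_{x_i}$, $\Delta_{n+1}=D\overline D=\overline DD=\sum_{i=0}^n\partial_{x_i}^2$; $fD=\partial_{x_0}f+\sum_i(\partial_{x_i}f)e_i$ and similarly $f\overline D$. All differential operators act in $x$. With $\mathcal{U}=\{(u,v)\in\mathbb{R}^2:u+Iv\in U\ \forall I\in\mathbb{S}\}$, $f:U\to\mathbb{R}_n$ is of left (resp. right) axial type if $f(x)=A(x_0,|\underline x|)+\underline\omega B(x_0,|\underline x|)$ (resp. $A+B\underline\omega$), $\underline\omega=\underline x/|\underline x|$, with $A,B:\mathcal{U}\to\mathbb{R}_n$,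 $A(u,-v)=A(u,v)$, $B(u,-v)=-B(u,v)$. It is left (resp. right) slice hyperholomorphic if in addition $A,B$ are $C^1$ and $\partial_uA=\partial_vB$, $\partial_vA=-\partial_uB$. A function of left axial type is (left) axially poly-harmonic of order $p$ if it is $C^{2p}$ and $\Delta_{n+1}^pf=0$ (order $1$: axially harmonic); it is (left) axially Anti-Analytic-Harmonic of type $(b,p)$ if it is $C^{2p+b}$ and $\overline D^{\,b}\Delta_{n+1}^pf=0$. In the right case: right axial type and $f\Delta_{n+1}^p\overline D^{\,b}=0$. Kernels, for $x\notin[s]$: $\mathcal{Q}_{c,s}(x)=s^2-2x_0s+|x|^2$, $S_L^{-1}(s,x)=(s-\bar x)\mathcal{Q}_{c,s}^{-1}(x)$, $S_R^{-1}(s,x)=\mathcal{Q}_{c,s}^{-1}(x)(s-\bar x)$, and $S^{-1}_{L,D^\beta\Delta^m}(s,x):=D^\beta\Delta^m_{n+1}S_L^{-1}(s,x)$. Explicitly, with $K^{1,L}_{\nu,\ell}(s,x)=(s-\bar x)(s-x_0)^\nu\mathcal{Q}_{c,s}^{-\ell}(x)$, $K^2_{\nu,\ell}(s,x)=(s-x_0)^\nu\mathcal{Q}_{c,s}^{-\ell}(x)$, $(-h_n)_m=(-1)^m\frac{h_n!}{(h_n-m)!}$ and $c_{\beta,m,h_n}=2^\beta(h_n-m)4^m(-h_n)_m$: if $\beta=2k_1+1$, $$S^{-1}_{L,D^\beta\Delta^m}=c_{\beta,m,h_n}\Big(\sum_{j=0}^{k_1-1}a^1_{j}K^{1,L}_{2j+1,m+j+2+k_1}-\sum_{j=0}^{k_1}b^1_{j}K^2_{2j,m+1+k_1+j}\Big),$$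 $b^1_j=2^{2j}(m+k_1+j)!\binom{h_n-m-k_1-j-1}{h_n-m-2k_1-1}\frac{(k_1+j)!}{(2j)!}$, $a^1_j=\frac{j+1}{k_1+j+1}b^1_{j+1}$; if $\beta=2k_2$, $k_2\ge1$, $$S^{-1}_{L,D^\beta\Delta^m}=c_{\beta,m,h_n}\Big(\sum_{j=0}^{k_2-1}a^2_jK^{1,L}_{2j,m+j+1+k_2}-\sum_{j=0}^{k_2-1}b^2_jK^2_{2j+1,m+1+j+k_2}\Big),$$ $a^2_j=2^{2j}(m+k_2+j)!\frac{(k_2+j-1)!}{(2j)!}\binom{h_n-m-k_2-1-j}{h_n-m-2k_2}$, $b^2_j=\frac{2(k_2+j)}{2j+1}a^2_j$. *)

theory Defs
  imports "HOL-Complex_Analysis.Complex_Analysis"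
begin

unbundle no fps_syntax

section \<open>The real Clifford algebra with generators of square \<open>-1\<close>\<close>

text \<open>
  An element of the Clifford algebra on the generators \<open>e i\<close>, \<open>i :: 'n\<close>, is given by its coordinates
  with respect to the basis \<open>e_A = e i1 \<cdots> e ik\<close>, \<open>A = {i1 < \<dots> < ik}\<close>. A type copy is needed
  because \<^typ>\<open>real ^ 'm\<close> already carries the componentwise product. The linear order on the index
  type only fixes the order of the factors of \<open>e_A\<close>.
\<close>

typedef (overloaded) 'n clifford = "UNIV :: (real ^ ('n::finite) set) set"
  morphisms cl_vec Cl by simp

setup_lifting type_definition_clifford

instantiation clifford :: (finite) real_vector
begin
lift_definition zero_clifford :: "'a clifford" is "0" .
lift_definition plus_clifford :: "'a clifford \<Rightarrow> 'a clifford \<Rightarrow> 'a clifford" is "(+)" .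
lift_definition minus_clifford :: "'a clifford \<Rightarrow> 'a clifford \<Rightarrow> 'a clifford" is "(-)" .
lift_definition uminus_clifford :: "'a clifford \<Rightarrow> 'a clifford" is "uminus" .
lift_definition scaleR_clifford :: "real \<Rightarrow> 'a clifford \<Rightarrow> 'a clifford" is "scaleR" .
instance
  by standard (transfer; simp add: algebra_simps)+
end

instantiation clifford :: (finite) real_inner
begin
lift_definition inner_clifford :: "'a clifford \<Rightarrow> 'a clifford \<Rightarrow> real" is "inner" .
lift_definition norm_clifford :: "'a clifford \<Rightarrow> real" is "norm" .
definition dist_clifford :: "'a clifford \<Rightarrow> 'a clifford \<Rightarrow> real"
  where "dist_clifford a b = norm (a - b)"
definition sgn_clifford :: "'a clifford \<Rightarrow> 'a clifford"
  where "sgn_clifford a = a /\<^sub>R norm a"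
definition uniformity_clifford :: "('a clifford \<times> 'a clifford) filter"
  where "uniformity_clifford = (INF e\<in>{0 <..}. principal {(a, b). dist a b < e})"
definition open_clifford :: "'a clifford set \<Rightarrow> bool"
  where "open_clifford S = (\<forall>a\<in>S. \<forall>\<^sub>F (a', b) in uniformity. a' = a \<longrightarrow> b \<in> S)"
instance
proof
  fix a b c :: "'a clifford" and r :: real and S :: "'a clifford set"
  show "dist a b = norm (a - b)" by (rule dist_clifford_def)
  show "sgn a = a /\<^sub>R norm a" by (rule sgn_clifford_def)
  show "uniformity = (INF e\<in>{0 <..}. principal {(a::'a clifford, b). dist a b < e})"
    by (rule uniformity_clifford_def)
  show "open S = (\<forall>a\<in>S. \<forall>\<^sub>F (a', b) in uniformity. a' = a \<longrightarrow> b \<in> S)"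
    by (rule open_clifford_def)
  show "a \<bullet> b = b \<bullet> a" by transfer (rule inner_commute)
  show "(a + b) \<bullet> c = a \<bullet> c + b \<bullet> c" by transfer (rule inner_add_left)
  show "(r *\<^sub>R a) \<bullet> b = r * (a \<bullet> b)" by transfer (rule inner_scaleR_left)
  show "0 \<le> a \<bullet> a" by transfer (rule inner_ge_zero)
  show "(a \<bullet> a = 0) = (a = 0)" by transfer (rule inner_eq_zero_iff)
  show "norm a = sqrt (a \<bullet> a)" by transfer (rule norm_eq_sqrt_inner)
qed
end

instantiation clifford :: (finite) euclidean_space
begin
lift_definition Basis_clifford :: "'a clifford set" is "Basis" .
instance
proof
  show "(Basis :: 'a clifford set) \<noteq> {}" by transfer (rule nonempty_Basis)
  show "finite (Basis :: 'a clifford set)" by transfer (rule finite_Basis)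
  fix a b :: "'a clifford"
  show "a \<in> Basis \<Longrightarrow> b \<in> Basis \<Longrightarrow> a \<bullet> b = (if a = b then 1 else 0)"
    by transfer (rule inner_Basis)
  show "(\<forall>b\<in>Basis. a \<bullet> b = 0) \<longleftrightarrow> a = 0" by transfer (rule euclidean_all_zero_iff)
qed
end

text \<open>
  \<open>e_A * e_B = cl_sign A B *\<^sub>R e_C\<close> with \<open>C\<close> the symmetric difference: every pair \<open>(a, b)\<close> with
  \<open>b < a\<close> costs one anticommutation, and every common generator contributes its square \<open>-1\<close>.
\<close>

definition cl_sign :: "('n::{finite,linorder}) set \<Rightarrow> 'n set \<Rightarrow> real"
  where "cl_sign A B = (-1) ^ card {(a, b). a \<in> A \<and> b \<in> B \<and> b \<le> a}"

lemma cl_sign_prod: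
  "cl_sign A B = (\<Prod>a\<in>A. \<Prod>b\<in>B. if b \<le> a then -1 else 1)"
proof -
  have "{(a, b). a \<in> A \<and> b \<in> B \<and> b \<le> a} = (SIGMA a:A. {b\<in>B. b \<le> a})" by auto
  then have "cl_sign A B = (-1) ^ (\<Sum>a\<in>A. card {b\<in>B. b \<le> a})"
    by (simp add: cl_sign_def)
  also have "\<dots> = (\<Prod>a\<in>A. (-1) ^ card {b\<in>B. b \<le> a})" by (simp add: power_sum)
  also have "\<dots> = (\<Prod>a\<in>A. \<Prod>b\<in>B. if b \<le> a then -1 else 1)"
    by (intro prod.cong refl) (simp add: prod.If_cases Int_def)
  finally show ?thesis .
qed

lemma prod_sym_diff:
  fixes g :: "'a \<Rightarrow> real"
  assumes "finite A" "finite B" "\<And>a. g a * g a = 1"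
  shows "prod g (sym_diff A B) = prod g A * prod g B"
proof -
  have 1: "prod g A = prod g (A - B) * prod g (A \<inter> B)"
    using assms by (subst prod.union_disjoint [symmetric]) (auto intro!: prod.cong)
  have 2: "prod g B = prod g (B - A) * prod g (A \<inter> B)"
    using assms by (subst prod.union_disjoint [symmetric]) (auto intro!: prod.cong)
  have 3: "prod g (sym_diff A B) = prod g (A - B) * prod g (B - A)"
    using assms by (subst prod.union_disjoint [symmetric]) (auto intro!: prod.cong)
  have "prod g (A \<inter> B) * prod g (A \<inter> B) = 1"
    by (simp add: prod.distrib [symmetric] assms(3))
  then show ?thesis unfolding 1 2 3 by (simp add: algebra_simps)
qed

lemma cl_sign_sym_diff_left: "cl_sign (sym_diff A B) C = cl_sign A C * cl_sign B C"
  unfolding cl_sign_prod by (rule prod_sym_diff) (auto simp flip: prod.distrib intro!: prod.neutral)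

lemma cl_sign_commute_prod: "cl_sign A B = (\<Prod>b\<in>B. \<Prod>a\<in>A. if b \<le> a then -1 else 1)"
  unfolding cl_sign_prod by (rule prod.swap)

lemma cl_sign_sym_diff_right: "cl_sign A (sym_diff B C) = cl_sign A B * cl_sign A C"
  unfolding cl_sign_commute_prod
  by (rule prod_sym_diff) (auto simp flip: prod.distrib intro!: prod.neutral)

lemma cl_sign_empty [simp]: "cl_sign {} A = 1" "cl_sign A {} = 1"
  by (simp_all add: cl_sign_prod)

lemma sym_diff_cancel: "sym_diff A (sym_diff A B) = B"
  by auto

lemma bij_sym_diff: "bij (sym_diff A)"
  by (rule involuntory_imp_bij) (rule sym_diff_cancel)

lemma sym_diff_eq_self [simp]: "sym_diff A B = A \<longleftrightarrow> B = {}"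
  by auto

instantiation clifford :: ("{finite,linorder}") real_algebra_1
begin
lift_definition one_clifford :: "'a clifford" is "axis {} 1" .
lift_definition times_clifford :: "'a clifford \<Rightarrow> 'a clifford \<Rightarrow> 'a clifford"
  is "\<lambda>a b. \<chi> C. \<Sum>A\<in>UNIV. cl_sign A (sym_diff A C) * a $ A * b $ sym_diff A C" .
instance
proof
  fix a b c :: "'a clifford" and r :: real
  show "a * b * c = a * (b * c)"
  proof (transfer, simp only: vec_eq_iff vec_lambda_beta, rule allI)
    fix a b c :: "real ^ 'a set" and D :: "'a set"
    let ?s = cl_sign and ?d = "\<lambda>A B :: 'a set. sym_diff A B"
    have "(\<Sum>C\<in>UNIV. ?s C (?d C D) * (\<Sum>A\<in>UNIV. ?s A (?d A C) * a $ A * b $ ?d A C) * c $ ?d C D)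
        = (\<Sum>C\<in>UNIV. \<Sum>A\<in>UNIV. ?s C (?d C D) * (?s A (?d A C) * a $ A * b $ ?d A C) * c $ ?d C D)"
      by (simp only: sum_distrib_left sum_distrib_right)
    also have "\<dots> = (\<Sum>A\<in>UNIV. \<Sum>C\<in>UNIV. ?s C (?d C D) * (?s A (?d A C) * a $ A * b $ ?d A C) * c $ ?d C D)"
      by (rule sum.swap)
    also have "\<dots> = (\<Sum>A\<in>UNIV. \<Sum>B\<in>UNIV. ?s (?d A B) (?d (?d A B) D)
          * (?s A (?d A (?d A B)) * a $ A * b $ ?d A (?d A B)) * c $ ?d (?d A B) D)"
      by (intro sum.cong refl sum.reindex_bij_betw [symmetric] bij_sym_diff)
    also have "\<dots> = (\<Sum>A\<in>UNIV. \<Sum>B\<in>UNIV. ?s A (?d A D) * a $ A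
          * (?s B (?d B (?d A D)) * b $ B * c $ ?d B (?d A D)))"
    proof (intro sum.cong refl)
      fix A B
      have eq: "?d (?d A B) D = ?d B (?d A D)" by auto
      have AB: "?s A B * ?s A B = 1"
        by (simp add: cl_sign_def flip: power_add mult_2)
      have "?s (?d A B) (?d (?d A B) D) * ?s A B
          = ?s A (?d B (?d A D)) * ?s B (?d B (?d A D)) * ?s A B"
        by (simp only: cl_sign_sym_diff_left eq)
      also have "\<dots> = ?s A (?d A D) * ?s B (?d B (?d A D)) * (?s A B * ?s A B)"
        by (simp only: cl_sign_sym_diff_right [of A B]) (simp add: algebra_simps)
      finally have "?s (?d A B) (?d (?d A B) D) * ?s A B = ?s A (?d A D) * ?s B (?d B (?d A D))"
        by (simp only: AB mult_1_right)
      then have "?s (?d A B) (?d (?d A B) D) * ?s A B * (a $ A * b $ B * c $ ?d B (?d A D))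
          = ?s A (?d A D) * ?s B (?d B (?d A D)) * (a $ A * b $ B * c $ ?d B (?d A D))"
        by (simp only:)
      then show "?s (?d A B) (?d (?d A B) D) * (?s A (?d A (?d A B)) * a $ A * b $ ?d A (?d A B))
            * c $ ?d (?d A B) D
          = ?s A (?d A D) * a $ A * (?s B (?d B (?d A D)) * b $ B * c $ ?d B (?d A D))"
        unfolding sym_diff_cancel eq by (simp only: mult_ac)
    qed
    finally show "(\<Sum>C\<in>UNIV. ?s C (?d C D) * (\<Sum>A\<in>UNIV. ?s A (?d A C) * a $ A * b $ ?d A C) * c $ ?d C D)
        = (\<Sum>A\<in>UNIV. ?s A (?d A D) * a $ A
          * (\<Sum>B\<in>UNIV. ?s B (?d B (?d A D)) * b $ B * c $ ?d B (?d A D)))"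
      by (simp only: sum_distrib_left)
  qed
  show "(a + b) * c = a * c + b * c"
    by transfer (simp add: vec_eq_iff algebra_simps sum.distrib)
  show "a * (b + c) = a * b + a * c"
    by transfer (simp add: vec_eq_iff algebra_simps sum.distrib)
  show "r *\<^sub>R a * b = r *\<^sub>R (a * b)"
    by transfer (simp add: vec_eq_iff algebra_simps sum_distrib_left)
  show "a * r *\<^sub>R b = r *\<^sub>R (a * b)"
    by transfer (simp add: vec_eq_iff algebra_simps sum_distrib_left)
  show "1 * a = a"
  proof (transfer, simp only: vec_eq_iff vec_lambda_beta, rule allI)
    fix a :: "real ^ 'a set" and C
    have "(\<Sum>A\<in>UNIV. cl_sign A (sym_diff A C) * axis {} 1 $ A * a $ sym_diff A C)
        = (\<Sum>A\<in>UNIV. if A = ({} :: 'a set) then a $ C else 0)"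
      by (intro sum.cong) (auto simp: axis_def)
    then show "(\<Sum>A\<in>UNIV. cl_sign A (sym_diff A C) * axis {} 1 $ A * a $ sym_diff A C) = a $ C"
      by simp
  qed
  show "a * 1 = a"
  proof (transfer, simp only: vec_eq_iff vec_lambda_beta, rule allI)
    fix a :: "real ^ 'a set" and C
    have "(\<Sum>A\<in>UNIV. cl_sign A (sym_diff A C) * a $ A * axis {} 1 $ sym_diff A C)
        = (\<Sum>A\<in>UNIV. if A = C then a $ C else 0)"
      by (intro sum.cong) (auto simp: axis_def)
    then show "(\<Sum>A\<in>UNIV. cl_sign A (sym_diff A C) * a $ A * axis {} 1 $ sym_diff A C) = a $ C"
      by simp
  qed
  show "(0 :: 'a clifford) \<noteq> 1"
    by transfer (simp add: axis_eq_0_iff eq_commute [of 0])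
qed
end

lift_definition cl_basis :: "('n::finite) set \<Rightarrow> 'n clifford" is "\<lambda>A. axis A 1" .

definition cl_e :: "'n::finite \<Rightarrow> 'n clifford"
  where "cl_e i = cl_basis {i}"

lemma cl_basis_mult: "cl_basis A * cl_basis B = cl_sign A B *\<^sub>R cl_basis (sym_diff A B)"
proof (transfer, simp only: vec_eq_iff vec_lambda_beta, rule allI)
  fix A B C :: "'a::{finite,linorder} set"
  have "(\<Sum>A'\<in>UNIV. cl_sign A' (sym_diff A' C) * axis A 1 $ A' * axis B 1 $ sym_diff A' C)
      = (\<Sum>A'\<in>UNIV. if A' = A then cl_sign A (sym_diff A C) * axis B 1 $ sym_diff A C else (0::real))"
    by (intro sum.cong) (auto simp: axis_def)
  also have "\<dots> = cl_sign A (sym_diff A C) * axis B 1 $ sym_diff A C" by simp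
  also have "\<dots> = (cl_sign A B *\<^sub>R axis (sym_diff A B) 1) $ C"
  proof (cases "C = sym_diff A B")
    case True
    then show ?thesis by (simp only: sym_diff_cancel) simp
  next
    case False
    then have "sym_diff A C \<noteq> B" using sym_diff_cancel [of A C] by metis
    then show ?thesis using False by (simp add: axis_def)
  qed
  finally show "(\<Sum>A'\<in>UNIV. cl_sign A' (sym_diff A' C) * axis A 1 $ A' * axis B 1 $ sym_diff A' C)
      = (cl_sign A B *\<^sub>R axis (sym_diff A B) 1) $ C" .
qed

lemma cl_basis_empty: "cl_basis {} = 1"
  by transfer simp

lemma cl_e_relations:
  "cl_e i * cl_e j + cl_e j * cl_e i = (if i = j then - 2 else 0)"
proof (cases "i = j")
  case True
  then show ?thesis
    by (simp add: cl_e_def cl_basis_mult cl_sign_prod cl_basis_empty)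
next
  case False
  then have "cl_sign {i} {j} = - cl_sign {j} {i}"
    by (auto simp: cl_sign_prod)
  moreover have "sym_diff {i} {j} = sym_diff {j} {i}" by auto
  ultimately show ?thesis
    using False by (simp only: cl_e_def cl_basis_mult) simp
qed

text \<open>Two-sided inverse; it exists for every nonzero paravector.\<close>

definition cl_inverse :: "('n::{finite,linorder}) clifford \<Rightarrow> 'n clifford"
  where "cl_inverse a = (THE b. a * b = 1 \<and> b * a = 1)"


section \<open>Paravectors and axially symmetric sets\<close>

text \<open>
  The point \<open>x = (x\<^sub>0, x\<^sub>1, \<dots>, x\<^sub>n)\<close> is the pair of \<open>x\<^sub>0\<close> and the vector part. The imaginary units
  are the \<open>I :: real ^ 'n\<close> with \<^term>\<open>norm I = 1\<close>.
\<close>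

type_synonym 'n point = "real \<times> (real ^ 'n)"

definition paravector :: "('n::{finite,linorder}) point \<Rightarrow> 'n clifford"
  where "paravector x = of_real (fst x) + (\<Sum>i\<in>UNIV. (snd x $ i) *\<^sub>R cl_e i)"

definition conj_point :: "('n::finite) point \<Rightarrow> 'n point"
  where "conj_point x = (fst x, - snd x)"

text \<open>The point \<open>u + I v\<close>, with \<open>u + i v\<close> in the complex plane as coordinate on \<open>\<complex>\<^sub>I\<close>.\<close>

definition slice_point :: "real ^ ('n::finite) \<Rightarrow> complex \<Rightarrow> 'n point"
  where "slice_point I z = (Re z, Im z *\<^sub>R I)"

definition axial_sphere :: "('n::finite) point \<Rightarrow> 'n point set"
  where "axial_sphere x = {(fst x, norm (snd x) *\<^sub>R I) | I. norm I = 1}"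

definition axially_symmetric :: "('n::finite) point set \<Rightarrow> bool"
  where "axially_symmetric U \<longleftrightarrow> (\<forall>x\<in>U. axial_sphere x \<subseteq> U)"

definition slice_of :: "real ^ ('n::finite) \<Rightarrow> 'n point set \<Rightarrow> complex set"
  where "slice_of I U = {z. slice_point I z \<in> U}"

definition jordan_curves :: "(real \<Rightarrow> complex) set \<Rightarrow> bool"
  where "jordan_curves \<Gamma> \<longleftrightarrow> finite \<Gamma> \<and>
    (\<forall>\<gamma>\<in>\<Gamma>. valid_path \<gamma> \<and> simple_path \<gamma> \<and> pathfinish \<gamma> = pathstart \<gamma>) \<and>
    pairwise (\<lambda>\<gamma> \<delta>. disjnt (path_image \<gamma>) (path_image \<delta>)) \<Gamma>"

definition slice_Cauchy_domain :: "('n::finite) point set \<Rightarrow> bool"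
  where "slice_Cauchy_domain U \<longleftrightarrow> open U \<and> axially_symmetric U \<and>
    (\<forall>I. norm I = 1 \<longrightarrow>
      (\<exists>\<Gamma>. jordan_curves \<Gamma> \<and> frontier (slice_of I U) = (\<Union>\<gamma>\<in>\<Gamma>. path_image \<gamma>)))"

text \<open>
  \<open>\<Gamma>\<close> parametrizes the positively oriented boundary of \<open>W\<close>: it winds once around the points of \<open>W\<close>
  and not around the points outside the closure. The winding condition forces \<open>\<Gamma>\<close> to contain every
  boundary curve that has \<open>W\<close> on one side only. A curve with \<open>W\<close> on both sides (as for a disc from
  which a concentric circle is removed) would be run through in both directions, which cancels; this
  is why the images need not exhaust the frontier.
\<close>

definition oriented_boundary :: "complex set \<Rightarrow> (real \<Rightarrow> complex) set \<Rightarrow> bool"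
  where "oriented_boundary W \<Gamma> \<longleftrightarrow> jordan_curves \<Gamma> \<and> (\<Union>\<gamma>\<in>\<Gamma>. path_image \<gamma>) \<subseteq> frontier W \<and>
    (\<forall>z\<in>W. (\<Sum>\<gamma>\<in>\<Gamma>. winding_number \<gamma> z) = 1) \<and>
    (\<forall>z. z \<notin> closure W \<longrightarrow> (\<Sum>\<gamma>\<in>\<Gamma>. winding_number \<gamma> z) = 0)"


section \<open>Partial derivatives and differential operators\<close>

definition partial_deriv ::
    "'a::euclidean_space \<Rightarrow> ('a \<Rightarrow> 'b::real_normed_vector) \<Rightarrow> 'a \<Rightarrow> 'b"
  where "partial_deriv b f x = vector_derivative (\<lambda>t. f (x + t *\<^sub>R b)) (at 0)"

text \<open>Only meaningful for open \<open>S\<close>.\<close>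

fun C_diff_on :: "nat \<Rightarrow> ('a::euclidean_space \<Rightarrow> 'b::real_normed_vector) \<Rightarrow> 'a set \<Rightarrow> bool"
  where
    "C_diff_on 0 f S \<longleftrightarrow> continuous_on S f"
  | "C_diff_on (Suc k) f S \<longleftrightarrow> continuous_on S f \<and>
      (\<forall>b\<in>Basis. (\<forall>x\<in>S. (\<lambda>t. f (x + t *\<^sub>R b)) differentiable at 0) \<and>
        C_diff_on k (partial_deriv b f) S)"

type_synonym 'n cl_fun = "'n point \<Rightarrow> 'n clifford"

definition Dirac_left :: "('n::{finite,linorder}) cl_fun \<Rightarrow> 'n cl_fun"
  where "Dirac_left f x = partial_deriv (1, 0) f x +
    (\<Sum>i\<in>UNIV. cl_e i * partial_deriv (0, axis i 1) f x)"

definition Dirac_right :: "('n::{finite,linorder}) cl_fun \<Rightarrow> 'n cl_fun"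
  where "Dirac_right f x = partial_deriv (1, 0) f x +
    (\<Sum>i\<in>UNIV. partial_deriv (0, axis i 1) f x * cl_e i)"

definition Dirac_conj_left :: "('n::{finite,linorder}) cl_fun \<Rightarrow> 'n cl_fun"
  where "Dirac_conj_left f x = partial_deriv (1, 0) f x -
    (\<Sum>i\<in>UNIV. cl_e i * partial_deriv (0, axis i 1) f x)"

definition Dirac_conj_right :: "('n::{finite,linorder}) cl_fun \<Rightarrow> 'n cl_fun"
  where "Dirac_conj_right f x = partial_deriv (1, 0) f x -
    (\<Sum>i\<in>UNIV. partial_deriv (0, axis i 1) f x * cl_e i)"

definition Laplacian :: "('n::finite) cl_fun \<Rightarrow> 'n cl_fun"
  where "Laplacian f x = (\<Sum>b\<in>Basis. partial_deriv b (partial_deriv b f) x)"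

text \<open>
  The operators are composed as written: in \<open>D^\<beta> \<Delta>^m f\<close> the Laplacian acts first, in
  \<open>f D^\<beta> \<Delta>^m\<close> the operator \<open>D\<close> acts first (from the right).
\<close>

definition DLap_left :: "nat \<Rightarrow> nat \<Rightarrow> ('n::{finite,linorder}) cl_fun \<Rightarrow> 'n cl_fun"
  where "DLap_left \<beta> m f = (Dirac_left ^^ \<beta>) ((Laplacian ^^ m) f)"

definition DLap_right :: "nat \<Rightarrow> nat \<Rightarrow> ('n::{finite,linorder}) cl_fun \<Rightarrow> 'n cl_fun"
  where "DLap_right \<beta> m f = (Laplacian ^^ m) ((Dirac_right ^^ \<beta>) f)"


section \<open>Axial type and slice hyperholomorphic functions\<close>

definition plane_domain :: "('n::finite) point set \<Rightarrow> (real \<times> real) set"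
  where "plane_domain U = {(u, v). \<forall>I. norm I = 1 \<longrightarrow> (u, v *\<^sub>R I) \<in> U}"

definition even_odd_pair ::
    "('n::finite) point set \<Rightarrow> (real \<times> real \<Rightarrow> 'n clifford) \<Rightarrow> (real \<times> real \<Rightarrow> 'n clifford) \<Rightarrow> bool"
  where "even_odd_pair U A B \<longleftrightarrow>
    (\<forall>(u, v)\<in>plane_domain U. A (u, - v) = A (u, v) \<and> B (u, - v) = - B (u, v))"

text \<open>
  \<^term>\<open>sgn (snd x)\<close> is \<open>\<omega>\<close>. On the real axis it is \<open>0\<close>; this is consistent, since there
  \<open>B (x\<^sub>0, 0) = 0\<close> by oddness.
\<close>

definition axial_form_left ::
    "('n::{finite,linorder}) point set \<Rightarrow> 'n cl_fun \<Rightarrow>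
      (real \<times> real \<Rightarrow> 'n clifford) \<Rightarrow> (real \<times> real \<Rightarrow> 'n clifford) \<Rightarrow> bool"
  where "axial_form_left U f A B \<longleftrightarrow> even_odd_pair U A B \<and>
    (\<forall>x\<in>U. f x = A (fst x, norm (snd x)) + paravector (0, sgn (snd x)) * B (fst x, norm (snd x)))"

definition axial_form_right ::
    "('n::{finite,linorder}) point set \<Rightarrow> 'n cl_fun \<Rightarrow>
      (real \<times> real \<Rightarrow> 'n clifford) \<Rightarrow> (real \<times> real \<Rightarrow> 'n clifford) \<Rightarrow> bool"
  where "axial_form_right U f A B \<longleftrightarrow> even_odd_pair U A B \<and>
    (\<forall>x\<in>U. f x = A (fst x, norm (snd x)) + B (fst x, norm (snd x)) * paravector (0, sgn (snd x)))"

definition cauchy_riemann_on ::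
    "(real \<times> real) set \<Rightarrow> (real \<times> real \<Rightarrow> 'b::real_normed_vector) \<Rightarrow> (real \<times> real \<Rightarrow> 'b) \<Rightarrow> bool"
  where "cauchy_riemann_on V A B \<longleftrightarrow> C_diff_on 1 A V \<and> C_diff_on 1 B V \<and>
    (\<forall>p\<in>V. partial_deriv (1, 0) A p = partial_deriv (0, 1) B p \<and>
      partial_deriv (0, 1) A p = - partial_deriv (1, 0) B p)"

definition slice_hyperholomorphic_left ::
    "('n::{finite,linorder}) point set \<Rightarrow> 'n cl_fun \<Rightarrow> bool"
  where "slice_hyperholomorphic_left U f \<longleftrightarrow>
    (\<exists>A B. axial_form_left U f A B \<and> cauchy_riemann_on (plane_domain U) A B)"

definition slice_hyperholomorphic_right ::
    "('n::{finite,linorder}) point set \<Rightarrow> 'n cl_fun \<Rightarrow> bool"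
  where "slice_hyperholomorphic_right U f \<longleftrightarrow>
    (\<exists>A B. axial_form_right U f A B \<and> cauchy_riemann_on (plane_domain U) A B)"

definition axially_polyharmonic_left ::
    "nat \<Rightarrow> ('n::{finite,linorder}) point set \<Rightarrow> 'n cl_fun \<Rightarrow> bool"
  where "axially_polyharmonic_left p U f \<longleftrightarrow> (\<exists>A B. axial_form_left U f A B) \<and>
    C_diff_on (2 * p) f U \<and> (\<forall>x\<in>U. (Laplacian ^^ p) f x = 0)"

definition axially_polyharmonic_right ::
    "nat \<Rightarrow> ('n::{finite,linorder}) point set \<Rightarrow> 'n cl_fun \<Rightarrow> bool"
  where "axially_polyharmonic_right p U f \<longleftrightarrow> (\<exists>A B. axial_form_right U f A B) \<and>
    C_diff_on (2 * p) f U \<and> (\<forall>x\<in>U. (Laplacian ^^ p) f x = 0)"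

definition axially_anti_analytic_harmonic_left ::
    "nat \<Rightarrow> nat \<Rightarrow> ('n::{finite,linorder}) point set \<Rightarrow> 'n cl_fun \<Rightarrow> bool"
  where "axially_anti_analytic_harmonic_left b p U f \<longleftrightarrow> (\<exists>A B. axial_form_left U f A B) \<and>
    C_diff_on (2 * p + b) f U \<and> (\<forall>x\<in>U. (Dirac_conj_left ^^ b) ((Laplacian ^^ p) f) x = 0)"

definition axially_anti_analytic_harmonic_right ::
    "nat \<Rightarrow> nat \<Rightarrow> ('n::{finite,linorder}) point set \<Rightarrow> 'n cl_fun \<Rightarrow> bool"
  where "axially_anti_analytic_harmonic_right b p U f \<longleftrightarrow> (\<exists>A B. axial_form_right U f A B) \<and>
    C_diff_on (2 * p + b) f U \<and> (\<forall>x\<in>U. (Dirac_conj_right ^^ b) ((Laplacian ^^ p) f) x = 0)"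


section \<open>Kernels and boundary integrals\<close>

definition Q_c :: "('n::{finite,linorder}) point \<Rightarrow> 'n point \<Rightarrow> 'n clifford"
  where "Q_c s x = (paravector s)\<^sup>2 - of_real (2 * fst x) * paravector s + of_real ((norm x)\<^sup>2)"

definition S_left :: "('n::{finite,linorder}) point \<Rightarrow> 'n cl_fun"
  where "S_left s x = (paravector s - paravector (conj_point x)) * cl_inverse (Q_c s x)"

definition S_right :: "('n::{finite,linorder}) point \<Rightarrow> 'n cl_fun"
  where "S_right s x = cl_inverse (Q_c s x) * (paravector s - paravector (conj_point x))"

text \<open>
  Along \<open>s = u + I v\<close>, \<open>(u, v) = \<gamma> t\<close>, the form \<open>ds\<^sub>I = ds (-I)\<close> is \<open>(u' + I v') (-I) dt\<close>.
\<close>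

definition ds_slice ::
    "real ^ ('n::{finite,linorder}) \<Rightarrow> (real \<Rightarrow> complex) \<Rightarrow> real \<Rightarrow> 'n clifford"
  where "ds_slice I \<gamma> t =
    paravector (slice_point I (vector_derivative \<gamma> (at t within {0..1}))) * (- paravector (0, I))"

definition slice_integrand ::
    "real ^ ('n::{finite,linorder}) \<Rightarrow> 'n cl_fun \<Rightarrow> 'n cl_fun \<Rightarrow> (real \<Rightarrow> complex) \<Rightarrow> real \<Rightarrow> 'n clifford"
  where "slice_integrand I g h \<gamma> t =
    g (slice_point I (\<gamma> t)) * ds_slice I \<gamma> t * h (slice_point I (\<gamma> t))"

definition slice_integrable ::
    "real ^ ('n::{finite,linorder}) \<Rightarrow> (real \<Rightarrow> complex) set \<Rightarrow> 'n cl_fun \<Rightarrow> 'n cl_fun \<Rightarrow> bool"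
  where "slice_integrable I \<Gamma> g h \<longleftrightarrow> (\<forall>\<gamma>\<in>\<Gamma>. slice_integrand I g h \<gamma> integrable_on {0..1})"

definition slice_integral ::
    "real ^ ('n::{finite,linorder}) \<Rightarrow> (real \<Rightarrow> complex) set \<Rightarrow> 'n cl_fun \<Rightarrow> 'n cl_fun \<Rightarrow> 'n clifford"
  where "slice_integral I \<Gamma> g h = (\<Sum>\<gamma>\<in>\<Gamma>. integral {0..1} (slice_integrand I g h \<gamma>))"

definition DLap_kernel_left ::
    "nat \<Rightarrow> nat \<Rightarrow> ('n::{finite,linorder}) point \<Rightarrow> 'n point \<Rightarrow> 'n clifford"
  where "DLap_kernel_left \<beta> m s x = DLap_left \<beta> m (\<lambda>y. S_left s y) x"

definition DLap_kernel_right ::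
    "nat \<Rightarrow> nat \<Rightarrow> ('n::{finite,linorder}) point \<Rightarrow> 'n point \<Rightarrow> 'n clifford"
  where "DLap_kernel_right \<beta> m s x = DLap_right \<beta> m (\<lambda>y. S_right s y) x"

end

theory Submission
  imports Defs
begin

text \<open>
  With respect to a real basis of the Clifford algebra, \<open>f = A + \<omega> B\<close> has components \<open>A + i B\<close> that
  are ordinary holomorphic functions, and Cauchy's formula for them at the two points \<open>x\<^sub>0 \<plusminus> i |v|\<close>
  (\<open>v\<close> the vector part of \<open>x\<close>) is the slice Cauchy formula with kernel \<open>S\<^sub>L\<close>. Written in the variables \<open>t = s - x\<^sub>0\<close> and
  \<open>Q = t\<^sup>2 + |v|\<^sup>2\<close>, the kernel is \<open>t Q\<^sup>-\<^sup>1 + v Q\<^sup>-\<^sup>1\<close>, and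
  \<open>D S\<^sub>L = - 2 h Q\<^sup>-\<^sup>1\<close>, \<open>\<Delta> Q\<^sup>-\<^sup>l = 4 l (l - h) Q\<^sup>-\<^sup>l\<^sup>-\<^sup>1\<close>, so that \<open>\<Delta>\<^sup>h D S\<^sub>L = 0\<close>.

  Near a fixed sphere \<open>f\<close> is represented by one or two small circles, and differentiation under the
  integral transports smoothness, the axial form and the differential equations from the kernel to
  \<open>f\<close>. The circles are then replaced by the boundary of \<open>U\<close>: the differentiated kernel is
  holomorphic in \<open>s\<close> off the two points, so Cauchy's theorem for homologous cycles applies. Since the
  integral equals \<open>2 \<pi> D\<^sup>\<beta> \<Delta>\<^sup>m f(x)\<close>, its independence of \<open>U\<close>, of \<open>I\<close> and of the kernel of the
  operator is immediate. Reversion reduces the right case to the left one.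
\<close>

section \<open>Cauchy's theorem for cycles\<close>

text \<open>The boundary of a slice may have several components, and a single curve need not be
  null-homologous where f is holomorphic; only sums of winding numbers are controlled. Hence
  Cauchy's theorem is proved for weighted families of loops.

  Identities for the kernels hold only off the sphere where Q vanishes, while the operators are
  iterated on total functions. Equalities are therefore kept on open sets, and kernels are collected
  in inductive classes that ignore values where Q = 0. The iterated kernel enters through membership
  in such a class, which yields its smoothness, its holomorphy in s and its dependence on the
  direction of v.

  The condition \<beta> \<ge> 1 shapes the computation: one factor D is moved next to
  \<open>S_left\<close>, where it removes the vector part, and from then on \<Delta> acts on powers
  of Q by numerical factors. Each of the other \<beta> - 1 factors D meets a conjugate and becomes a
  \<Delta>; with the m given ones and the h - m - \<beta> + 1 of the conclusion this makes exactly
  h.\<close>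

lemma negligible_valid_path_image:
  fixes \<gamma> :: "real \<Rightarrow> complex"
  assumes "valid_path \<gamma>"
  shows "negligible (path_image \<gamma>)"
proof -
  obtain T where T: "finite T" "\<gamma> C1_differentiable_on ({0..1} - T)"
    using assms unfolding valid_path_def piecewise_C1_differentiable_on_def by blast
  have "\<gamma> differentiable_on ({0..1} - T)"
    using T(2) by (meson C1_differentiable_on_eq differentiable_at_imp_differentiable_on)
  then have "negligible (\<gamma> ` ({0..1} - T))"
    by (intro negligible_differentiable_image_lowdim) auto
  moreover have "negligible (\<gamma> ` T)"
    using T(1) by (simp add: negligible_finite)
  ultimately have "negligible (\<gamma> ` ({0..1} - T) \<union> \<gamma> ` T)"
    by (rule negligible_Un)
  then show ?thesis
    unfolding path_image_def by (rule negligible_subset) auto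
qed

text \<open>Differentiating a Cauchy integral in its parameter calls for a bounded derivative of the
  path, which a valid path may fail to have near its break points. Locally in z the path is
  therefore traded for a polynomial path with the same ends, close enough to leave integrals of
  functions holomorphic on \<open>S'\<close> unchanged.\<close>

lemma holomorphic_on_Cauchy_transform:
  assumes "open S" and f: "f holomorphic_on S" and \<gamma>: "valid_path \<gamma>" "path_image \<gamma> \<subseteq> S"
  shows "(\<lambda>z. contour_integral \<gamma> (\<lambda>w. f w / (w - z))) holomorphic_on (- path_image \<gamma>)"
proof -
  have op: "open (- path_image \<gamma>)"
    using closed_valid_path_image [OF \<gamma>(1)] by (simp add: open_Compl)
  have "(\<lambda>z. contour_integral \<gamma> (\<lambda>w. f w / (w - z))) field_differentiable at z0"
    if "z0 \<notin> path_image \<gamma>" for z0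
  proof -
    obtain e where e: "e > 0" "cball z0 e \<subseteq> - path_image \<gamma>"
      using op \<open>z0 \<notin> _\<close> by (meson ComplI open_contains_cball)
    \<comment> \<open>Removing the whole closed disc makes one polynomial path serve every pole z in
      the open disc.\<close>
    define S' where "S' = S - cball z0 e"
    have S': "open S'" "path_image \<gamma> \<subseteq> S'"
      using \<gamma>(2) e \<open>open S\<close> by (auto simp: S'_def)
    obtain d where "d > 0" and d: "\<And>h. \<lbrakk>valid_path h; \<forall>t\<in>{0..1}. cmod (h t - \<gamma> t) < d;
        pathstart h = pathstart \<gamma> \<and> pathfinish h = pathfinish \<gamma>\<rbrakk> \<Longrightarrow>
        path_image h \<subseteq> S' \<and> (\<forall>f. f holomorphic_on S' \<longrightarrow> contour_integral h f = contour_integral \<gamma> f)"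
      using contour_integral_nearby_ends [OF S'(1) valid_path_imp_path [OF \<gamma>(1)] S'(2)] \<gamma>(1)
      by (metis cancel_comm_monoid_add_class.diff_cancel norm_zero)
    obtain p where p: "polynomial_function p" "pathstart p = pathstart \<gamma>" "pathfinish p = pathfinish \<gamma>"
      "\<And>t. t \<in> {0..1} \<Longrightarrow> cmod (p t - \<gamma> t) < d"
      using path_approx_polynomial_function [OF valid_path_imp_path [OF \<gamma>(1)] \<open>d > 0\<close>] by blast
    have vp: "valid_path p" using p(1) by (rule valid_path_polynomial_function)
    have pS': "path_image p \<subseteq> S'" and
      eq: "\<And>f. f holomorphic_on S' \<Longrightarrow> contour_integral p f = contour_integral \<gamma> f"
      using d [OF vp] p by auto
    obtain p' where p': "polynomial_function p'" "\<And>x. (p has_vector_derivative (p' x)) (at x)"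
      by (blast intro: has_vector_derivative_polynomial_function p(1))
    have vd: "vector_derivative p (at t) = p' t" for t
      using p'(2) by (rule vector_derivative_at)
    have "bounded (p' ` {0..1})"
      using p'(1) by (intro compact_imp_bounded compact_continuous_image continuous_on_polymonial_function) auto
    then obtain B where B: "\<And>t. t \<in> {0..1} \<Longrightarrow> norm (p' t) \<le> B"
      unfolding bounded_iff by fastforce
    have hol: "(\<lambda>w. f w / (w - z)) holomorphic_on S'" if "z \<in> ball z0 e" for z
      using that by (intro holomorphic_intros holomorphic_on_subset [OF f]) (auto simp: S'_def)
    have int: "((\<lambda>u. f u / (u - w) ^ 1) has_contour_integral contour_integral p (\<lambda>w'. f w' / (w' - w))) p"
      if "w \<in> ball z0 e - path_image p" for w
    proof -
      have "(\<lambda>w'. f w' / (w' - w)) contour_integrable_on p"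
        using that by (intro contour_integrable_holomorphic_simple [OF hol S'(1) vp pS']) auto
      then show ?thesis by (simp add: has_contour_integral_integral)
    qed
    have cont: "continuous_on (path_image p) f"
      using pS' by (intro holomorphic_on_imp_continuous_on holomorphic_on_subset [OF f]) (auto simp: S'_def)
    have z0: "z0 \<in> ball z0 e - path_image p"
      using pS' e(1) by (auto simp: S'_def)
    have "((\<lambda>z. contour_integral p (\<lambda>w. f w / (w - z))) has_field_derivative
        (of_nat 1 * contour_integral p (\<lambda>u. f u / (u - z0) ^ Suc 1))) (at z0)"
      by (rule Cauchy_next_derivative(2) [where B = B and S = "ball z0 e" and k = 1])
         (use cont B int vp z0 in \<open>auto simp: vd\<close>)
    then have "(\<lambda>z. contour_integral p (\<lambda>w. f w / (w - z))) field_differentiable at z0"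
      unfolding field_differentiable_def by blast
    then show ?thesis
      by (rule field_differentiable_transform_within [OF \<open>e > 0\<close>, rotated 2])
         (use eq hol in \<open>auto simp: dist_commute\<close>)
  qed
  then show ?thesis
    by (simp add: holomorphic_on_def field_differentiable_at_within)
qed

text \<open>The integrand tends to zero uniformly on a bounded neighbourhood of the path, and the
  integral is at most a constant times the supremum over that neighbourhood.\<close>

lemma Cauchy_transform_at_infinity:
  assumes "open S" and f: "f holomorphic_on S" and \<gamma>: "valid_path \<gamma>" "path_image \<gamma> \<subseteq> S"
  shows "((\<lambda>z. contour_integral \<gamma> (\<lambda>w. f w / (w - z))) \<longlongrightarrow> 0) at_infinity"
proof -
  have comp: "compact (path_image \<gamma>)" using \<gamma>(1) by (rule compact_valid_path_image)
  have contf: "continuous_on S f" using f by (rule holomorphic_on_imp_continuous_on)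
  have "compact (f ` path_image \<gamma>)"
    using comp contf \<gamma>(2) by (meson compact_continuous_image continuous_on_subset)
  then obtain B where B: "B > 0" "\<And>z. z \<in> path_image \<gamma> \<Longrightarrow> cmod (f z) \<le> B"
    using compact_imp_bounded bounded_pos by (metis imageI)
  obtain R where R: "R > 0" "\<And>z. z \<in> path_image \<gamma> \<Longrightarrow> cmod z \<le> R"
    using comp compact_imp_bounded bounded_pos by metis
  \<comment> \<open>The bound refers to an open set around the path, not to the path itself; this is
    the origin of the slack 1 in both radii.\<close>
  define V where "V = (S \<inter> f -` ball 0 (B + 1)) \<inter> ball 0 (R + 1)"
  have "open V"
    unfolding V_def using contf \<open>open S\<close> by (intro open_Int continuous_open_preimage) auto
  moreover have "path_image \<gamma> \<subseteq> V"
    using \<gamma>(2) B R by (force simp: V_def)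
  ultimately obtain L where L: "L > 0"
    "\<And>g b. g holomorphic_on V \<Longrightarrow> (\<forall>z\<in>V. norm (g z) \<le> b) \<Longrightarrow> norm (contour_integral \<gamma> g) \<le> L * b"
    using contour_integral_bound_exists [of V \<gamma>] \<gamma>(1) by metis
  have bd: "norm (contour_integral \<gamma> (\<lambda>w. f w / (w - z))) \<le> L * ((B + 1) / (norm z - (R + 1)))"
    if "norm z > R + 1" for z
  proof (rule L(2))
    show "(\<lambda>w. f w / (w - z)) holomorphic_on V"
      using that by (intro holomorphic_intros holomorphic_on_subset [OF f]) (auto simp: V_def)
    show "\<forall>w\<in>V. norm (f w / (w - z)) \<le> (B + 1) / (norm z - (R + 1))"
    proof
      fix w assume w: "w \<in> V"
      then have "norm z - (R + 1) \<le> norm (w - z)"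
        using norm_triangle_ineq2 [of z w] by (auto simp: V_def norm_minus_commute)
      with w that B show "norm (f w / (w - z)) \<le> (B + 1) / (norm z - (R + 1))"
        unfolding norm_divide by (intro frac_le) (auto simp: V_def)
    qed
  qed
  show ?thesis
  proof (rule Lim_null_comparison)
    show "\<forall>\<^sub>F z in at_infinity. norm (contour_integral \<gamma> (\<lambda>w. f w / (w - z)))
        \<le> L * ((B + 1) / (norm z - (R + 1)))"
      unfolding eventually_at_infinity by (rule exI [of _ "R + 2"]) (use bd in auto)
    have "filterlim (\<lambda>r. - (R + 1) + r) at_top at_top"
      by (rule filterlim_tendsto_add_at_top [OF tendsto_const filterlim_ident])
    then have "((\<lambda>r. L * ((B + 1) / (- (R + 1) + r))) \<longlongrightarrow> 0) at_top"
      by (intro tendsto_mult_right_zero tendsto_divide_0 [OF tendsto_const] filterlim_at_top_imp_at_infinity)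
    then have "((\<lambda>r. L * ((B + 1) / (r - (R + 1)))) \<longlongrightarrow> 0) at_top"
      by (simp only: add.commute [of "- (R + 1)"] add_uminus_conv_diff)
    then show "((\<lambda>z::complex. L * ((B + 1) / (norm z - (R + 1)))) \<longlongrightarrow> 0) at_infinity"
      by (rule filterlim_compose) (rule filterlim_norm_at_top)
  qed
qed

lemma winding_number_sum_locally_constant:
  assumes "finite \<Gamma>" and \<Gamma>: "\<And>\<gamma>. \<gamma> \<in> \<Gamma> \<Longrightarrow> valid_path \<gamma> \<and> pathfinish \<gamma> = pathstart \<gamma>"
    and "connected V" "V \<inter> (\<Union>\<gamma>\<in>\<Gamma>. path_image \<gamma>) = {}" "z \<in> V" "z' \<in> V"
  shows "(\<Sum>\<gamma>\<in>\<Gamma>. c \<gamma> * winding_number \<gamma> z) = (\<Sum>\<gamma>\<in>\<Gamma>. c \<gamma> * winding_number \<gamma> z')"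
proof (intro sum.cong refl arg_cong2 [where f = "(*)"])
  fix \<gamma> assume "\<gamma> \<in> \<Gamma>"
  then show "winding_number \<gamma> z = winding_number \<gamma> z'"
    using winding_number_constant [of \<gamma> V] assms valid_path_imp_path
    unfolding constant_on_def by (metis UN_I disjoint_iff)
qed

text \<open>
  Dixon's argument. The difference quotient \<open>\<phi> z\<close> of \<open>f\<close> is integrated over the cycle; where the
  winding number vanishes, this is the Cauchy transform of \<open>f\<close>, so that the two patch to an entire
  function. At a point of the cycle, holomorphy is seen after a small translation of the cycle.
\<close>

theorem Cauchy_integral_formula_cycle:
  fixes f :: "complex \<Rightarrow> complex" and c :: "(real \<Rightarrow> complex) \<Rightarrow> complex"
  assumes "open S" and f: "f holomorphic_on S" and fin: "finite \<Gamma>"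
    and \<Gamma>: "\<And>\<gamma>. \<gamma> \<in> \<Gamma> \<Longrightarrow> valid_path \<gamma> \<and> pathfinish \<gamma> = pathstart \<gamma> \<and> path_image \<gamma> \<subseteq> S"
    and zero: "\<And>w. w \<notin> S \<Longrightarrow> (\<Sum>\<gamma>\<in>\<Gamma>. c \<gamma> * winding_number \<gamma> w) = 0"
    and z: "z \<in> S" "z \<notin> (\<Union>\<gamma>\<in>\<Gamma>. path_image \<gamma>)"
  shows "(\<Sum>\<gamma>\<in>\<Gamma>. c \<gamma> * contour_integral \<gamma> (\<lambda>w. f w / (w - z))) =
    2 * pi * \<i> * (\<Sum>\<gamma>\<in>\<Gamma>. c \<gamma> * winding_number \<gamma> z) * f z"
proof -
  define P where "P = (\<Union>\<gamma>\<in>\<Gamma>. path_image \<gamma>)"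
  define N where "N w = (\<Sum>\<gamma>\<in>\<Gamma>. c \<gamma> * winding_number \<gamma> w)" for w
  define \<phi> where "\<phi> z w = (if w = z then deriv f z else (f w - f z) / (w - z))" for z w
  define h where "h z = (\<Sum>\<gamma>\<in>\<Gamma>. c \<gamma> * contour_integral \<gamma> (\<phi> z))" for z
  define k where "k z = (\<Sum>\<gamma>\<in>\<Gamma>. c \<gamma> * contour_integral \<gamma> (\<lambda>w. f w / (w - z)))" for z
  \<comment> \<open>By \<open>h_eq\<close> the two pieces agree at points of \<open>S\<close> off
    the cycle with winding number zero. Near a point outside \<open>S\<close> all points of
    \<open>S\<close> are of this kind, so \<open>H\<close> coincides with \<open>k\<close>
    there.\<close>
  define H where "H z = (if z \<in> S then h z else k z)" for z
  have compP: "compact P"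
    unfolding P_def using fin \<Gamma> by (intro compact_UN) (auto intro: compact_valid_path_image)
  have PS: "P \<subseteq> S" unfolding P_def using \<Gamma> by blast
  have negP: "negligible P"
    unfolding P_def using fin \<Gamma> by (intro negligible_Union) (auto intro: negligible_valid_path_image)
  have \<phi>: "\<phi> z holomorphic_on S" if "z \<in> S" for z
    unfolding \<phi>_def [abs_def] using pole_lemma_open [OF f \<open>open S\<close>] .
  have split: "contour_integral \<gamma> (\<phi> z) = contour_integral \<gamma> (\<lambda>w. f w / (w - z)) -
      f z * contour_integral \<gamma> (\<lambda>w. 1 / (w - z))"
    if "valid_path \<gamma>" "path_image \<gamma> \<subseteq> S" "z \<notin> path_image \<gamma>" for \<gamma> z
  proof -
    have hol: "(\<lambda>w. f w / (w - z)) holomorphic_on S - {z}" "(\<lambda>w. 1 / (w - z)) holomorphic_on S - {z}"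
      by (rule holomorphic_intros holomorphic_on_subset [OF f] | force)+
    have "(\<lambda>w. f w / (w - z)) contour_integrable_on \<gamma>" "(\<lambda>w. 1 / (w - z)) contour_integrable_on \<gamma>"
      by (rule contour_integrable_holomorphic_simple [OF hol(1)] contour_integrable_holomorphic_simple [OF hol(2)];
          use that \<open>open S\<close> in \<open>force simp: open_delete\<close>)+
    note ci = this
    have "contour_integral \<gamma> (\<phi> z) = contour_integral \<gamma> (\<lambda>w. f w / (w - z) - f z * (1 / (w - z)))"
      by (rule contour_integral_eq) (use that in \<open>auto simp: \<phi>_def diff_divide_distrib\<close>)
    also have "\<dots> = contour_integral \<gamma> (\<lambda>w. f w / (w - z)) - f z * contour_integral \<gamma> (\<lambda>w. 1 / (w - z))"
      using ci by (simp add: contour_integral_diff contour_integrable_lmul contour_integral_lmul del: times_divide_eq_right mult_1_right)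
    finally show ?thesis .
  qed
  have h_eq: "h z = k z - 2 * pi * \<i> * N z * f z" if "z \<in> S" "z \<notin> P" for z
  proof -
    have "c \<gamma> * contour_integral \<gamma> (\<phi> z) = c \<gamma> * contour_integral \<gamma> (\<lambda>w. f w / (w - z)) -
        2 * pi * \<i> * (c \<gamma> * winding_number \<gamma> z) * f z" if "\<gamma> \<in> \<Gamma>" for \<gamma>
    proof -
      have "z \<notin> path_image \<gamma>" using \<open>z \<notin> P\<close> that by (auto simp: P_def)
      then show ?thesis
        using \<Gamma> [OF that] by (simp add: split winding_number_valid_path algebra_simps)
    qed
    then show ?thesis
      by (simp add: h_def k_def N_def sum_subtractf sum_distrib_left sum_distrib_right)
  qed
  have holk: "k holomorphic_on - P"
    unfolding k_def P_def
    by (intro holomorphic_intros holomorphic_on_subset [OF holomorphic_on_Cauchy_transform [OF \<open>open S\<close> f]])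
       (use \<Gamma> in auto)
  have N0: "eventually (\<lambda>w. w \<notin> P \<and> N w = 0) (nhds w0)" if "w0 \<notin> S" for w0
  proof -
    have "open (- P)" using compP by (simp add: compact_imp_closed open_Compl)
    moreover have "w0 \<in> - P" using that PS by blast
    ultimately obtain e where e: "e > 0" "ball w0 e \<subseteq> - P"
      unfolding open_contains_ball by blast
    have "N w = N w0" if "w \<in> ball w0 e" for w
      unfolding N_def
      by (rule winding_number_sum_locally_constant [where V = "ball w0 e"])
         (use that e fin \<Gamma> in \<open>auto simp: P_def\<close>)
    moreover have "N w0 = 0" using zero [OF that] by (simp add: N_def)
    ultimately show ?thesis
      unfolding eventually_nhds using e by (intro exI [of _ "ball w0 e"]) auto
  qed
  have diffS: "h field_differentiable at z0" if z0: "z0 \<in> S" for z0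
  proof -
    have "\<exists>d>0. \<forall>g. valid_path g \<and> pathfinish g = pathstart g \<and> (\<forall>t\<in>{0..1}. cmod (g t - \<gamma> t) < d) \<longrightarrow>
        path_image g \<subseteq> S \<and> (\<forall>f. f holomorphic_on S \<longrightarrow> contour_integral g f = contour_integral \<gamma> f)"
      if "\<gamma> \<in> \<Gamma>" for \<gamma>
    proof -
      have g: "valid_path \<gamma>" "pathfinish \<gamma> = pathstart \<gamma>" "path_image \<gamma> \<subseteq> S" using \<Gamma> [OF that] by auto
      show ?thesis
        using contour_integral_nearby_loops [OF \<open>open S\<close> valid_path_imp_path [OF g(1)] g(3)] g
        by (metis cancel_comm_monoid_add_class.diff_cancel norm_zero)
    qed
    then obtain d where d: "\<And>\<gamma>. \<gamma> \<in> \<Gamma> \<Longrightarrow> d \<gamma> > 0"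
      "\<And>\<gamma> g. \<lbrakk>\<gamma> \<in> \<Gamma>; valid_path g; pathfinish g = pathstart g; \<forall>t\<in>{0..1}. cmod (g t - \<gamma> t) < d \<gamma>\<rbrakk> \<Longrightarrow>
        path_image g \<subseteq> S \<and> (\<forall>f. f holomorphic_on S \<longrightarrow> contour_integral g f = contour_integral \<gamma> f)"
      by metis
    obtain \<delta> where \<delta>: "\<delta> > 0" "\<And>\<gamma>. \<gamma> \<in> \<Gamma> \<Longrightarrow> \<delta> \<le> d \<gamma>"
    proof
      show "Min (insert 1 (d ` \<Gamma>)) > 0" using fin d(1) by (subst Min_gr_iff) auto
      show "Min (insert 1 (d ` \<Gamma>)) \<le> d \<gamma>" if "\<gamma> \<in> \<Gamma>" for \<gamma>
        using fin that by (intro Min_le) auto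
    qed
    \<comment> \<open>Curves are null sets, so the disc around \<open>z0\<close> contains a point
      \<open>b\<close> off the cycle; translation by \<open>z0 - b\<close> moves the cycle by less
      than \<delta> and off \<open>z0\<close>.\<close>
    obtain b where b: "b \<in> ball z0 \<delta>" "b \<notin> P"
      using negP \<delta>(1) negligible_subset [of P "ball z0 \<delta>"] open_not_negligible [of "ball z0 \<delta>"] by fastforce
    define tr where "tr = (\<lambda>\<gamma> (t::real). (z0 - b) + \<gamma> t :: complex)"
    have tr: "valid_path (tr \<gamma>)" "pathfinish (tr \<gamma>) = pathstart (tr \<gamma>)" "path_image (tr \<gamma>) \<subseteq> S"
      "z0 \<notin> path_image (tr \<gamma>)"
      "\<And>f. f holomorphic_on S \<Longrightarrow> contour_integral (tr \<gamma>) f = contour_integral \<gamma> f" if "\<gamma> \<in> \<Gamma>" for \<gamma>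
    proof -
      show v: "valid_path (tr \<gamma>)"
        using \<Gamma> [OF that] unfolding tr_def by (simp add: valid_path_translation_eq [unfolded comp_def])
      show l: "pathfinish (tr \<gamma>) = pathstart (tr \<gamma>)"
        using \<Gamma> [OF that] by (simp add: tr_def pathfinish_def pathstart_def)
      have "\<forall>t\<in>{0..1}. cmod (tr \<gamma> t - \<gamma> t) < d \<gamma>"
        using b(1) \<delta>(2) [OF that] by (auto simp: tr_def dist_norm)
      then show "path_image (tr \<gamma>) \<subseteq> S"
        and "\<And>f. f holomorphic_on S \<Longrightarrow> contour_integral (tr \<gamma>) f = contour_integral \<gamma> f"
        using d(2) [OF that v l] by auto
      show "z0 \<notin> path_image (tr \<gamma>)"
        using b(2) that by (fastforce simp: tr_def path_image_def P_def)
    qed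
    define V where "V = S - (\<Union>\<gamma>\<in>\<Gamma>. path_image (tr \<gamma>))"
    have V: "open V" "z0 \<in> V"
      using \<open>open S\<close> fin tr(1,4) z0 by (auto simp: V_def intro!: open_Diff closed_valid_path_image)
    \<comment> \<open>Off the translated cycle the difference quotient splits into two Cauchy
      transforms, both holomorphic in z. The quotient itself is holomorphic in w on all of
      \<open>S\<close>, so its integral is not changed by the translation.\<close>
    have "(\<lambda>z. \<Sum>\<gamma>\<in>\<Gamma>. c \<gamma> * (contour_integral (tr \<gamma>) (\<lambda>w. f w / (w - z)) -
        f z * contour_integral (tr \<gamma>) (\<lambda>w. 1 / (w - z)))) holomorphic_on V"
      by (intro holomorphic_intros holomorphic_on_subset [OF f]
          holomorphic_on_subset [OF holomorphic_on_Cauchy_transform [OF \<open>open S\<close> f]]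
          holomorphic_on_subset [OF holomorphic_on_Cauchy_transform [OF \<open>open S\<close>, of "\<lambda>w. 1"]])
         (use tr in \<open>auto simp: V_def\<close>)
    moreover have "(\<Sum>\<gamma>\<in>\<Gamma>. c \<gamma> * (contour_integral (tr \<gamma>) (\<lambda>w. f w / (w - z)) -
        f z * contour_integral (tr \<gamma>) (\<lambda>w. 1 / (w - z)))) = h z" if "z \<in> V" for z
    proof -
      have "contour_integral (tr \<gamma>) (\<lambda>w. f w / (w - z)) - f z * contour_integral (tr \<gamma>) (\<lambda>w. 1 / (w - z))
          = contour_integral \<gamma> (\<phi> z)" if "\<gamma> \<in> \<Gamma>" for \<gamma>
        using split [of "tr \<gamma>" z] tr [OF that] \<open>z \<in> V\<close> \<phi> [of z] that by (auto simp: V_def)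
      then show ?thesis by (simp add: h_def)
    qed
    ultimately have "h holomorphic_on V"
      by (rule holomorphic_transform)
    then show ?thesis
      using V by (simp add: holomorphic_on_open field_differentiable_def)
  qed
  have HolH: "H holomorphic_on UNIV"
  proof (clarsimp simp: holomorphic_on_def)
    fix z0
    show "H field_differentiable at z0"
    proof (cases "z0 \<in> S")
      case True
      then obtain e where "e > 0" "ball z0 e \<subseteq> S" using \<open>open S\<close> open_contains_ball by blast
      with diffS [OF True] show ?thesis
        by (elim field_differentiable_transform_within [where d = e, rotated 3])
           (auto simp: H_def dist_commute subset_iff)
    next
      case False
      obtain e where e: "e > 0" "\<And>w. dist w z0 < e \<Longrightarrow> w \<notin> P \<and> N w = 0"
        using N0 [OF False] unfolding eventually_nhds_metric by blast
      have "k field_differentiable at z0"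
        using holk False PS compP
        by (metis ComplI compact_imp_closed holomorphic_on_imp_differentiable_at open_Compl subsetD)
      then show ?thesis
        by (rule field_differentiable_transform_within [OF e(1), rotated 2])
           (use e h_eq in \<open>auto simp: H_def\<close>)
    qed
  qed
  \<comment> \<open>Far out all winding numbers vanish, so \<open>H\<close> is the Cauchy transform
    there.\<close>
  have "(H \<longlongrightarrow> 0) at_infinity"
  proof -
    have "(k \<longlongrightarrow> (\<Sum>\<gamma>\<in>\<Gamma>. c \<gamma> * 0)) at_infinity"
      unfolding k_def using \<Gamma>
      by (intro tendsto_sum tendsto_mult tendsto_const Cauchy_transform_at_infinity [OF \<open>open S\<close> f]) auto
    moreover obtain R where R: "P \<subseteq> ball 0 R"
      using compP compact_imp_bounded bounded_subset_ballD by blast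
    have "k w = H w" if "R \<le> cmod w" for w
    proof -
      have "w \<notin> P" using R that by auto
      have "winding_number \<gamma> w = 0" if "\<gamma> \<in> \<Gamma>" for \<gamma>
        by (rule winding_number_zero_outside [where s = "ball 0 R"])
           (use \<Gamma> [OF that] R that \<open>R \<le> _\<close> in \<open>auto simp: P_def valid_path_imp_path\<close>)
      then have "N w = 0" by (simp add: N_def)
      then show ?thesis using h_eq \<open>w \<notin> P\<close> by (simp add: H_def)
    qed
    then have "\<forall>\<^sub>F w in at_infinity. k w = H w"
      unfolding eventually_at_infinity by blast
    ultimately show ?thesis
      by (simp add: tendsto_cong)
  qed
  then have "H z = 0" using Liouville_weak_0 [OF HolH] by blast
  then show ?thesis
    using h_eq [of z] z by (simp add: H_def k_def N_def P_def)
qed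

text \<open>The integral formula is applied to (w - z) f(w), which vanishes at z. Any z in
  \<open>S\<close> off the curves will do, and one exists because the curves are null sets.\<close>

corollary Cauchy_theorem_cycle:
  fixes f :: "complex \<Rightarrow> complex" and c :: "(real \<Rightarrow> complex) \<Rightarrow> complex"
  assumes "open S" and f: "f holomorphic_on S" and fin: "finite \<Gamma>"
    and \<Gamma>: "\<And>\<gamma>. \<gamma> \<in> \<Gamma> \<Longrightarrow> valid_path \<gamma> \<and> pathfinish \<gamma> = pathstart \<gamma> \<and> path_image \<gamma> \<subseteq> S"
    and zero: "\<And>w. w \<notin> S \<Longrightarrow> (\<Sum>\<gamma>\<in>\<Gamma>. c \<gamma> * winding_number \<gamma> w) = 0"
  shows "(\<Sum>\<gamma>\<in>\<Gamma>. c \<gamma> * contour_integral \<gamma> f) = 0"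
proof (cases "\<Gamma> = {}")
  case False
  then have "S \<noteq> {}" using \<Gamma> path_image_nonempty by blast
  moreover have "negligible (\<Union>\<gamma>\<in>\<Gamma>. path_image \<gamma>)"
    using fin \<Gamma> by (intro negligible_Union) (auto intro: negligible_valid_path_image)
  ultimately obtain z where z: "z \<in> S" "z \<notin> (\<Union>\<gamma>\<in>\<Gamma>. path_image \<gamma>)"
    using open_not_negligible [OF \<open>open S\<close>] negligible_subset [of _ S] by blast
  have "contour_integral \<gamma> f = contour_integral \<gamma> (\<lambda>w. ((w - z) * f w) / (w - z))" if "\<gamma> \<in> \<Gamma>" for \<gamma>
    by (rule contour_integral_eq) (use z that in auto)
  then have "(\<Sum>\<gamma>\<in>\<Gamma>. c \<gamma> * contour_integral \<gamma> f) =
      (\<Sum>\<gamma>\<in>\<Gamma>. c \<gamma> * contour_integral \<gamma> (\<lambda>w. ((w - z) * f w) / (w - z)))"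
    by simp
  also have "\<dots> = 2 * pi * \<i> * (\<Sum>\<gamma>\<in>\<Gamma>. c \<gamma> * winding_number \<gamma> z) * ((z - z) * f z)"
    using f by (intro Cauchy_integral_formula_cycle [OF \<open>open S\<close> _ fin \<Gamma> zero z] holomorphic_intros) auto
  finally show ?thesis by simp
qed simp

section \<open>Paravectors and directional derivatives\<close>

text \<open>The Euclidean norm of the coordinates is not submultiplicative once there are three
  generators. Continuity and the product rule therefore come from bilinearity in finite
  dimension.\<close>

lemma clifford_bounded_bilinear:
  "bounded_bilinear ((*) :: ('n::{finite,linorder}) clifford \<Rightarrow> 'n clifford \<Rightarrow> 'n clifford)"
  unfolding bilinear_conv_bounded_bilinear [symmetric] bilinear_def
  by (auto intro!: linearI simp: algebra_simps)

interpretation cl_mult: bounded_bilinear "(*) :: ('n::{finite,linorder}) clifford \<Rightarrow> 'n clifford \<Rightarrow> 'n clifford"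
  by (rule clifford_bounded_bilinear)

lemma paravector_add: "paravector (x + y) = paravector x + paravector y"
  by (simp add: paravector_def algebra_simps sum.distrib)

lemma paravector_scaleR: "paravector (r *\<^sub>R x) = r *\<^sub>R paravector x"
  by (simp add: paravector_def algebra_simps scaleR_sum_right of_real_def)

lemma linear_paravector: "linear (paravector :: ('n::{finite,linorder}) point \<Rightarrow> 'n clifford)"
  by (rule linearI) (simp_all add: paravector_add paravector_scaleR)

lemma paravector_minus: "paravector (- x) = - paravector x"
  using paravector_scaleR [of "-1" x] by simp

lemma paravector_zero [simp]: "paravector 0 = 0"
  using paravector_scaleR [of 0 0] by simp

lemma paravector_split: "paravector x = of_real (fst x) + paravector (0, snd x)"
  by (simp add: paravector_def)

lemma paravector_axis: "paravector (0, axis i 1) = cl_e i"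
proof -
  have "(\<Sum>j\<in>UNIV. (axis i 1 $ j) *\<^sub>R cl_e j) = (\<Sum>j\<in>UNIV. if j = i then cl_e i else 0 :: 'a clifford)"
    by (intro sum.cong) (auto simp: axis_def)
  then show ?thesis by (simp add: paravector_def)
qed

lemma paravector_anticommute:
  "paravector (0, u) * paravector (0, v) + paravector (0, v) * paravector (0, u) = of_real (- 2 * (u \<bullet> v))"
proof -
  have "paravector (0, u) * paravector (0, v) =
      (\<Sum>i\<in>UNIV. \<Sum>j\<in>UNIV. (u $ i * v $ j) *\<^sub>R (cl_e i * cl_e j))"
    by (simp add: paravector_def sum_product mult.commute)
  moreover have "paravector (0, v) * paravector (0, u) =
      (\<Sum>i\<in>UNIV. \<Sum>j\<in>UNIV. (u $ i * v $ j) *\<^sub>R (cl_e j * cl_e i))"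
    by (subst sum.swap) (simp add: paravector_def sum_product)
  ultimately have "paravector (0, u) * paravector (0, v) + paravector (0, v) * paravector (0, u) =
      (\<Sum>i\<in>UNIV. \<Sum>j\<in>UNIV. (u $ i * v $ j) *\<^sub>R (cl_e i * cl_e j + cl_e j * cl_e i))"
    by (simp add: sum.distrib scaleR_right_distrib)
  also have "\<dots> = (\<Sum>i\<in>UNIV. \<Sum>j\<in>UNIV. if j = i then (u $ i * v $ i) *\<^sub>R (- 2) else 0)"
    by (intro sum.cong refl) (auto simp: cl_e_relations)
  also have "\<dots> = (\<Sum>i\<in>UNIV. (u $ i * v $ i) *\<^sub>R (- 2))"
    by simp
  also have "\<dots> = of_real (\<Sum>i\<in>UNIV. (u $ i * v $ i) * (- 2))"
    by (simp add: scaleR_conv_of_real)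
  also have "(\<Sum>i\<in>UNIV. (u $ i * v $ i) * (- 2)) = - 2 * (u \<bullet> v)"
    by (simp add: inner_vec_def sum_distrib_left mult_ac)
  finally show ?thesis .
qed

lemma paravector_square: "paravector (0, v) * paravector (0, v) = - of_real ((norm v)\<^sup>2)"
proof -
  have "2 *\<^sub>R (paravector (0, v) * paravector (0, v)) = 2 *\<^sub>R (- of_real ((norm v)\<^sup>2))"
    using paravector_anticommute [of v v]
    by (simp add: scaleR_2 power2_norm_eq_inner flip: of_real_add of_real_minus)
  then show ?thesis by (simp only: scaleR_cancel_left) simp
qed

text \<open>The polarization of conj(x) x = |x|^2. It is the algebraic half of the factorization of
  \<Delta> into D and its conjugate; the other half is the symmetry of second derivatives.\<close>

lemma paravector_conj_polar:
  "paravector (conj_point a) * paravector b + paravector (conj_point b) * paravector a = of_real (2 * (a \<bullet> b))"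
proof -
  have c: "paravector (conj_point x) = of_real (fst x) - paravector (0, snd x)" for x :: "'a point"
    using paravector_split [of "conj_point x"] paravector_minus [of "(0, snd x)"]
    by (simp add: conj_point_def)
  have "paravector (conj_point a) * paravector b + paravector (conj_point b) * paravector a =
      of_real (fst a) * of_real (fst b) + of_real (fst b) * of_real (fst a) +
      (of_real (fst a) * paravector (0, snd b) - paravector (0, snd b) * of_real (fst a)) +
      (of_real (fst b) * paravector (0, snd a) - paravector (0, snd a) * of_real (fst b)) -
      (paravector (0, snd a) * paravector (0, snd b) + paravector (0, snd b) * paravector (0, snd a))"
    unfolding c paravector_split [of a] paravector_split [of b] by (simp add: algebra_simps)
  also have "\<dots> = of_real (2 * (a \<bullet> b))"
    unfolding paravector_anticommute
    by (simp add: of_real_def inner_prod_def algebra_simps scaleR_2 flip: scaleR_add_left)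
  finally show ?thesis .
qed

section \<open>Slices as copies of the complex plane\<close>

text \<open>For a unit vector I this is the isomorphism of the complex numbers onto the subalgebra
  spanned by 1 and I. Kernels are computed as complex functions and then carried over, so that
  commutative calculus applies.\<close>

definition cl_complex :: "real ^ ('n::{finite,linorder}) \<Rightarrow> complex \<Rightarrow> 'n clifford"
  where "cl_complex I z = of_real (Re z) + Im z *\<^sub>R paravector (0, I)"

lemma paravector_slice_point: "paravector (slice_point I z) = cl_complex I z"
  using paravector_split [of "slice_point I z"] paravector_scaleR [of "Im z" "(0, I)"]
  by (simp add: cl_complex_def slice_point_def)

lemma linear_cl_complex: "linear (cl_complex I)"
  by (rule linearI) (auto simp: cl_complex_def algebra_simps of_real_def scaleR_add_left)

lemma bounded_linear_cl_complex: "bounded_linear (cl_complex I)"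
  by (rule linear_conv_bounded_linear [THEN iffD1, OF linear_cl_complex])

lemmas cl_complex_add = linear_add [OF linear_cl_complex]
  and cl_complex_diff = linear_diff [OF linear_cl_complex]
  and cl_complex_minus = linear_neg [OF linear_cl_complex]
  and cl_complex_scaleR = linear_scale [OF linear_cl_complex]
  and cl_complex_sum = linear_sum [OF linear_cl_complex]

lemma cl_complex_of_real: "cl_complex I (of_real r) = of_real r"
  by (simp add: cl_complex_def)

lemma cl_complex_1: "cl_complex I 1 = 1"
  by (simp add: cl_complex_def)

lemma cl_complex_i: "cl_complex I \<i> = paravector (0, I)"
  by (simp add: cl_complex_def)

lemma cl_complex_mult:
  assumes "norm I = 1"
  shows "cl_complex I (z * w) = cl_complex I z * cl_complex I w"
proof -
  have *: "paravector (0, I) * paravector (0, I) = - 1"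
    using paravector_square [of I] assms by simp
  show ?thesis
    by (simp add: cl_complex_def algebra_simps of_real_def *)
qed

section \<open>Directional derivatives as a relation\<close>

text \<open>\<open>partial_deriv\<close> has an unspecified value where no derivative exists, so the
  rules of calculus are stated for this relation. The direction is arbitrary, and its length
  counts.\<close>

definition has_pd ::
    "('a::euclidean_space \<Rightarrow> 'b::real_normed_vector) \<Rightarrow> 'a \<Rightarrow> 'b \<Rightarrow> 'a \<Rightarrow> bool"
  where "has_pd f b d x \<longleftrightarrow> ((\<lambda>t. f (x + t *\<^sub>R b)) has_vector_derivative d) (at 0)"

lemma has_pd_partial_deriv: "has_pd f b d x \<Longrightarrow> partial_deriv b f x = d"
  unfolding has_pd_def partial_deriv_def by (rule vector_derivative_at)

lemma eventually_line_in_open: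
  fixes x b :: "'a::real_normed_vector"
  assumes "open S" "x \<in> S"
  shows "eventually (\<lambda>t. x + t *\<^sub>R b \<in> S) (nhds 0)"
proof -
  have "continuous_on UNIV (\<lambda>t. x + t *\<^sub>R b)" by (intro continuous_intros)
  then have "open ((\<lambda>t. x + t *\<^sub>R b) -` S)"
    using assms(1) by (simp add: open_vimage)
  then show ?thesis
    unfolding eventually_nhds using assms(2) by (intro exI [of _ "(\<lambda>t. x + t *\<^sub>R b) -` S"]) auto
qed

lemma has_pd_cong_open:
  assumes "open S" "x \<in> S" "\<And>y. y \<in> S \<Longrightarrow> f y = g y"
  shows "has_pd f b d x \<longleftrightarrow> has_pd g b d x"
proof -
  have *: "eventually (\<lambda>t. f (x + t *\<^sub>R b) = g (x + t *\<^sub>R b)) (nhds 0)"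
    using eventually_line_in_open [OF assms(1,2)] by eventually_elim (rule assms(3))
  show ?thesis
    unfolding has_pd_def
    by (rule has_vector_derivative_cong_ev) (use * eventually_nhds_x_imp_x [OF *] in auto)
qed

lemma partial_deriv_cong_open:
  assumes "open S" "x \<in> S" "\<And>y. y \<in> S \<Longrightarrow> f y = g y"
  shows "partial_deriv b f x = partial_deriv b g x"
proof -
  have "has_pd f b d x \<longleftrightarrow> has_pd g b d x" for d
    by (rule has_pd_cong_open [OF assms])
  then show ?thesis by (simp add: partial_deriv_def vector_derivative_def has_pd_def)
qed

lemma has_pd_const: "has_pd (\<lambda>x. c) b 0 x"
  by (simp add: has_pd_def)

lemma has_pd_add: "has_pd f b d x \<Longrightarrow> has_pd g b e x \<Longrightarrow> has_pd (\<lambda>x. f x + g x) b (d + e) x"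
  unfolding has_pd_def by (rule has_vector_derivative_add)

lemma has_pd_diff: "has_pd f b d x \<Longrightarrow> has_pd g b e x \<Longrightarrow> has_pd (\<lambda>x. f x - g x) b (d - e) x"
  unfolding has_pd_def by (rule has_vector_derivative_diff)

lemma has_pd_sum:
  "(\<And>i. i \<in> A \<Longrightarrow> has_pd (f i) b (d i) x) \<Longrightarrow> has_pd (\<lambda>x. \<Sum>i\<in>A. f i x) b (\<Sum>i\<in>A. d i) x"
  unfolding has_pd_def by (rule has_vector_derivative_sum)

lemma has_pd_bounded_linear:
  "bounded_linear L \<Longrightarrow> has_pd f b d x \<Longrightarrow> has_pd (\<lambda>x. L (f x)) b (L d) x"
  unfolding has_pd_def by (rule bounded_linear.has_vector_derivative)

lemma has_pd_cl_mult_left: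
  fixes f :: "'a::euclidean_space \<Rightarrow> ('n::{finite,linorder}) clifford"
  shows "has_pd f b d x \<Longrightarrow> has_pd (\<lambda>x. c * f x) b (c * d) x"
  by (rule has_pd_bounded_linear [OF cl_mult.bounded_linear_right])

lemma has_pd_scaleR: "has_pd f b d x \<Longrightarrow> has_pd (\<lambda>x. r *\<^sub>R f x) b (r *\<^sub>R d) x"
  by (rule has_pd_bounded_linear [OF bounded_linear_scaleR_right])

lemma has_pd_mult:
  fixes f g :: "'a::euclidean_space \<Rightarrow> 'b::real_normed_algebra"
  shows "has_pd f b d x \<Longrightarrow> has_pd g b e x \<Longrightarrow> has_pd (\<lambda>x. f x * g x) b (f x * e + d * g x) x"
  unfolding has_pd_def using has_vector_derivative_mult [of _ _ "0::real" UNIV] by fastforce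

lemma has_pd_bilinear:
  assumes "bounded_bilinear p" "has_pd f b d x" "has_pd g b e x"
  shows "has_pd (\<lambda>x. p (f x) (g x)) b (p (f x) e + p d (g x)) x"
  using bounded_bilinear.has_vector_derivative [OF assms(1), of _ _ "0::real" UNIV] assms(2,3)
  unfolding has_pd_def by fastforce

lemma has_pd_ident: "has_pd (\<lambda>x. x) b b x"
  unfolding has_pd_def by (auto intro!: derivative_eq_intros)

lemma has_pd_coord: "has_pd (\<lambda>x. of_real (x \<bullet> c)) b (of_real (b \<bullet> c)) x"
  by (rule has_pd_bounded_linear [OF bounded_linear_compose
        [OF bounded_linear_of_real bounded_linear_inner_left] has_pd_ident])

lemma has_pd_inverse:
  fixes f :: "'a::euclidean_space \<Rightarrow> 'b::real_normed_field"
  assumes "has_pd f b d x" "f x \<noteq> 0"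
  shows "has_pd (\<lambda>x. inverse (f x)) b (- (inverse (f x) * inverse (f x) * d)) x"
proof -
  have "((\<lambda>t. inverse (f (x + t *\<^sub>R b))) has_derivative
      (\<lambda>h. - (inverse (f (x + 0 *\<^sub>R b)) * (h *\<^sub>R d) * inverse (f (x + 0 *\<^sub>R b))))) (at 0)"
    using assms unfolding has_pd_def has_vector_derivative_def
    by (intro Deriv.has_derivative_inverse) auto
  then show ?thesis
    unfolding has_pd_def has_vector_derivative_def by (simp add: algebra_simps)
qed

section \<open>Kernel families\<close>

text \<open>The complex counterpart of \<open>Q_c\<close>, with the square completed: for a unit I,
  \<open>cl_complex I\<close> maps it to \<open>Q_c (slice_point I w) x\<close>, see
  \<open>Q_c_slice_point\<close>. Only the length of the vector part enters.\<close>

definition qf :: "complex \<Rightarrow> ('n::finite) point \<Rightarrow> complex"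
  where "qf w x = (w - of_real (fst x))\<^sup>2 + of_real ((norm (snd x))\<^sup>2)"

lemma qf_factor: "qf w x = (w - Complex (fst x) (norm (snd x))) * (w - Complex (fst x) (- norm (snd x)))"
  by (simp add: qf_def complex_eq_iff power2_eq_square algebra_simps)

lemma continuous_on_qf [continuous_intros]:
  "continuous_on S f \<Longrightarrow> continuous_on S g \<Longrightarrow> continuous_on S (\<lambda>p. qf (f p) (g p))"
  unfolding qf_def by (intro continuous_intros)

lemma open_qf: "open {x. qf w x \<noteq> 0}"
  by (intro open_Collect_neq continuous_intros)

lemma has_pd_qf:
  "has_pd (qf w) b (of_real (2 * (snd x \<bullet> snd b)) - 2 * of_real (fst b) * (w - of_real (fst x))) x"
proof -
  have s: "has_pd snd b (snd b) x"
    using has_pd_bounded_linear [OF bounded_linear_snd has_pd_ident] .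
  have f: "has_pd (\<lambda>y. w - of_real (fst y)) b (- of_real (fst b)) x"
    using has_pd_diff [OF has_pd_const has_pd_bounded_linear
        [OF bounded_linear_compose [OF bounded_linear_of_real bounded_linear_fst] has_pd_ident], of w b x]
    by simp
  have qf: "qf w = (\<lambda>y. (w - of_real (fst y)) * (w - of_real (fst y)) + of_real (snd y \<bullet> snd y))"
    by (simp add: fun_eq_iff qf_def power2_eq_square [of "w - _"] power2_norm_eq_inner flip: of_real_power)
  have "has_pd (qf w) b
      ((w - of_real (fst x)) * (- of_real (fst b)) + (- of_real (fst b)) * (w - of_real (fst x)) +
        of_real (snd x \<bullet> snd b + snd b \<bullet> snd x)) x"
    unfolding qf by (intro has_pd_add has_pd_mult f
        has_pd_bounded_linear [OF bounded_linear_of_real has_pd_bilinear [OF bounded_bilinear_inner s s]])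
  moreover have "(w - of_real (fst x)) * (- of_real (fst b)) + (- of_real (fst b)) * (w - of_real (fst x)) +
      of_real (snd x \<bullet> snd b + snd b \<bullet> snd x) =
      of_real (2 * (snd x \<bullet> snd b)) - 2 * of_real (fst b) * (w - of_real (fst x))"
    by (simp add: algebra_simps inner_commute)
  ultimately show ?thesis by (simp only:)
qed

text \<open>
  The coefficients of the kernels, as functions of the parameter \<open>w\<close> and of the point \<open>x\<close>. Nothing is
  required where \<^const>\<open>qf\<close> vanishes, that is, where the sphere of \<open>x\<close> meets \<open>w\<close>.
\<close>

inductive rat_fam :: "(complex \<Rightarrow> ('n::finite) point \<Rightarrow> complex) \<Rightarrow> bool" where
  rat_fam_const: "rat_fam (\<lambda>w x. c)"
| rat_fam_param: "rat_fam (\<lambda>w x. w)"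
| rat_fam_coord: "rat_fam (\<lambda>w x. of_real (x \<bullet> b))"
| rat_fam_inverse: "rat_fam (\<lambda>w x. inverse (qf w x))"
| rat_fam_add: "rat_fam a \<Longrightarrow> rat_fam a' \<Longrightarrow> rat_fam (\<lambda>w x. a w x + a' w x)"
| rat_fam_mult: "rat_fam a \<Longrightarrow> rat_fam a' \<Longrightarrow> rat_fam (\<lambda>w x. a w x * a' w x)"
| rat_fam_cong: "rat_fam a \<Longrightarrow> (\<And>w x. qf w x \<noteq> 0 \<Longrightarrow> a' w x = a w x) \<Longrightarrow> rat_fam a'"

lemma rat_fam_continuous:
  "rat_fam a \<Longrightarrow> continuous_on {p. qf (fst p) (snd p) \<noteq> 0} (\<lambda>p. a (fst p) (snd p))"
proof (induction rule: rat_fam.induct)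
  case (rat_fam_cong a a')
  then show ?case by (subst continuous_on_cong [OF refl, where g = "\<lambda>p. a (fst p) (snd p)"]) auto
qed (auto intro!: continuous_intros)

lemma rat_fam_uminus: "rat_fam a \<Longrightarrow> rat_fam (\<lambda>w x. - a w x)"
  using rat_fam_mult [OF rat_fam_const [of "-1"], of a] by simp

lemma rat_fam_diff: "rat_fam a \<Longrightarrow> rat_fam a' \<Longrightarrow> rat_fam (\<lambda>w x. a w x - a' w x)"
  using rat_fam_add [OF _ rat_fam_uminus, of a a'] by simp

lemma rat_fam_power: "rat_fam a \<Longrightarrow> rat_fam (\<lambda>w x. a w x ^ k)"
  by (induction k) (auto intro: rat_fam_const rat_fam_mult)

lemma rat_fam_fst: "rat_fam (\<lambda>w x. of_real (fst x))"
  using rat_fam_coord [of "(1, 0)"] by (simp add: inner_prod_def)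

lemma rat_fam_snd: "rat_fam (\<lambda>w x. of_real (snd x \<bullet> v))"
  using rat_fam_coord [of "(0, v)"] by (simp add: inner_prod_def)

lemma rat_fam_qf_deriv:
  "rat_fam (\<lambda>w x. of_real (2 * (snd x \<bullet> v)) - 2 * of_real r * (w - of_real (fst x)))"
proof -
  have "rat_fam (\<lambda>w x. 2 * of_real (snd x \<bullet> v) - 2 * of_real r * (w - of_real (fst x)))"
    by (intro rat_fam_diff rat_fam_mult rat_fam_const rat_fam_snd rat_fam_param rat_fam_fst)
  then show ?thesis by simp
qed

text \<open>The derivative is found inside the class, as one family for all w. Since membership
  ignores values where \<open>qf\<close> vanishes, \<open>partial_deriv\<close> itself is then a
  member, and higher derivatives exist by iteration.\<close>

lemma rat_fam_has_pd_ex: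
  "rat_fam a \<Longrightarrow> \<exists>a'. rat_fam a' \<and> (\<forall>w x. qf w x \<noteq> 0 \<longrightarrow> has_pd (a w) b (a' w x) x)"
proof (induction rule: rat_fam.induct)
  case (rat_fam_const c)
  then show ?case by (intro exI [of _ "\<lambda>w x. 0"]) (auto intro: rat_fam.intros has_pd_const)
next
  case rat_fam_param
  then show ?case by (intro exI [of _ "\<lambda>w x. 0"]) (auto intro: rat_fam.intros has_pd_const)
next
  case (rat_fam_coord c)
  then show ?case
    by (intro exI [of _ "\<lambda>w x. of_real (b \<bullet> c)"]) (auto intro: rat_fam.intros has_pd_coord)
next
  case rat_fam_inverse
  show ?case
    by (intro exI [of _ "\<lambda>w x. - (inverse (qf w x) * inverse (qf w x) *
          (of_real (2 * (snd x \<bullet> snd b)) - 2 * of_real (fst b) * (w - of_real (fst x))))"] conjI)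
       (intro rat_fam_uminus rat_fam_mult rat_fam.rat_fam_inverse rat_fam_qf_deriv
          has_pd_inverse has_pd_qf allI impI | assumption)+
next
  case (rat_fam_add a1 a2)
  then obtain d1 d2 where "rat_fam d1" "\<And>w x. qf w x \<noteq> 0 \<Longrightarrow> has_pd (a1 w) b (d1 w x) x"
    "rat_fam d2" "\<And>w x. qf w x \<noteq> 0 \<Longrightarrow> has_pd (a2 w) b (d2 w x) x" by blast
  then show ?case
    by (intro exI [of _ "\<lambda>w x. d1 w x + d2 w x"]) (auto intro!: rat_fam.rat_fam_add has_pd_add)
next
  case (rat_fam_mult a1 a2)
  then obtain d1 d2 where "rat_fam d1" "\<And>w x. qf w x \<noteq> 0 \<Longrightarrow> has_pd (a1 w) b (d1 w x) x"
    "rat_fam d2" "\<And>w x. qf w x \<noteq> 0 \<Longrightarrow> has_pd (a2 w) b (d2 w x) x" by blast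
  then show ?case
    by (intro exI [of _ "\<lambda>w x. a1 w x * d2 w x + d1 w x * a2 w x"])
       (auto intro!: rat_fam.rat_fam_add rat_fam.rat_fam_mult has_pd_mult rat_fam_mult.hyps)
next
  case (rat_fam_cong a a')
  then obtain d where d: "rat_fam d" "\<And>w x. qf w x \<noteq> 0 \<Longrightarrow> has_pd (a w) b (d w x) x" by blast
  have "has_pd (a' w) b (d w x) x" if "qf w x \<noteq> 0" for w x
    using d(2) [OF that] has_pd_cong_open [OF open_qf, of x w "a' w" "a w"] rat_fam_cong.hyps(2) that by auto
  with d(1) show ?case by blast
qed

lemma rat_fam_has_pd:
  assumes "rat_fam a" "qf w x \<noteq> 0"
  shows "has_pd (a w) b (partial_deriv b (a w) x) x"
  using rat_fam_has_pd_ex [OF assms(1)] assms(2) has_pd_partial_deriv by metis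

lemma rat_fam_pd:
  assumes "rat_fam a"
  shows "rat_fam (\<lambda>w. partial_deriv b (a w))"
proof -
  obtain a' where "rat_fam a'" "\<And>w x. qf w x \<noteq> 0 \<Longrightarrow> has_pd (a w) b (a' w x) x"
    using rat_fam_has_pd_ex [OF assms] by blast
  then show ?thesis by (elim rat_fam.rat_fam_cong) (simp add: has_pd_partial_deriv)
qed

text \<open>Symmetry of second derivatives is read off from explicit formulas, by induction on the
  way the function is built. The one computation is that for 1/Q: with q_d the derivative of Q along
  d, the result - q_de / Q^2 + 2 q_d q_e / Q^3 is symmetric in d and e.\<close>

lemma rat_fam_pd_commute:
  "rat_fam a \<Longrightarrow> qf w x \<noteq> 0 \<Longrightarrow>
    partial_deriv b (partial_deriv c (a w)) x = partial_deriv c (partial_deriv b (a w)) x"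
proof (induction arbitrary: w x rule: rat_fam.induct)
  case (rat_fam_const k)
  have "partial_deriv d (\<lambda>x. k) = (\<lambda>x. 0)" for k :: complex and d :: "'a point"
    using has_pd_partial_deriv [OF has_pd_const] by blast
  then show ?case by simp
next
  case rat_fam_param
  have "partial_deriv d (\<lambda>x. k) = (\<lambda>x. 0)" for k :: complex and d :: "'a point"
    using has_pd_partial_deriv [OF has_pd_const] by blast
  then show ?case by simp
next
  case (rat_fam_coord v)
  have "partial_deriv d (\<lambda>x. k) = (\<lambda>x. 0)" for k :: complex and d :: "'a point"
    using has_pd_partial_deriv [OF has_pd_const] by blast
  moreover have "partial_deriv d (\<lambda>x. complex_of_real (x \<bullet> v)) = (\<lambda>x. of_real (d \<bullet> v))" for d :: "'a point"
    using has_pd_partial_deriv [OF has_pd_coord] by blast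
  ultimately show ?case by simp
next
  case rat_fam_inverse
  define dq where "dq d w x = complex_of_real (2 * (snd x \<bullet> snd d)) - 2 * of_real (fst d) * (w - of_real (fst x))"
    for d x :: "'a point" and w :: complex
  have pd1: "partial_deriv d (\<lambda>x. inverse (qf w x)) y = - (inverse (qf w y) * inverse (qf w y) * dq d w y)"
    if "qf w y \<noteq> 0" for d y
    unfolding dq_def using that by (intro has_pd_partial_deriv has_pd_inverse has_pd_qf)
  \<comment> \<open>\<open>dq d w\<close> is affine in x, so its derivative is a constant symmetric
    form in the two directions.\<close>
  have dq: "has_pd (dq d w) e (of_real (2 * (snd e \<bullet> snd d)) + 2 * of_real (fst d * fst e)) x" for d e
  proof -
    have "has_pd (\<lambda>x. 2 * of_real (x \<bullet> (0, snd d)) - 2 * of_real (fst d) * (w - of_real (x \<bullet> (1, 0)))) e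
        ((2 * of_real (e \<bullet> (0, snd d)) + 0 * of_real (x \<bullet> (0, snd d))) -
         (2 * of_real (fst d) * (0 - of_real (e \<bullet> (1, 0))) + 0 * (w - of_real (x \<bullet> (1, 0))))) x"
      by (intro has_pd_diff has_pd_mult has_pd_const has_pd_coord)
    then show ?thesis by (simp add: dq_def [abs_def] inner_prod_def mult.assoc)
  qed
  have qf': "has_pd (qf w) d (dq d w x) x" for d
    unfolding dq_def by (rule has_pd_qf)
  have "partial_deriv e (partial_deriv d (\<lambda>x. inverse (qf w x))) x =
      - (inverse (qf w x) * inverse (qf w x) * (of_real (2 * (snd e \<bullet> snd d)) + 2 * of_real (fst d * fst e))) +
      2 * inverse (qf w x) ^ 3 * dq d w x * dq e w x" for d e
  proof -
    have "partial_deriv e (partial_deriv d (\<lambda>x. inverse (qf w x))) x =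
        partial_deriv e (\<lambda>y. - (inverse (qf w y) * inverse (qf w y) * dq d w y)) x"
      by (rule partial_deriv_cong_open [OF open_qf [of w]]) (use rat_fam_inverse pd1 in auto)
    also have "\<dots> = - ((inverse (qf w x) * inverse (qf w x)) *
        (of_real (2 * (snd e \<bullet> snd d)) + 2 * of_real (fst d * fst e)) +
        (inverse (qf w x) * (- (inverse (qf w x) * inverse (qf w x) * dq e w x)) +
         (- (inverse (qf w x) * inverse (qf w x) * dq e w x)) * inverse (qf w x)) * dq d w x)"
      by (intro has_pd_partial_deriv has_pd_bounded_linear [OF bounded_linear_minus [OF bounded_linear_ident]]
          has_pd_mult has_pd_inverse dq qf' rat_fam_inverse)
    finally show ?thesis by (simp add: algebra_simps power3_eq_cube)
  qed
  then show ?case by (simp add: inner_commute mult_ac)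
next
  case (rat_fam_add a1 a2)
  have 1: "partial_deriv d (\<lambda>x. a1 w x + a2 w x) y = partial_deriv d (a1 w) y + partial_deriv d (a2 w) y"
    if "qf w y \<noteq> 0" for d y
    using that rat_fam_add by (intro has_pd_partial_deriv has_pd_add rat_fam_has_pd)
  have "partial_deriv e (partial_deriv d (\<lambda>x. a1 w x + a2 w x)) x =
      partial_deriv e (partial_deriv d (a1 w)) x + partial_deriv e (partial_deriv d (a2 w)) x" for d e
  proof -
    have "partial_deriv e (partial_deriv d (\<lambda>x. a1 w x + a2 w x)) x =
        partial_deriv e (\<lambda>y. partial_deriv d (a1 w) y + partial_deriv d (a2 w) y) x"
      by (rule partial_deriv_cong_open [OF open_qf [of w]]) (use rat_fam_add 1 in auto)
    also have "\<dots> = partial_deriv e (partial_deriv d (a1 w)) x + partial_deriv e (partial_deriv d (a2 w)) x"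
      using rat_fam_add
      by (intro has_pd_partial_deriv has_pd_add rat_fam_has_pd [of "\<lambda>w. partial_deriv d (a1 w)"]
          rat_fam_has_pd [of "\<lambda>w. partial_deriv d (a2 w)"] rat_fam_pd)
    finally show ?thesis .
  qed
  then show ?case using rat_fam_add by simp
next
  case (rat_fam_mult a1 a2)
  have 1: "partial_deriv d (\<lambda>x. a1 w x * a2 w x) y =
      a1 w y * partial_deriv d (a2 w) y + partial_deriv d (a1 w) y * a2 w y"
    if "qf w y \<noteq> 0" for d y
    using that rat_fam_mult by (intro has_pd_partial_deriv has_pd_mult rat_fam_has_pd)
  have "partial_deriv e (partial_deriv d (\<lambda>x. a1 w x * a2 w x)) x =
      (a1 w x * partial_deriv e (partial_deriv d (a2 w)) x + partial_deriv e (a1 w) x * partial_deriv d (a2 w) x) +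
      (partial_deriv d (a1 w) x * partial_deriv e (a2 w) x + partial_deriv e (partial_deriv d (a1 w)) x * a2 w x)"
    for d e
  proof -
    have "partial_deriv e (partial_deriv d (\<lambda>x. a1 w x * a2 w x)) x =
        partial_deriv e (\<lambda>y. a1 w y * partial_deriv d (a2 w) y + partial_deriv d (a1 w) y * a2 w y) x"
      by (rule partial_deriv_cong_open [OF open_qf [of w]]) (use rat_fam_mult 1 in auto)
    also have "\<dots> = (a1 w x * partial_deriv e (partial_deriv d (a2 w)) x + partial_deriv e (a1 w) x * partial_deriv d (a2 w) x) +
      (partial_deriv d (a1 w) x * partial_deriv e (a2 w) x + partial_deriv e (partial_deriv d (a1 w)) x * a2 w x)"
      using rat_fam_mult
      by (intro has_pd_partial_deriv has_pd_add has_pd_mult rat_fam_has_pd [of a1] rat_fam_has_pd [of a2]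
          rat_fam_has_pd [of "\<lambda>w. partial_deriv d (a1 w)"]
          rat_fam_has_pd [of "\<lambda>w. partial_deriv d (a2 w)"] rat_fam_pd)
    finally show ?thesis .
  qed
  then show ?case using rat_fam_mult by (simp add: algebra_simps)
next
  case (rat_fam_cong a a')
  have 1: "partial_deriv d (a' w) y = partial_deriv d (a w) y" if "qf w y \<noteq> 0" for d y
    by (rule partial_deriv_cong_open [OF open_qf [of w]]) (use rat_fam_cong that in auto)
  have "partial_deriv e (partial_deriv d (a' w)) x = partial_deriv e (partial_deriv d (a w)) x" for d e
    by (rule partial_deriv_cong_open [OF open_qf [of w]]) (use 1 rat_fam_cong in auto)
  then show ?case using rat_fam_cong by simp
qed

section \<open>Clifford-valued kernels\<close>

text \<open>Clifford coefficients stand on the left because the operators multiply from the left,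
  which leaves the right side free for the density of an integral. The variable vector part of x
  fits in through its coordinates, see \<open>ker_fam_vec\<close>.\<close>

inductive ker_fam :: "real ^ ('n::{finite,linorder}) \<Rightarrow> (complex \<Rightarrow> 'n cl_fun) \<Rightarrow> bool" for I where
  ker_fam_atom: "rat_fam a \<Longrightarrow> ker_fam I (\<lambda>w x. C * cl_complex I (a w x))"
| ker_fam_add: "ker_fam I k \<Longrightarrow> ker_fam I k' \<Longrightarrow> ker_fam I (\<lambda>w x. k w x + k' w x)"
| ker_fam_cong: "ker_fam I k \<Longrightarrow> (\<And>w x. qf w x \<noteq> 0 \<Longrightarrow> k' w x = k w x) \<Longrightarrow> ker_fam I k'"

text \<open>Continuity is joint in the parameter and the point, as differentiation under the
  integral requires.\<close>

lemma ker_fam_continuous: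
  "ker_fam I k \<Longrightarrow> continuous_on {p. qf (fst p) (snd p) \<noteq> 0} (\<lambda>p. k (fst p) (snd p))"
proof (induction rule: ker_fam.induct)
  case (ker_fam_atom a C)
  have "continuous_on {p. qf (fst p) (snd p) \<noteq> 0} (\<lambda>p. cl_complex I (a (fst p) (snd p)))"
    using bounded_linear.continuous_on [OF bounded_linear_cl_complex rat_fam_continuous [OF ker_fam_atom]] .
  then show ?case by (intro cl_mult.continuous_on continuous_on_const)
next
  case (ker_fam_cong a a')
  then show ?case by (subst continuous_on_cong [OF refl, where g = "\<lambda>p. a (fst p) (snd p)"]) auto
qed (intro continuous_intros)

lemma ker_fam_has_pd_ex:
  "ker_fam I k \<Longrightarrow> \<exists>k'. ker_fam I k' \<and> (\<forall>w x. qf w x \<noteq> 0 \<longrightarrow> has_pd (k w) b (k' w x) x)"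
proof (induction rule: ker_fam.induct)
  case (ker_fam_atom a C)
  have "has_pd (\<lambda>x. C * cl_complex I (a w x)) b (C * cl_complex I (partial_deriv b (a w) x)) x"
    if "qf w x \<noteq> 0" for w x
    by (intro has_pd_cl_mult_left has_pd_bounded_linear [OF bounded_linear_cl_complex] rat_fam_has_pd
        ker_fam_atom that)
  then show ?case
    using ker_fam.ker_fam_atom [OF rat_fam_pd [OF ker_fam_atom]] by fast
next
  case (ker_fam_add a1 a2)
  then obtain d1 d2 where "ker_fam I d1" "\<And>w x. qf w x \<noteq> 0 \<Longrightarrow> has_pd (a1 w) b (d1 w x) x"
    "ker_fam I d2" "\<And>w x. qf w x \<noteq> 0 \<Longrightarrow> has_pd (a2 w) b (d2 w x) x" by blast
  then show ?case
    by (intro exI [of _ "\<lambda>w x. d1 w x + d2 w x"]) (auto intro!: ker_fam.ker_fam_add has_pd_add)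
next
  case (ker_fam_cong a a')
  then obtain d where d: "ker_fam I d" "\<And>w x. qf w x \<noteq> 0 \<Longrightarrow> has_pd (a w) b (d w x) x" by blast
  have "has_pd (a' w) b (d w x) x" if "qf w x \<noteq> 0" for w x
    using d(2) [OF that] has_pd_cong_open [OF open_qf, of x w "a' w" "a w"] ker_fam_cong.hyps(2) that by auto
  with d(1) show ?case by blast
qed

lemma ker_fam_has_pd:
  assumes "ker_fam I k" "qf w x \<noteq> 0"
  shows "has_pd (k w) b (partial_deriv b (k w) x) x"
  using ker_fam_has_pd_ex [OF assms(1)] assms(2) has_pd_partial_deriv by metis

lemma ker_fam_pd:
  assumes "ker_fam I k"
  shows "ker_fam I (\<lambda>w. partial_deriv b (k w))"
proof -
  obtain k' where "ker_fam I k'" "\<And>w x. qf w x \<noteq> 0 \<Longrightarrow> has_pd (k w) b (k' w x) x"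
    using ker_fam_has_pd_ex [OF assms] by blast
  then show ?thesis by (elim ker_fam.ker_fam_cong) (simp add: has_pd_partial_deriv)
qed

lemma ker_fam_pd_commute:
  "ker_fam I k \<Longrightarrow> qf w x \<noteq> 0 \<Longrightarrow>
    partial_deriv b (partial_deriv c (k w)) x = partial_deriv c (partial_deriv b (k w)) x"
proof (induction arbitrary: w x rule: ker_fam.induct)
  case (ker_fam_atom a C)
  have "partial_deriv d (\<lambda>x. C * cl_complex I (a w x)) y = C * cl_complex I (partial_deriv d (a w) y)"
    if "qf w y \<noteq> 0" "rat_fam a" for d y a
    by (intro has_pd_partial_deriv has_pd_cl_mult_left has_pd_bounded_linear [OF bounded_linear_cl_complex]
        rat_fam_has_pd that)
  note 1 = this
  have "partial_deriv e (partial_deriv d (\<lambda>x. C * cl_complex I (a w x))) x =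
      C * cl_complex I (partial_deriv e (partial_deriv d (a w)) x)" for d e
  proof -
    have "partial_deriv e (partial_deriv d (\<lambda>x. C * cl_complex I (a w x))) x =
        partial_deriv e (\<lambda>y. C * cl_complex I (partial_deriv d (a w) y)) x"
      by (rule partial_deriv_cong_open [OF open_qf [of w]]) (use ker_fam_atom(2) 1 [OF _ ker_fam_atom(1)] in auto)
    also have "\<dots> = C * cl_complex I (partial_deriv e (partial_deriv d (a w)) x)"
      using 1 [OF ker_fam_atom(2) rat_fam_pd [OF ker_fam_atom(1)]] .
    finally show ?thesis .
  qed
  then show ?case using rat_fam_pd_commute [OF ker_fam_atom] by simp
next
  case (ker_fam_add a1 a2)
  have 1: "partial_deriv d (\<lambda>x. a1 w x + a2 w x) y = partial_deriv d (a1 w) y + partial_deriv d (a2 w) y"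
    if "qf w y \<noteq> 0" for d y
    using that ker_fam_add by (intro has_pd_partial_deriv has_pd_add ker_fam_has_pd)
  have "partial_deriv e (partial_deriv d (\<lambda>x. a1 w x + a2 w x)) x =
      partial_deriv e (partial_deriv d (a1 w)) x + partial_deriv e (partial_deriv d (a2 w)) x" for d e
  proof -
    have "partial_deriv e (partial_deriv d (\<lambda>x. a1 w x + a2 w x)) x =
        partial_deriv e (\<lambda>y. partial_deriv d (a1 w) y + partial_deriv d (a2 w) y) x"
      by (rule partial_deriv_cong_open [OF open_qf [of w]]) (use ker_fam_add 1 in auto)
    also have "\<dots> = partial_deriv e (partial_deriv d (a1 w)) x + partial_deriv e (partial_deriv d (a2 w)) x"
      using ker_fam_add
      by (intro has_pd_partial_deriv has_pd_add ker_fam_has_pd [of I "\<lambda>w. partial_deriv d (a1 w)"]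
          ker_fam_has_pd [of I "\<lambda>w. partial_deriv d (a2 w)"] ker_fam_pd)
    finally show ?thesis .
  qed
  then show ?case using ker_fam_add by simp
next
  case (ker_fam_cong a a')
  have 1: "partial_deriv d (a' w) y = partial_deriv d (a w) y" if "qf w y \<noteq> 0" for d y
    by (rule partial_deriv_cong_open [OF open_qf [of w]]) (use ker_fam_cong that in auto)
  have "partial_deriv e (partial_deriv d (a' w)) x = partial_deriv e (partial_deriv d (a w)) x" for d e
    by (rule partial_deriv_cong_open [OF open_qf [of w]]) (use 1 ker_fam_cong in auto)
  then show ?case using ker_fam_cong by simp
qed

lemma ker_fam_zero: "ker_fam I (\<lambda>w x. 0)"
  using ker_fam_atom [OF rat_fam_const, of I 0] by simp

lemma ker_fam_sum:
  "finite A \<Longrightarrow> (\<And>i. i \<in> A \<Longrightarrow> ker_fam I (k i)) \<Longrightarrow> ker_fam I (\<lambda>w x. \<Sum>i\<in>A. k i w x)"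
  by (induction A rule: finite_induct) (auto intro: ker_fam_zero ker_fam_add)

lemma ker_fam_mult_left: "ker_fam I k \<Longrightarrow> ker_fam I (\<lambda>w x. c * k w x)"
proof (induction rule: ker_fam.induct)
  case (ker_fam_atom a C)
  then show ?case using ker_fam.ker_fam_atom [of a I "c * C"] by (simp add: mult.assoc)
next
  case (ker_fam_add k k')
  then show ?case using ker_fam.ker_fam_add by (simp add: distrib_left)
next
  case (ker_fam_cong k k')
  show ?case by (rule ker_fam.ker_fam_cong [OF ker_fam_cong.IH]) (simp add: ker_fam_cong.hyps)
qed

section \<open>Differential operators with constant coefficients\<close>

text \<open>A common form of D and its conjugate, so that locality, commutation and passage under
  the integral are proved once for both.\<close>

definition cl_op :: "('n point \<Rightarrow> 'n clifford) \<Rightarrow> 'n cl_fun \<Rightarrow> ('n::{finite,linorder}) cl_fun"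
  where "cl_op C f x = (\<Sum>b\<in>Basis. C b * partial_deriv b f x)"

lemma Basis_point:
  "(Basis :: (real \<times> (real ^ ('n::finite))) set) = insert (1, 0) (range (\<lambda>i. (0, axis i 1)))"
  by (auto simp: Basis_prod_def Basis_vec_def)

lemma sum_Basis_point:
  fixes g :: "real \<times> (real ^ ('n::finite)) \<Rightarrow> 'c::comm_monoid_add"
  shows "(\<Sum>b\<in>Basis. g b) = g (1, 0) + (\<Sum>i\<in>UNIV. g (0, axis i 1))"
proof -
  have "inj (\<lambda>i::'n. (0::real, axis i (1::real)))"
    by (auto simp: inj_def axis_eq_axis)
  then show ?thesis
    unfolding Basis_point by (subst sum.insert) (auto simp: sum.reindex)
qed

lemma paravector_1_0: "paravector (1, 0) = 1"
  by (simp add: paravector_def)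

lemma Dirac_left_eq: "Dirac_left = cl_op paravector"
  by (simp add: fun_eq_iff Dirac_left_def cl_op_def sum_Basis_point paravector_axis paravector_1_0)

lemma Dirac_conj_left_eq: "Dirac_conj_left = cl_op (\<lambda>b. paravector (conj_point b))"
proof -
  have "paravector (conj_point (0, axis i 1)) = - cl_e i" for i :: 'a
    using paravector_minus [of "(0, axis i 1)"] by (simp add: conj_point_def paravector_axis)
  then show ?thesis
    by (simp add: fun_eq_iff Dirac_conj_left_def cl_op_def sum_Basis_point conj_point_def paravector_1_0 sum_negf)
qed

lemma ker_fam_cl_op: "ker_fam I k \<Longrightarrow> ker_fam I (\<lambda>w. cl_op C (k w))"
  unfolding cl_op_def by (intro ker_fam_sum ker_fam_mult_left ker_fam_pd finite_Basis)

lemma ker_fam_Laplacian: "ker_fam I k \<Longrightarrow> ker_fam I (\<lambda>w. Laplacian (k w))"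
  unfolding Laplacian_def by (intro ker_fam_sum ker_fam_pd finite_Basis)

text \<open>Constant coefficients and symmetric second derivatives let the operator pass through a
  directional derivative; its commutation with the Laplacian rests on this.\<close>

lemma has_pd_cl_op:
  assumes "ker_fam I k" "qf w x \<noteq> 0"
  shows "has_pd (cl_op C (k w)) b (cl_op C (partial_deriv b (k w)) x) x"
proof -
  have "has_pd (\<lambda>x. \<Sum>c\<in>Basis. C c * partial_deriv c (k w) x) b
      (\<Sum>c\<in>Basis. C c * partial_deriv b (partial_deriv c (k w)) x) x"
    by (intro has_pd_sum has_pd_cl_mult_left ker_fam_has_pd [OF ker_fam_pd [OF assms(1)] assms(2)])
  then show ?thesis
    using ker_fam_pd_commute [OF assms] by (simp add: cl_op_def [abs_def])
qed

lemma cl_op_cong_open: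
  assumes "open S" "x \<in> S" "\<And>y. y \<in> S \<Longrightarrow> f y = g y"
  shows "cl_op C f x = cl_op C g x"
  unfolding cl_op_def using partial_deriv_cong_open [OF assms] by simp

lemma Laplacian_cong_open:
  assumes "open S" "x \<in> S" "\<And>y. y \<in> S \<Longrightarrow> f y = g y"
  shows "Laplacian f x = Laplacian g x"
  unfolding Laplacian_def
  by (intro sum.cong refl partial_deriv_cong_open [OF assms(1,2)] partial_deriv_cong_open [OF assms(1)] assms(3))

lemma Laplacian_cl_op_commute:
  assumes k: "ker_fam I k" and qf: "qf w x \<noteq> 0"
  shows "Laplacian (cl_op C (k w)) x = cl_op C (Laplacian (k w)) x"
proof -
  have "partial_deriv b (partial_deriv b (cl_op C (k w))) x = cl_op C (partial_deriv b (partial_deriv b (k w))) x" for b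
  proof -
    have "partial_deriv b (partial_deriv b (cl_op C (k w))) x = partial_deriv b (cl_op C (partial_deriv b (k w))) x"
      by (rule partial_deriv_cong_open [OF open_qf [of w]])
         (use qf has_pd_partial_deriv [OF has_pd_cl_op [OF k]] in auto)
    also have "\<dots> = cl_op C (partial_deriv b (partial_deriv b (k w))) x"
      by (rule has_pd_partial_deriv [OF has_pd_cl_op [OF ker_fam_pd [OF k] qf]])
    finally show ?thesis .
  qed
  moreover have "cl_op C (Laplacian (k w)) x = (\<Sum>b\<in>Basis. cl_op C (partial_deriv b (partial_deriv b (k w))) x)"
  proof -
    have "partial_deriv c (Laplacian (k w)) x = (\<Sum>b\<in>Basis. partial_deriv c (partial_deriv b (partial_deriv b (k w))) x)" for c
      unfolding Laplacian_def [abs_def]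
      by (intro has_pd_partial_deriv has_pd_sum ker_fam_has_pd [OF ker_fam_pd [OF ker_fam_pd [OF k]]] qf)
    then show ?thesis
      unfolding cl_op_def by (simp add: sum_distrib_left) (rule sum.swap)
  qed
  ultimately show ?thesis by (simp add: Laplacian_def)
qed

text \<open>The double sum over basis vectors is added to its transpose, which equals it because
  \<open>M\<close> is symmetric. The symmetrized coefficients are the scalars 2 (b \<bullet> c), so
  only the diagonal survives, twice.\<close>

lemma Dirac_conj_Dirac:
  assumes k: "ker_fam I k" and qf: "qf w x \<noteq> 0"
  shows "Dirac_conj_left (Dirac_left (k w)) x = Laplacian (k w) x"
proof -
  define M where "M b c = partial_deriv b (partial_deriv c (k w)) x" for b c
  have sym: "M b c = M c b" for b c
    unfolding M_def by (rule ker_fam_pd_commute [OF k qf])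
  have pd: "partial_deriv b (cl_op paravector (k w)) x = (\<Sum>c\<in>Basis. paravector c * M b c)" for b
    using has_pd_partial_deriv [OF has_pd_cl_op [OF k qf]] by (simp add: cl_op_def sym) (simp add: M_def)
  have "Dirac_conj_left (Dirac_left (k w)) x =
      (\<Sum>b\<in>Basis. \<Sum>c\<in>Basis. paravector (conj_point b) * paravector c * M b c)" (is "?L = ?S")
    by (simp add: Dirac_conj_left_eq Dirac_left_eq cl_op_def [of "\<lambda>b. paravector (conj_point b)"] pd
        sum_distrib_left mult.assoc)
  moreover have "?S = (\<Sum>b\<in>Basis. \<Sum>c\<in>Basis. paravector (conj_point c) * paravector b * M b c)"
    by (subst sum.swap) (simp add: sym)
  ultimately have "?L + ?L = (\<Sum>b\<in>Basis. \<Sum>c\<in>Basis.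
      (paravector (conj_point b) * paravector c + paravector (conj_point c) * paravector b) * M b c)"
    by (simp add: distrib_right sum.distrib)
  also have "\<dots> = (\<Sum>b\<in>Basis. \<Sum>c\<in>Basis. if c = b then 2 *\<^sub>R M b b else 0)"
  proof (intro sum.cong refl)
    fix b c :: "'a point"
    assume "b \<in> Basis" "c \<in> Basis"
    then have bc: "b \<bullet> c = (if c = b then 1 else 0)" by (simp add: inner_Basis)
    have "of_real (2 * (b \<bullet> c)) * M b c = (if c = b then 2 *\<^sub>R M b b else 0)"
      unfolding bc of_real_def by (cases "c = b") simp_all
    then show "(paravector (conj_point b) * paravector c + paravector (conj_point c) * paravector b) * M b c =
        (if c = b then 2 *\<^sub>R M b b else 0)"
      by (simp only: paravector_conj_polar)
  qed
  also have "\<dots> = 2 *\<^sub>R (\<Sum>b\<in>Basis. M b b)"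
    by (simp add: scaleR_sum_right)
  finally have "2 *\<^sub>R ?L = 2 *\<^sub>R (\<Sum>b\<in>Basis. M b b)" by (simp add: scaleR_2)
  then have "?L = (\<Sum>b\<in>Basis. M b b)" by (simp only: scaleR_cancel_left) simp
  then show ?thesis by (simp add: Laplacian_def M_def)
qed

text \<open>Kernel identities hold off a sphere only. Locality is what allows one of them to be used
  underneath further operators, and it passes to compositions and iterates.\<close>

definition local_op :: "(('n::{finite,linorder}) cl_fun \<Rightarrow> 'n cl_fun) \<Rightarrow> bool"
  where "local_op L \<longleftrightarrow> (\<forall>S f g x. open S \<longrightarrow> x \<in> S \<longrightarrow> (\<forall>y\<in>S. f y = g y) \<longrightarrow> L f x = L g x)"

lemma local_opD: "local_op L \<Longrightarrow> open S \<Longrightarrow> x \<in> S \<Longrightarrow> (\<And>y. y \<in> S \<Longrightarrow> f y = g y) \<Longrightarrow> L f x = L g x"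
  unfolding local_op_def by blast

lemma local_op_id: "local_op (\<lambda>f. f)"
  by (auto simp: local_op_def)

lemma local_op_comp:
  assumes "local_op L" "local_op M"
  shows "local_op (\<lambda>f. L (M f))"
  unfolding local_op_def
proof (intro allI impI)
  fix S and f g :: "'a cl_fun" and x
  assume S: "open S" "x \<in> S" "\<forall>y\<in>S. f y = g y"
  have "M f y = M g y" if "y \<in> S" for y
    using S that by (intro local_opD [OF assms(2), of S]) auto
  then show "L (M f) x = L (M g) x"
    using S by (intro local_opD [OF assms(1), of S]) auto
qed

lemma local_op_funpow: "local_op L \<Longrightarrow> local_op (L ^^ j)"
  by (induction j) (simp_all add: local_op_comp local_op_id id_def comp_def)

lemma local_op_cl_op: "local_op (cl_op C)"
  unfolding local_op_def using cl_op_cong_open by blast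

lemma local_op_Laplacian: "local_op Laplacian"
  unfolding local_op_def using Laplacian_cong_open by blast

section \<open>The Cauchy kernel\<close>

lemma sum_Basis_inner_paravector:
  "(\<Sum>b\<in>Basis. (y \<bullet> b) *\<^sub>R paravector b) = paravector y"
  by (simp add: euclidean_representation linear_sum [OF linear_paravector, symmetric]
      flip: paravector_scaleR)

lemma has_pd_power:
  fixes f :: "'a::euclidean_space \<Rightarrow> 'b::real_normed_field"
  assumes "has_pd f b d x"
  shows "has_pd (\<lambda>x. f x ^ k) b (of_nat k * f x ^ (k - 1) * d) x"
proof (induction k)
  case 0
  show ?case using has_pd_const [of 1 b x] by simp
next
  case (Suc k)
  have "has_pd (\<lambda>x. f x * f x ^ k) b (f x * (of_nat k * f x ^ (k - 1) * d) + d * f x ^ k) x"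
    by (intro has_pd_mult assms Suc)
  moreover have "f x * (of_nat k * f x ^ (k - 1) * d) + d * f x ^ k = of_nat (Suc k) * f x ^ (Suc k - 1) * d"
    by (cases k) (simp_all add: algebra_simps)
  ultimately show ?case by simp
qed

definition tq :: "nat \<Rightarrow> nat \<Rightarrow> complex \<Rightarrow> ('n::finite) point \<Rightarrow> complex"
  where "tq i l w x = (w - of_real (fst x)) ^ i * inverse (qf w x) ^ l"

lemma rat_fam_tq: "rat_fam (tq i l)"
proof -
  have "rat_fam (\<lambda>w x. (w - of_real (fst x)) ^ i * inverse (qf w x) ^ l)"
    by (intro rat_fam_mult rat_fam_power rat_fam_diff rat_fam_param rat_fam_fst rat_fam_inverse)
  then show ?thesis by (simp add: tq_def [abs_def])
qed

text \<open>The gradient has a real part and a part parallel to the vector part of x; this shape is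
  what the formulas for D below take as their premise. For \<open>i = 0\<close> the truncated
  exponent \<open>i - 1\<close> carries the factor zero.\<close>

lemma has_pd_tq:
  assumes "qf w x \<noteq> 0"
  shows "has_pd (tq i l w) b
    (of_real (fst b) * (2 * of_nat l * tq (i + 1) (l + 1) w x - of_nat i * tq (i - 1) l w x) +
     of_real (snd x \<bullet> snd b) * (- 2 * of_nat l * tq i (l + 1) w x)) x"
proof -
  define q' where "q' = of_real (2 * (snd x \<bullet> snd b)) - 2 * of_real (fst b) * (w - of_real (fst x))"
  have t: "has_pd (\<lambda>y. w - of_real (fst y)) b (- of_real (fst b)) x"
    using has_pd_diff [OF has_pd_const has_pd_bounded_linear
        [OF bounded_linear_compose [OF bounded_linear_of_real bounded_linear_fst] has_pd_ident], of w b x]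
    by simp
  have "has_pd (\<lambda>y. (w - of_real (fst y)) ^ i * inverse (qf w y) ^ l) b
      ((w - of_real (fst x)) ^ i * (of_nat l * inverse (qf w x) ^ (l - 1) * - (inverse (qf w x) * inverse (qf w x) * q')) +
       (of_nat i * (w - of_real (fst x)) ^ (i - 1) * - of_real (fst b)) * inverse (qf w x) ^ l) x"
    unfolding q'_def by (intro has_pd_mult has_pd_power t has_pd_inverse has_pd_qf assms)
  moreover have "(w - of_real (fst x)) ^ i *
        (of_nat l * inverse (qf w x) ^ (l - 1) * - (inverse (qf w x) * inverse (qf w x) * q')) +
       (of_nat i * (w - of_real (fst x)) ^ (i - 1) * - of_real (fst b)) * inverse (qf w x) ^ l =
    of_real (fst b) * (2 * of_nat l * tq (i + 1) (l + 1) w x - of_nat i * tq (i - 1) l w x) +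
    of_real (snd x \<bullet> snd b) * (- 2 * of_nat l * tq i (l + 1) w x)"
    by (cases l) (simp_all add: tq_def q'_def algebra_simps)
  ultimately show ?thesis
    by (simp only: tq_def [abs_def])
qed

text \<open>A gradient with real part p and vector part r v, where v is the vector part of x, is
  summed against the basis: the expansion of the points (1, 0) and (0, v) in the basis turns the two
  sums into 1 and v.\<close>

lemma Dirac_left_cl_complex:
  assumes "\<And>b. has_pd a b (of_real (fst b) * p + of_real (snd x \<bullet> snd b) * r) x"
  shows "Dirac_left (\<lambda>x. cl_complex I (a x)) x = cl_complex I p + paravector (0, snd x) * cl_complex I r"
proof -
  have "partial_deriv b (\<lambda>x. cl_complex I (a x)) x =
      ((1, 0) \<bullet> b) *\<^sub>R cl_complex I p + ((0, snd x) \<bullet> b) *\<^sub>R cl_complex I r" for b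
    using has_pd_partial_deriv [OF has_pd_bounded_linear [OF bounded_linear_cl_complex assms]]
    by (simp add: cl_complex_add cl_complex_scaleR inner_prod_def flip: scaleR_conv_of_real)
  then have "Dirac_left (\<lambda>x. cl_complex I (a x)) x =
      (\<Sum>b\<in>Basis. ((1, 0) \<bullet> b) *\<^sub>R paravector b) * cl_complex I p +
      (\<Sum>b\<in>Basis. ((0, snd x) \<bullet> b) *\<^sub>R paravector b) * cl_complex I r"
    by (simp add: Dirac_left_eq cl_op_def algebra_simps sum.distrib sum_distrib_left sum_distrib_right)
  then show ?thesis by (simp add: sum_Basis_inner_paravector paravector_1_0)
qed

lemma has_pd_paravector_snd:
  fixes x :: "('n::{finite,linorder}) point"
  shows "has_pd (\<lambda>x. paravector (0, snd x)) b (paravector (0, snd b)) x"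
proof -
  have "bounded_linear (\<lambda>x :: 'n point. paravector (0, snd x))"
    by (intro linear_conv_bounded_linear [THEN iffD1] linearI)
       (simp_all flip: paravector_add paravector_scaleR)
  from has_pd_bounded_linear [OF this has_pd_ident] show ?thesis .
qed

text \<open>The dimension enters here. By the product rule there are two kinds of terms: v v r = -
  |v|^2 r from differentiating a, and the sum of the squares of the n generators, - n, from
  differentiating v.\<close>

lemma Dirac_left_vec_cl_complex:
  fixes x :: "('n::{finite,linorder}) point"
  assumes "\<And>b. has_pd a b (of_real (fst b) * p + of_real (snd x \<bullet> snd b) * r) x"
  shows "Dirac_left (\<lambda>x. paravector (0, snd x) * cl_complex I (a x)) x =
    paravector (0, snd x) * cl_complex I p -
    cl_complex I (of_nat CARD('n) * a x + of_real ((norm (snd x))\<^sup>2) * r)"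
proof -
  define X where "X = paravector (0, snd x)"
  have "partial_deriv b (\<lambda>x. paravector (0, snd x) * cl_complex I (a x)) x =
      X * cl_complex I (of_real (fst b) * p + of_real (snd x \<bullet> snd b) * r) +
      paravector (0, snd b) * cl_complex I (a x)" for b
    unfolding X_def
    by (intro has_pd_partial_deriv has_pd_bilinear [OF clifford_bounded_bilinear] has_pd_paravector_snd
        has_pd_bounded_linear [OF bounded_linear_cl_complex] assms)
  then have pd: "partial_deriv b (\<lambda>x. paravector (0, snd x) * cl_complex I (a x)) x =
      ((1, 0) \<bullet> b) *\<^sub>R (X * cl_complex I p) + ((0, snd x) \<bullet> b) *\<^sub>R (X * cl_complex I r) +
      paravector (0, snd b) * cl_complex I (a x)" for b
    by (simp add: cl_complex_add cl_complex_scaleR inner_prod_def distrib_left flip: scaleR_conv_of_real)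
  have "Dirac_left (\<lambda>x. paravector (0, snd x) * cl_complex I (a x)) x =
      (\<Sum>b\<in>Basis. ((1, 0) \<bullet> b) *\<^sub>R paravector b) * (X * cl_complex I p) +
      (\<Sum>b\<in>Basis. ((0, snd x) \<bullet> b) *\<^sub>R paravector b) * (X * cl_complex I r) +
      (\<Sum>b\<in>Basis. paravector b * paravector (0, snd b)) * cl_complex I (a x)"
    unfolding Dirac_left_eq cl_op_def pd
    by (simp add: distrib_left sum.distrib sum_distrib_right mult.assoc)
  moreover have "(\<Sum>b :: 'n point\<in>Basis. paravector b * paravector (0, snd b)) = - of_nat CARD('n)"
  proof -
    have "cl_e i * cl_e i = - 1" for i :: 'n
      using paravector_square [of "axis i 1 :: (real, 'n) vec"] by (simp add: paravector_axis)
    then show ?thesis by (simp add: sum_Basis_point paravector_axis flip: zero_prod_def)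
  qed
  moreover have "X * (X * cl_complex I r) = - cl_complex I (of_real ((norm (snd x))\<^sup>2) * r)"
    using paravector_square [of "snd x"]
    by (simp add: X_def cl_complex_scaleR flip: mult.assoc scaleR_conv_of_real of_real_power)
  moreover have "cl_complex I (of_nat CARD('n) * a x) = of_nat CARD('n) * cl_complex I (a x)"
    using cl_complex_scaleR [of I "of_nat CARD('n)" "a x"] by (simp add: scaleR_conv_of_real)
  ultimately show ?thesis
    by (simp add: sum_Basis_inner_paravector paravector_1_0 cl_complex_add) (simp add: X_def)
qed

text \<open>
  The span of the paper's kernels \<open>K\<^sup>1\<close>, \<open>K\<^sup>2\<close>: since \<open>s - conj x = (s - x\<^sub>0) + (vector part of x)\<close>,
  \<open>K\<^sup>1\<close> with indices \<open>i, l\<close> is \<open>tq (i + 1) l\<close> plus the vector part times \<open>tq i l\<close>. Families are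
  compared only where \<^const>\<open>qf\<close> does not vanish.
\<close>

inductive axial_fam :: "real ^ ('n::{finite,linorder}) \<Rightarrow> (complex \<Rightarrow> 'n cl_fun) \<Rightarrow> bool" for I where
  axial_fam_scal: "axial_fam I (\<lambda>w x. cl_complex I (tq i l w x))"
| axial_fam_vec: "axial_fam I (\<lambda>w x. paravector (0, snd x) * cl_complex I (tq i l w x))"
| axial_fam_add: "axial_fam I k \<Longrightarrow> axial_fam I k' \<Longrightarrow> axial_fam I (\<lambda>w x. k w x + k' w x)"
| axial_fam_scaleR: "axial_fam I k \<Longrightarrow> axial_fam I (\<lambda>w x. r *\<^sub>R k w x)"
| axial_fam_cong: "axial_fam I k \<Longrightarrow> (\<And>w x. qf w x \<noteq> 0 \<Longrightarrow> k' w x = k w x) \<Longrightarrow> axial_fam I k'"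

lemma ker_fam_scaleR: "ker_fam I k \<Longrightarrow> ker_fam I (\<lambda>w x. r *\<^sub>R k w x)"
  using ker_fam_mult_left [of I k "of_real r"] by (simp add: scaleR_conv_of_real)

lemma ker_fam_cl_complex: "rat_fam a \<Longrightarrow> ker_fam I (\<lambda>w x. cl_complex I (a w x))"
  using ker_fam_atom [of a I 1] by simp

lemma ker_fam_vec:
  assumes "rat_fam a"
  shows "ker_fam I (\<lambda>w x. paravector (0, snd x) * cl_complex I (a w x))"
proof -
  have "ker_fam I (\<lambda>w x. \<Sum>i\<in>UNIV. cl_e i * cl_complex I (of_real (x \<bullet> (0, axis i 1)) * a w x))"
    by (intro ker_fam_sum ker_fam_atom rat_fam_mult rat_fam_coord assms) auto
  moreover have "(\<Sum>i\<in>UNIV. cl_e i * cl_complex I (of_real (x \<bullet> (0, axis i 1)) * a w x)) =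
      paravector (0, snd x) * cl_complex I (a w x)" for w x
    by (simp add: paravector_def sum_distrib_right inner_prod_def inner_axis cl_complex_scaleR
        flip: scaleR_conv_of_real)
  ultimately show ?thesis by simp
qed

lemma axial_fam_imp_ker_fam: "axial_fam I k \<Longrightarrow> ker_fam I k"
  by (induction rule: axial_fam.induct)
     (auto intro: ker_fam_cl_complex ker_fam_vec rat_fam_tq ker_fam_add ker_fam_scaleR ker_fam_cong)

lemma cl_op_add:
  assumes "ker_fam I k" "ker_fam I k'" "qf w x \<noteq> 0"
  shows "cl_op C (\<lambda>x. k w x + k' w x) x = cl_op C (k w) x + cl_op C (k' w) x"
proof -
  have "partial_deriv b (\<lambda>x. k w x + k' w x) x = partial_deriv b (k w) x + partial_deriv b (k' w) x" for b
    by (intro has_pd_partial_deriv has_pd_add ker_fam_has_pd [OF assms(1,3)] ker_fam_has_pd [OF assms(2,3)])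
  then show ?thesis by (simp add: cl_op_def distrib_left sum.distrib)
qed

lemma cl_op_scaleR:
  assumes "ker_fam I k" "qf w x \<noteq> 0"
  shows "cl_op C (\<lambda>x. r *\<^sub>R k w x) x = r *\<^sub>R cl_op C (k w) x"
proof -
  have "partial_deriv b (\<lambda>x. r *\<^sub>R k w x) x = r *\<^sub>R partial_deriv b (k w) x" for b
    by (intro has_pd_partial_deriv has_pd_scaleR ker_fam_has_pd [OF assms])
  then show ?thesis by (simp add: cl_op_def scaleR_sum_right)
qed

lemma Dirac_left_tq:
  assumes "qf w x \<noteq> 0"
  shows "Dirac_left (\<lambda>x. cl_complex I (tq i l w x)) x =
    (2 * real l) *\<^sub>R cl_complex I (tq (i + 1) (l + 1) w x) - real i *\<^sub>R cl_complex I (tq (i - 1) l w x) -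
    (2 * real l) *\<^sub>R (paravector (0, snd x) * cl_complex I (tq i (l + 1) w x))"
proof -
  have s: "cl_complex I (2 * of_nat l * z) = (2 * real l) *\<^sub>R cl_complex I z"
    "cl_complex I (- 2 * of_nat l * z) = - ((2 * real l) *\<^sub>R cl_complex I z)"
    "cl_complex I (of_nat l * z) = real l *\<^sub>R cl_complex I z" for z l
    using cl_complex_scaleR [of I "2 * real l" z] cl_complex_scaleR [of I "- 2 * real l" z]
      cl_complex_scaleR [of I "real l" z]
    by (simp_all add: scaleR_conv_of_real)
  show ?thesis
    unfolding Dirac_left_cl_complex [OF has_pd_tq [OF assms]] cl_complex_diff s by simp
qed

text \<open>The factor |v|^2 produced by v v is rewritten as Q - t^2 with t = w - x0. Thus the
  result stays in the span of t^i / Q^l and v t^i / Q^l.\<close>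

lemma Dirac_left_vec_tq:
  fixes x :: "('n::{finite,linorder}) point"
  assumes "qf w x \<noteq> 0"
  shows "Dirac_left (\<lambda>x. paravector (0, snd x) * cl_complex I (tq i l w x)) x =
    (2 * real l) *\<^sub>R (paravector (0, snd x) * cl_complex I (tq (i + 1) (l + 1) w x)) -
    real i *\<^sub>R (paravector (0, snd x) * cl_complex I (tq (i - 1) l w x)) +
    (2 * real l - CARD('n)) *\<^sub>R cl_complex I (tq i l w x) -
    (2 * real l) *\<^sub>R cl_complex I (tq (i + 2) (l + 1) w x)"
proof -
  have s: "cl_complex I (of_real r * z) = r *\<^sub>R cl_complex I z" for z r
    using cl_complex_scaleR [of I r z] by (simp add: scaleR_conv_of_real)
  have t: "of_real ((norm (snd x))\<^sup>2) * tq i (l + 1) w x = tq i l w x - tq (i + 2) (l + 1) w x"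
  proof -
    have N: "of_real ((norm (snd x))\<^sup>2) = qf w x - (w - of_real (fst x))\<^sup>2" by (simp add: qf_def)
    show ?thesis
      unfolding N tq_def power_add [of _ i 2] using assms by (simp add: left_diff_distrib right_diff_distrib mult_ac)
  qed
  have n: "of_nat CARD('n) * tq i l w x + of_real ((norm (snd x))\<^sup>2) * (- 2 * of_nat l * tq i (l + 1) w x) =
     of_real (2 * real l) * tq (i + 2) (l + 1) w x - of_real (2 * real l - CARD('n)) * tq i l w x"
  proof -
    have "of_real ((norm (snd x))\<^sup>2) * (- 2 * of_nat l * tq i (l + 1) w x) =
        - 2 * of_nat l * (of_real ((norm (snd x))\<^sup>2) * tq i (l + 1) w x)"
      by (simp only: mult_ac)
    then show ?thesis unfolding t by (simp add: algebra_simps)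
  qed
  have p: "2 * of_nat l * tq (i + 1) (l + 1) w x - of_nat i * tq (i - 1) l w x =
      of_real (2 * real l) * tq (i + 1) (l + 1) w x - of_real (real i) * tq (i - 1) l w x"
    by simp
  show ?thesis
    unfolding Dirac_left_vec_cl_complex [OF has_pd_tq [OF assms]] n p cl_complex_diff s
    by (simp add: algebra_simps)
qed

lemma axial_fam_diff: "axial_fam I k \<Longrightarrow> axial_fam I k' \<Longrightarrow> axial_fam I (\<lambda>w x. k w x - k' w x)"
  using axial_fam_add [OF _ axial_fam_scaleR, of I k k' "-1"] by simp

lemma axial_fam_Dirac_left: "axial_fam I k \<Longrightarrow> axial_fam I (\<lambda>w. Dirac_left (k w))"
proof (induction rule: axial_fam.induct)
  case (axial_fam_scal i l)
  show ?case
    by (rule axial_fam_cong [OF _ Dirac_left_tq])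
       (intro axial_fam_diff axial_fam_scaleR axial_fam.axial_fam_scal axial_fam.axial_fam_vec | assumption)+
next
  case (axial_fam_vec i l)
  show ?case
    by (rule axial_fam_cong [OF _ Dirac_left_vec_tq])
       (intro axial_fam_diff axial_fam.axial_fam_add axial_fam_scaleR axial_fam.axial_fam_scal
          axial_fam.axial_fam_vec | assumption)+
next
  case (axial_fam_add k k')
  show ?case
    by (rule axial_fam_cong [OF axial_fam.axial_fam_add [OF axial_fam_add.IH]])
       (simp add: Dirac_left_eq cl_op_add [OF axial_fam_add.hyps [THEN axial_fam_imp_ker_fam]])
next
  case (axial_fam_scaleR k r)
  show ?case
    by (rule axial_fam_cong [OF axial_fam.axial_fam_scaleR [OF axial_fam_scaleR.IH, of r]])
       (simp add: Dirac_left_eq cl_op_scaleR [OF axial_fam_scaleR.hyps [THEN axial_fam_imp_ker_fam]])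
next
  case (axial_fam_cong k k')
  have "Dirac_left (k' w) x = Dirac_left (k w) x" if "qf w x \<noteq> 0" for w x
    unfolding Dirac_left_eq
    by (rule cl_op_cong_open [OF open_qf [of w]]) (use that axial_fam_cong.hyps in auto)
  then show ?case by (rule axial_fam.axial_fam_cong [OF axial_fam_cong.IH])
qed

lemma axial_fam_Dirac_left_funpow: "axial_fam I k \<Longrightarrow> axial_fam I (\<lambda>w. (Dirac_left ^^ j) (k w))"
  by (induction j) (simp_all add: axial_fam_Dirac_left)

text \<open>The squared gradient of Q is 4 Q, because t^2 + |v|^2 = Q, and the Laplacian of Q is 2
  (n + 1). Together they give 2 l (2 (l + 1) - (n + 1)), the constant of the statement.\<close>

lemma Laplacian_tq:
  fixes x :: "('n::{finite,linorder}) point"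
  assumes "qf w x \<noteq> 0"
  shows "Laplacian (\<lambda>x. cl_complex I (tq 0 l w x)) x =
    (2 * real l * (2 * real l + 1 - CARD('n))) *\<^sub>R cl_complex I (tq 0 (l + 1) w x)"
proof -
  define P where "P b y = of_real (fst b) * (2 * of_nat l * tq 1 (l + 1) w y) -
    of_real (snd y \<bullet> snd b) * (2 * of_nat l * tq 0 (l + 1) w y)" for b y :: "'n point"
  have 1: "has_pd (tq 0 l w) b (P b y) y" if "qf w y \<noteq> 0" for b y
    using has_pd_tq [OF that, of 0 l b] by (simp add: P_def)
  have 2: "has_pd (P b) b
      (of_real (fst b) * (2 * of_nat l *
        (of_real (fst b) * (2 * of_nat (l + 1) * tq 2 (l + 2) w x - tq 0 (l + 1) w x) +
         of_real (snd x \<bullet> snd b) * (- 2 * of_nat (l + 1) * tq 1 (l + 2) w x))) -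
       (of_real (snd x \<bullet> snd b) * (2 * of_nat l *
        (of_real (fst b) * (2 * of_nat (l + 1) * tq 1 (l + 2) w x) +
         of_real (snd x \<bullet> snd b) * (- 2 * of_nat (l + 1) * tq 0 (l + 2) w x))) +
        of_real (snd b \<bullet> snd b) * (2 * of_nat l * tq 0 (l + 1) w x))) x" (is "has_pd _ _ (?S b) _") for b
  proof -
    have t1: "has_pd (tq 1 (l + 1) w) b
      (of_real (fst b) * (2 * of_nat (l + 1) * tq 2 (l + 2) w x - tq 0 (l + 1) w x) +
         of_real (snd x \<bullet> snd b) * (- 2 * of_nat (l + 1) * tq 1 (l + 2) w x)) x"
      using has_pd_tq [OF assms, of 1 "l + 1" b] by (simp add: numeral_2_eq_2)
    have t0: "has_pd (tq 0 (l + 1) w) b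
      (of_real (fst b) * (2 * of_nat (l + 1) * tq 1 (l + 2) w x) +
         of_real (snd x \<bullet> snd b) * (- 2 * of_nat (l + 1) * tq 0 (l + 2) w x)) x"
      using has_pd_tq [OF assms, of 0 "l + 1" b] by (simp add: numeral_2_eq_2)
    have s: "has_pd (\<lambda>y. complex_of_real (snd y \<bullet> snd b)) b (of_real (snd b \<bullet> snd b)) x"
      using has_pd_coord [of "(0, snd b)" b x] by (simp add: inner_prod_def)
    have c: "has_pd (\<lambda>y. c * g y) b (c * d) x" if "has_pd g b d x" for c :: complex and g d
      using has_pd_bounded_linear [OF bounded_linear_mult_right that] .
    show ?thesis
      unfolding P_def by (intro has_pd_diff has_pd_mult c t0 t1 s)
  qed
  have "partial_deriv b (partial_deriv b (\<lambda>x. cl_complex I (tq 0 l w x))) x = cl_complex I (?S b)" for b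
  proof -
    have "partial_deriv b (partial_deriv b (\<lambda>x. cl_complex I (tq 0 l w x))) x =
        partial_deriv b (\<lambda>y. cl_complex I (P b y)) x"
      by (rule partial_deriv_cong_open [OF open_qf [of w]])
         (use assms in \<open>auto intro: has_pd_partial_deriv has_pd_bounded_linear [OF bounded_linear_cl_complex 1]\<close>)
    also have "\<dots> = cl_complex I (?S b)"
      by (rule has_pd_partial_deriv [OF has_pd_bounded_linear [OF bounded_linear_cl_complex 2]])
    finally show ?thesis .
  qed
  then have "Laplacian (\<lambda>x. cl_complex I (tq 0 l w x)) x = cl_complex I (\<Sum>b\<in>Basis. ?S b)"
    by (simp add: Laplacian_def cl_complex_sum)
  also have "(\<Sum>b\<in>Basis. ?S b) = of_real (2 * real l * (2 * real l + 1 - CARD('n))) * tq 0 (l + 1) w x"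
  proof -
    define u where "u = inverse (qf w x) ^ (l + 1)"
    define N where "N = complex_of_real ((norm (snd x))\<^sup>2)"
    have u: "tq 0 (l + 1) w x = u" by (simp add: u_def tq_def)
    \<comment> \<open>After this substitution for t^2 the terms containing \<open>N\<close>
      cancel.\<close>
    have v: "tq 2 (l + 2) w x = u - N * tq 0 (l + 2) w x"
    proof -
      have sq: "(w - of_real (fst x))\<^sup>2 = qf w x - N" by (simp add: qf_def N_def)
      show ?thesis
        unfolding tq_def u_def sq using assms by (simp add: left_diff_distrib right_diff_distrib mult_ac)
    qed
    have N: "(\<Sum>i\<in>UNIV. complex_of_real (snd x $ i) * complex_of_real (snd x $ i)) = N"
      by (simp add: N_def power2_norm_eq_inner inner_vec_def)
    \<comment> \<open>Each basis vector is either the real axis or a vector direction, so the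
      products mixing the two parts of b drop out.\<close>
    have "(\<Sum>b\<in>Basis. ?S b) = 2 * of_nat l * (2 * of_nat (l + 1) * tq 2 (l + 2) w x - u) +
        (\<Sum>i\<in>UNIV. complex_of_real (snd x $ i) * complex_of_real (snd x $ i) * (4 * of_nat l * of_nat (l + 1) * tq 0 (l + 2) w x) -
          2 * of_nat l * u)"
      unfolding sum_Basis_point u by (simp add: inner_axis algebra_simps)
    also have "\<dots> = 2 * of_nat l * (2 * of_nat (l + 1) * tq 2 (l + 2) w x - u) +
        (N * (4 * of_nat l * of_nat (l + 1) * tq 0 (l + 2) w x) - of_nat CARD('n) * (2 * of_nat l * u))"
      by (simp add: sum_subtractf N flip: sum_distrib_right)
    also have "\<dots> = of_real (2 * real l * (2 * real l + 1 - CARD('n))) * u"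
      unfolding v by (simp add: algebra_simps)
    finally show ?thesis by (simp only: u)
  qed
  finally show ?thesis
    by (simp only: cl_complex_scaleR flip: scaleR_conv_of_real)
qed

lemma Laplacian_scaleR:
  assumes "ker_fam I k" "qf w x \<noteq> 0"
  shows "Laplacian (\<lambda>x. r *\<^sub>R k w x) x = r *\<^sub>R Laplacian (k w) x"
proof -
  have 1: "partial_deriv b (\<lambda>x. r *\<^sub>R k w x) x = r *\<^sub>R partial_deriv b (k w) x"
    if "ker_fam I k" "qf w x \<noteq> 0" for b k x
    by (intro has_pd_partial_deriv has_pd_scaleR ker_fam_has_pd [OF that])
  have "partial_deriv b (partial_deriv b (\<lambda>x. r *\<^sub>R k w x)) x =
      partial_deriv b (\<lambda>x. r *\<^sub>R partial_deriv b (k w) x) x" for b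
    by (rule partial_deriv_cong_open [OF open_qf [of w]]) (use assms 1 in auto)
  also have "\<dots> b = r *\<^sub>R partial_deriv b (partial_deriv b (k w)) x" for b
    by (rule 1 [OF ker_fam_pd [OF assms(1)] assms(2)])
  finally show ?thesis by (simp add: Laplacian_def scaleR_sum_right)
qed

lemma Laplacian_funpow_tq:
  fixes x :: "('n::{finite,linorder}) point"
  assumes "qf w x \<noteq> 0"
  shows "(Laplacian ^^ m) (\<lambda>x. r *\<^sub>R cl_complex I (tq 0 1 w x)) x =
    (r * (\<Prod>l=1..m. 2 * real l * (2 * real l + 1 - CARD('n)))) *\<^sub>R cl_complex I (tq 0 (m + 1) w x)"
proof -
  define F where "F l = 2 * real l * (2 * real l + 1 - CARD('n))" for l
  have "(Laplacian ^^ m) (\<lambda>x. r *\<^sub>R cl_complex I (tq 0 1 w x)) x =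
      (r * (\<Prod>l=1..m. F l)) *\<^sub>R cl_complex I (tq 0 (m + 1) w x)"
    using assms
  proof (induction m arbitrary: x)
    case (Suc m)
    define c where "c = r * (\<Prod>l=1..m. F l)"
    have "(Laplacian ^^ Suc m) (\<lambda>x. r *\<^sub>R cl_complex I (tq 0 1 w x)) x =
        Laplacian (\<lambda>x. c *\<^sub>R cl_complex I (tq 0 (m + 1) w x)) x"
      unfolding funpow.simps comp_def
      by (rule Laplacian_cong_open [OF open_qf [of w]]) (use Suc in \<open>auto simp: c_def\<close>)
    also have "\<dots> = c *\<^sub>R Laplacian (\<lambda>x. cl_complex I (tq 0 (m + 1) w x)) x"
      by (rule Laplacian_scaleR [OF ker_fam_cl_complex [OF rat_fam_tq] Suc.prems])
    also have "\<dots> = c *\<^sub>R F (m + 1) *\<^sub>R cl_complex I (tq 0 (Suc m + 1) w x)"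
      unfolding Laplacian_tq [OF Suc.prems] F_def by simp
    finally show ?case by (simp add: c_def mult_ac)
  qed simp
  then show ?thesis by (simp only: F_def)
qed

section \<open>Iterated operators on the Cauchy kernel\<close>

definition kern :: "real ^ ('n::{finite,linorder}) \<Rightarrow> complex \<Rightarrow> 'n cl_fun"
  where "kern I w = S_left (slice_point I w)"

lemma Q_c_slice_point:
  assumes "norm I = 1"
  shows "Q_c (slice_point I w) x = cl_complex I (qf w x)"
proof -
  have n: "(norm x)\<^sup>2 = (fst x)\<^sup>2 + (norm (snd x))\<^sup>2"
    unfolding power2_norm_eq_inner inner_prod_def by (simp add: power2_eq_square)
  have "qf w x = w * w - of_real (2 * fst x) * w + of_real ((norm x)\<^sup>2)"
    unfolding qf_def n by (simp add: power2_eq_square algebra_simps)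
  then show ?thesis
    by (simp add: Q_c_def paravector_slice_point cl_complex_add cl_complex_diff cl_complex_mult [OF assms]
        cl_complex_of_real power2_eq_square del: of_real_mult of_real_power)
qed

lemma cl_inverse_cl_complex:
  assumes "norm I = 1" "z \<noteq> 0"
  shows "cl_inverse (cl_complex I z) = cl_complex I (inverse z)"
  unfolding cl_inverse_def
proof (rule the_equality)
  show *: "cl_complex I z * cl_complex I (inverse z) = 1 \<and> cl_complex I (inverse z) * cl_complex I z = 1"
    using assms(2) by (simp add: cl_complex_1 flip: cl_complex_mult [OF assms(1)])
  show "b = cl_complex I (inverse z)" if "cl_complex I z * b = 1 \<and> b * cl_complex I z = 1" for b
    using * that by (metis mult.assoc mult_1_left mult_1_right)
qed

lemma kern_eq:
  assumes "norm I = 1" "qf w x \<noteq> 0"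
  shows "kern I w x = cl_complex I (tq 1 1 w x) + paravector (0, snd x) * cl_complex I (tq 0 1 w x)"
proof -
  have "paravector (conj_point x) = of_real (fst x) - paravector (0, snd x)"
    using paravector_split [of "conj_point x"] paravector_minus [of "(0, snd x)"]
    by (simp add: conj_point_def)
  then have "kern I w x = (cl_complex I (w - of_real (fst x)) + paravector (0, snd x)) * cl_complex I (inverse (qf w x))"
    by (simp add: kern_def S_left_def Q_c_slice_point assms cl_inverse_cl_complex paravector_slice_point
        cl_complex_diff cl_complex_of_real diff_diff_eq2 add_diff_eq diff_add_eq)
  then show ?thesis
    by (simp add: tq_def distrib_right cl_complex_mult [OF assms(1)])
qed

lemma axial_fam_kern: "norm I = 1 \<Longrightarrow> axial_fam I (kern I)"
  by (rule axial_fam_cong [OF axial_fam_add [OF axial_fam_scal axial_fam_vec] kern_eq])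

text \<open>The kernel is t/Q + v/Q. The terms with v t / Q^2 and with t^2 / Q^2 cancel between the
  two summands; what remains is (-1 + (2 - n)) / Q.\<close>

lemma Dirac_left_kern:
  fixes x :: "('n::{finite,linorder}) point"
  assumes "norm I = 1" "qf w x \<noteq> 0"
  shows "Dirac_left (kern I w) x = (1 - real CARD('n)) *\<^sub>R cl_complex I (tq 0 1 w x)"
proof -
  have "Dirac_left (kern I w) x =
      Dirac_left (\<lambda>x. cl_complex I (tq 1 1 w x) + paravector (0, snd x) * cl_complex I (tq 0 1 w x)) x"
    unfolding Dirac_left_eq
    by (rule cl_op_cong_open [OF open_qf [of w]]) (use assms kern_eq in auto)
  also have "\<dots> = Dirac_left (\<lambda>x. cl_complex I (tq 1 1 w x)) x +
      Dirac_left (\<lambda>x. paravector (0, snd x) * cl_complex I (tq 0 1 w x)) x"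
    unfolding Dirac_left_eq
    by (rule cl_op_add [OF ker_fam_cl_complex [OF rat_fam_tq] ker_fam_vec [OF rat_fam_tq] assms(2)])
  finally show ?thesis
    unfolding Dirac_left_tq [OF assms(2)] Dirac_left_vec_tq [OF assms(2)]
    by (simp add: numeral_2_eq_2 scaleR_diff_left scaleR_add_left) (simp add: scaleR_2)
qed

text \<open>One Laplacian is moved past j copies of the operator, and this is repeated m times.
  Every step rewrites underneath an operator, so both inductions range over all points of the open
  set off the sphere.\<close>

lemma cl_op_funpow_Laplacian:
  assumes k: "ker_fam I k" and "qf w x \<noteq> 0"
  shows "(cl_op C ^^ j) ((Laplacian ^^ m) (k w)) x = (Laplacian ^^ m) ((cl_op C ^^ j) (k w)) x"
proof -
  have fam1: "ker_fam I (\<lambda>w. (cl_op C ^^ j) (k w))" if "ker_fam I k" for j k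
    using that by (induction j) (simp_all add: ker_fam_cl_op)
  have fam2: "ker_fam I (\<lambda>w. (Laplacian ^^ m) (k w))" if "ker_fam I k" for m k
    using that by (induction m) (simp_all add: ker_fam_Laplacian)
  have 1: "(cl_op C ^^ j) (Laplacian (k w)) x = Laplacian ((cl_op C ^^ j) (k w)) x"
    if "ker_fam I k" "qf w x \<noteq> 0" for x j k
    using that(2)
  proof (induction j arbitrary: x)
    case (Suc j)
    have "(cl_op C ^^ Suc j) (Laplacian (k w)) x = cl_op C (Laplacian ((cl_op C ^^ j) (k w))) x"
      unfolding funpow.simps comp_def by (rule cl_op_cong_open [OF open_qf [of w]]) (use Suc in auto)
    also have "\<dots> = Laplacian ((cl_op C ^^ Suc j) (k w)) x"
      using Laplacian_cl_op_commute [OF fam1 [OF that(1)] Suc.prems] by simp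
    finally show ?case .
  qed simp
  show ?thesis using assms(2)
  proof (induction m arbitrary: x)
    case (Suc m)
    have "(cl_op C ^^ j) ((Laplacian ^^ Suc m) (k w)) x = Laplacian ((cl_op C ^^ j) ((Laplacian ^^ m) (k w))) x"
      using 1 [OF fam2 [OF k] Suc.prems] by simp
    also have "\<dots> = (Laplacian ^^ Suc m) ((cl_op C ^^ j) (k w)) x"
      unfolding funpow.simps comp_def by (rule Laplacian_cong_open [OF open_qf [of w]]) (use Suc in auto)
    finally show ?case .
  qed simp
qed

text \<open>The innermost conjugate meets the outermost D and the pair becomes a Laplacian. It is
  moved to the front, so that the induction hypothesis applies to what is left.\<close>

lemma Dirac_conj_Dirac_funpow:
  assumes k: "ker_fam I k" and "qf w x \<noteq> 0"
  shows "(Dirac_conj_left ^^ b) ((Dirac_left ^^ b) (k w)) x = (Laplacian ^^ b) (k w) x"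
  using assms(2)
proof (induction b arbitrary: x)
  case (Suc b)
  have fam: "ker_fam I (\<lambda>w. (Dirac_left ^^ b) (k w))"
    using k by (induction b) (simp_all add: Dirac_left_eq ker_fam_cl_op)
  have "(Dirac_conj_left ^^ Suc b) ((Dirac_left ^^ Suc b) (k w)) x =
      (Dirac_conj_left ^^ b) (Dirac_conj_left (Dirac_left ((Dirac_left ^^ b) (k w)))) x"
    by (simp only: funpow_Suc_right [of b Dirac_conj_left] comp_apply) (simp only: funpow.simps comp_apply)
  also have "\<dots> = (Dirac_conj_left ^^ b) (Laplacian ((Dirac_left ^^ b) (k w))) x"
    unfolding Dirac_conj_left_eq
    by (rule local_opD [OF local_op_funpow [OF local_op_cl_op] open_qf [of w]])
       (use Suc.prems Dirac_conj_Dirac [OF fam] in \<open>auto simp: Dirac_conj_left_eq\<close>)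
  also have "\<dots> = Laplacian ((Dirac_conj_left ^^ b) ((Dirac_left ^^ b) (k w))) x"
    using cl_op_funpow_Laplacian [OF fam Suc.prems, where j = b and m = 1] by (simp add: Dirac_conj_left_eq)
  also have "\<dots> = (Laplacian ^^ Suc b) (k w) x"
    unfolding funpow.simps comp_def
    by (rule Laplacian_cong_open [OF open_qf [of w]]) (use Suc in auto)
  finally show ?case .
qed simp

text \<open>One D is moved inside the Laplacians, since D turns the kernel into a multiple of 1/Q,
  on which they act by scalar factors.\<close>

lemma DLap_left_kern:
  assumes "norm I = 1" "qf w x \<noteq> 0"
  shows "DLap_left (Suc b) m (kern I w) x = (Dirac_left ^^ b) ((Laplacian ^^ m) (Dirac_left (kern I w))) x"
proof -
  have fam: "ker_fam I (kern I)" using axial_fam_kern [OF assms(1)] by (rule axial_fam_imp_ker_fam)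
  have "DLap_left (Suc b) m (kern I w) x = (Dirac_left ^^ b) (Dirac_left ((Laplacian ^^ m) (kern I w))) x"
    by (simp only: DLap_left_def funpow_Suc_right comp_def)
  also have "\<dots> = (Dirac_left ^^ b) ((Laplacian ^^ m) (Dirac_left (kern I w))) x"
    unfolding Dirac_left_eq
    by (rule local_opD [OF local_op_funpow [OF local_op_cl_op] open_qf [of w]])
       (use assms(2) cl_op_funpow_Laplacian [OF fam, where w = w and j = 1 and m = m] in auto)
  finally show ?thesis .
qed

lemma Laplacian_funpow_Dirac_left_kern:
  fixes x :: "('n::{finite,linorder}) point"
  assumes "norm I = 1" "qf w x \<noteq> 0"
  shows "(Laplacian ^^ m) (Dirac_left (kern I w)) x =
    ((1 - real CARD('n)) * (\<Prod>l=1..m. 2 * real l * (2 * real l + 1 - CARD('n)))) *\<^sub>R cl_complex I (tq 0 (m + 1) w x)"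
proof -
  have "(Laplacian ^^ m) (Dirac_left (kern I w)) x =
      (Laplacian ^^ m) (\<lambda>x. (1 - real CARD('n)) *\<^sub>R cl_complex I (tq 0 1 w x)) x"
    by (rule local_opD [OF local_op_funpow [OF local_op_Laplacian] open_qf [of w]])
       (use assms Dirac_left_kern in auto)
  then show ?thesis unfolding Laplacian_funpow_tq [OF assms(2)] by (simp only:)
qed

text \<open>With one D innermost, the Laplacians yield a real multiple of a power of 1/Q, hence of a
  generator of the class, and the class is closed under the remaining copies of D.\<close>

lemma axial_fam_DLap_kern:
  assumes "norm I = 1" "1 \<le> \<beta>"
  shows "axial_fam I (\<lambda>w. DLap_left \<beta> m (kern I w))"
proof -
  obtain b where \<beta>: "\<beta> = Suc b" using assms(2) by (cases \<beta>) auto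
  have "axial_fam I (\<lambda>w. (Dirac_left ^^ b) ((Laplacian ^^ m) (Dirac_left (kern I w))))"
    by (intro axial_fam_Dirac_left_funpow
        axial_fam_cong [OF axial_fam_scaleR [OF axial_fam_scal] Laplacian_funpow_Dirac_left_kern] assms(1))
  then show ?thesis
    unfolding \<beta> by (rule axial_fam_cong) (rule DLap_left_kern [OF assms(1)])
qed

text \<open>
  The operators commute and the product of \<open>D\<close> and its conjugate is \<open>\<Delta>\<close>, so the left-hand side is
  \<open>\<Delta>\<^sup>h D\<close> of the kernel; the factor \<open>l = h\<close> of \<open>Laplacian_funpow_Dirac_left_kern\<close> vanishes.
\<close>

lemma anti_analytic_harmonic_kern:
  fixes x :: "('n::{finite,linorder}) point"
  assumes "norm I = 1" "qf w x \<noteq> 0" "CARD('n) = 2 * h + 1" "1 \<le> h" "p + m + b = h"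
  shows "(Dirac_conj_left ^^ b) ((Laplacian ^^ p) (DLap_left (Suc b) m (kern I w))) x = 0"
proof -
  have h: "h = p + (b + m)" using assms(5) by simp
  define L where "L j = ((Laplacian :: 'n cl_fun \<Rightarrow> 'n cl_fun) ^^ j)" for j
  have kern: "ker_fam I (kern I)" using axial_fam_kern [OF assms(1)] by (rule axial_fam_imp_ker_fam)
  have D: "ker_fam I (\<lambda>w. Dirac_left (kern I w))"
    unfolding Dirac_left_eq by (rule ker_fam_cl_op [OF kern])
  have Lfam: "ker_fam I (\<lambda>w. L j (k w))" if "ker_fam I k" for j k
    using that unfolding L_def by (induction j) (simp_all add: ker_fam_Laplacian)
  have Dfam: "ker_fam I (\<lambda>w. (Dirac_left ^^ j) (k w))" if "ker_fam I k" for j k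
    using that by (induction j) (simp_all add: Dirac_left_eq ker_fam_cl_op)
  define k where "k = (\<lambda>w. L m (Dirac_left (kern I w)))"
  have k: "ker_fam I k" unfolding k_def by (rule Lfam [OF D])
  have "(Dirac_conj_left ^^ b) (L p (DLap_left (Suc b) m (kern I w))) x =
      (Dirac_conj_left ^^ b) (L p ((Dirac_left ^^ b) (k w))) x"
    unfolding Dirac_conj_left_eq L_def
    by (rule local_opD [OF local_op_comp [OF local_op_funpow [OF local_op_cl_op] local_op_funpow [OF local_op_Laplacian]]
          open_qf [of w]])
       (use assms(2) DLap_left_kern [OF assms(1)] in \<open>auto simp: k_def L_def\<close>)
  also have "\<dots> = L p ((Dirac_conj_left ^^ b) ((Dirac_left ^^ b) (k w))) x"
    unfolding L_def Dirac_conj_left_eq by (rule cl_op_funpow_Laplacian [OF Dfam [OF k] assms(2)])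
  also have "\<dots> = L p (L b (k w)) x"
    unfolding L_def
    by (rule local_opD [OF local_op_funpow [OF local_op_Laplacian] open_qf [of w]])
       (use assms(2) Dirac_conj_Dirac_funpow [OF k] in \<open>auto simp: L_def\<close>)
  also have "\<dots> = (Laplacian ^^ h) (Dirac_left (kern I w)) x"
    unfolding L_def k_def h by (simp only: funpow_add comp_apply)
  also have "\<dots> = 0"
  proof -
    have "(\<Prod>l=1..h. 2 * real l * (2 * real l + 1 - CARD('n))) = 0"
      using assms(3,4) by (intro prod_zero bexI [of _ h]) auto
    then show ?thesis unfolding Laplacian_funpow_Dirac_left_kern [OF assms(1,2)] by simp
  qed
  finally show ?thesis by (simp add: L_def)
qed

section \<open>Superposition of kernels\<close>

text \<open>\<open>has_pd\<close> is anchored at the parameter 0, whereas the Leibniz rule and the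
  calculus of two variables ask for derivatives along the whole line.\<close>

lemma has_pd_shift:
  assumes "has_pd f b d (x + s *\<^sub>R b)"
  shows "((\<lambda>t. f (x + t *\<^sub>R b)) has_vector_derivative d) (at s)"
proof -
  have "((\<lambda>t. t - s) has_vector_derivative 1) (at s)"
    by (auto intro!: derivative_eq_intros)
  from vector_diff_chain_at [OF this, of "\<lambda>t. f (x + s *\<^sub>R b + t *\<^sub>R b)" d]
  show ?thesis
    using assms by (simp add: has_pd_def comp_def algebra_simps)
qed

lemma differentiable_iff_has_pd: "(\<lambda>t. f (x + t *\<^sub>R b)) differentiable at 0 \<longleftrightarrow> (\<exists>d. has_pd f b d x)"
  unfolding has_pd_def by (meson differentiableI_vector vector_derivative_works)

lemma C_diff_on_cong:
  assumes "open S" "\<And>x. x \<in> S \<Longrightarrow> f x = g x"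
  shows "C_diff_on N f S \<longleftrightarrow> C_diff_on N g S"
  using assms(2)
proof (induction N arbitrary: f g)
  case 0
  then show ?case by (simp cong: continuous_on_cong)
next
  case (Suc N)
  have "(\<lambda>t. f (x + t *\<^sub>R b)) differentiable at 0 \<longleftrightarrow> (\<lambda>t. g (x + t *\<^sub>R b)) differentiable at 0"
    if "x \<in> S" for x b
    by (simp only: differentiable_iff_has_pd has_pd_cong_open [OF assms(1) that Suc.prems])
  moreover have "C_diff_on N (partial_deriv b f) S \<longleftrightarrow> C_diff_on N (partial_deriv b g) S" for b
    by (rule Suc.IH) (rule partial_deriv_cong_open [OF assms(1) _ Suc.prems])
  ultimately show ?case
    using Suc.prems by (simp cong: continuous_on_cong)
qed

lemma C_diff_on_subset: "C_diff_on N f S \<Longrightarrow> T \<subseteq> S \<Longrightarrow> C_diff_on N f T"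
  by (induction N arbitrary: f) (auto intro: continuous_on_subset)

text \<open>The circles that represent a function change from sphere to sphere; this glues the
  smoothness they provide.\<close>

lemma C_diff_on_local:
  assumes "\<And>x. x \<in> S \<Longrightarrow> \<exists>T. open T \<and> x \<in> T \<and> C_diff_on N f T"
  shows "C_diff_on N f S"
  using assms
proof (induction N arbitrary: f)
  case 0
  have "isCont f x" if "x \<in> S" for x
  proof -
    obtain T where "open T" "x \<in> T" "continuous_on T f" using 0 \<open>x \<in> S\<close> by auto
    then show ?thesis by (simp add: continuous_on_eq_continuous_at)
  qed
  then show ?case by (simp add: continuous_at_imp_continuous_on)
next
  case (Suc N)
  have "isCont f x" if "x \<in> S" for x
  proof -
    from Suc.prems [OF that] obtain T where "open T" "x \<in> T" "continuous_on T f" by auto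
    then show ?thesis by (simp add: continuous_on_eq_continuous_at)
  qed
  moreover have "C_diff_on N (partial_deriv b f) S" if "b \<in> Basis" for b
  proof (rule Suc.IH)
    fix x assume "x \<in> S"
    from Suc.prems [OF this] that show "\<exists>T. open T \<and> x \<in> T \<and> C_diff_on N (partial_deriv b f) T"
      by auto
  qed
  moreover have "(\<lambda>t. f (x + t *\<^sub>R b)) differentiable at 0" if "b \<in> Basis" "x \<in> S" for b x
    using Suc.prems [OF that(2)] that(1) by auto
  ultimately show ?case by (simp add: continuous_at_imp_continuous_on)
qed

text \<open>The density c absorbs the differential and the values of f. Its continuity is what puts
  the integrals within reach of the Leibniz rule; circles provide it. The set \<open>X\<close> is
  kept off all spheres that meet the curves.\<close>

locale kernel_transform =
  fixes I :: "real ^ ('n::{finite,linorder})"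
    and \<Gamma> :: "(real \<Rightarrow> complex) set" and c :: "(real \<Rightarrow> complex) \<Rightarrow> real \<Rightarrow> 'n clifford"
    and X :: "'n point set"
  assumes finite_\<Gamma>: "finite \<Gamma>"
    and continuous_path: "\<gamma> \<in> \<Gamma> \<Longrightarrow> continuous_on {0..1} \<gamma>"
    and continuous_density: "\<gamma> \<in> \<Gamma> \<Longrightarrow> continuous_on {0..1} (c \<gamma>)"
    and open_X: "open X"
    and qf_nonzero: "\<gamma> \<in> \<Gamma> \<Longrightarrow> t \<in> {0..1} \<Longrightarrow> x \<in> X \<Longrightarrow> qf (\<gamma> t) x \<noteq> 0"
begin

definition T :: "(complex \<Rightarrow> 'n cl_fun) \<Rightarrow> 'n cl_fun"
  where "T k x = (\<Sum>\<gamma>\<in>\<Gamma>. integral {0..1} (\<lambda>t. k (\<gamma> t) x * c \<gamma> t))"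

lemma T_cong: "(\<And>w. qf w x \<noteq> 0 \<Longrightarrow> k w x = k' w x) \<Longrightarrow> x \<in> X \<Longrightarrow> T k x = T k' x"
  unfolding T_def by (intro sum.cong refl integral_cong) (simp add: qf_nonzero)

lemma continuous_integrand:
  assumes "ker_fam I k" "\<gamma> \<in> \<Gamma>"
  shows "continuous_on (X \<times> {0..1}) (\<lambda>(x, t). k (\<gamma> t) x * c \<gamma> t)"
proof -
  have 1: "continuous_on (X \<times> {0..1}) (\<lambda>p. \<gamma> (snd p))" "continuous_on (X \<times> {0..1}) (\<lambda>p. c \<gamma> (snd p))"
    by (rule continuous_on_compose2 [OF continuous_path [OF assms(2)]]
          continuous_on_compose2 [OF continuous_density [OF assms(2)]]; auto intro!: continuous_intros)+
  have "continuous_on (X \<times> {0..1}) (\<lambda>p. k (\<gamma> (snd p)) (fst p))"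
    using continuous_on_compose2 [OF ker_fam_continuous [OF assms(1)], of "X \<times> {0..1}" "\<lambda>p. (\<gamma> (snd p), fst p)"]
      qf_nonzero [OF assms(2)] 1(1)
    by (fastforce intro!: continuous_intros)
  then have "continuous_on (X \<times> {0..1}) (\<lambda>p. k (\<gamma> (snd p)) (fst p) * c \<gamma> (snd p))"
    by (intro cl_mult.continuous_on 1)
  then show ?thesis by (simp add: case_prod_unfold)
qed

lemma integrable_integrand:
  assumes "ker_fam I k" "\<gamma> \<in> \<Gamma>" "x \<in> X"
  shows "(\<lambda>t. k (\<gamma> t) x * c \<gamma> t) integrable_on {0..1}"
proof -
  have "continuous_on {0..1::real} (\<lambda>t. (x, t))" by (intro continuous_intros)
  from continuous_on_compose2 [OF continuous_integrand [OF assms(1,2)] this] assms(3)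
  have "continuous_on {0..1} (\<lambda>t. k (\<gamma> t) x * c \<gamma> t)" by auto
  then show ?thesis by (rule integrable_continuous_real)
qed

lemma continuous_T:
  assumes "ker_fam I k"
  shows "continuous_on X (T k)"
proof -
  have "continuous_on X (\<lambda>x. integral (cbox 0 1) (\<lambda>t. k (\<gamma> t) x * c \<gamma> t))" if "\<gamma> \<in> \<Gamma>" for \<gamma>
    by (rule integral_continuous_on_param) (use continuous_integrand [OF assms that] in simp)
  then have "continuous_on X (\<lambda>x. \<Sum>\<gamma>\<in>\<Gamma>. integral {0..1} (\<lambda>t. k (\<gamma> t) x * c \<gamma> t))"
    by (intro continuous_on_sum) simp
  then show ?thesis by (simp add: T_def [abs_def])
qed

text \<open>The Leibniz rule is applied along a short segment through x inside \<open>X\<close>, on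
  which the differentiated integrand is jointly continuous. The derivative is again the transform of
  a member of the class, so the lemma iterates.\<close>

lemma has_pd_T:
  assumes k: "ker_fam I k" and x: "x \<in> X"
  shows "has_pd (T k) b (T (\<lambda>w. partial_deriv b (k w)) x) x"
proof -
  obtain e where e: "e > 0" "\<And>t. dist t 0 < e \<Longrightarrow> x + t *\<^sub>R b \<in> X"
    using eventually_line_in_open [OF open_X x, of b] unfolding eventually_nhds_metric by blast
  have "((\<lambda>s. integral {0..1} (\<lambda>t. k (\<gamma> t) (x + s *\<^sub>R b) * c \<gamma> t)) has_vector_derivative
      integral {0..1} (\<lambda>t. partial_deriv b (k (\<gamma> t)) x * c \<gamma> t)) (at 0)" if \<gamma>: "\<gamma> \<in> \<Gamma>" for \<gamma>
  proof -
    have "((\<lambda>s. integral (cbox 0 1) (\<lambda>t. k (\<gamma> t) (x + s *\<^sub>R b) * c \<gamma> t)) has_vector_derivative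
      integral (cbox 0 1) (\<lambda>t. partial_deriv b (k (\<gamma> t)) (x + 0 *\<^sub>R b) * c \<gamma> t)) (at 0 within ball 0 e)"
    proof (rule leibniz_rule_vector_derivative [where fx = "\<lambda>s t. partial_deriv b (k (\<gamma> t)) (x + s *\<^sub>R b) * c \<gamma> t"])
      fix s t :: real
      assume s: "s \<in> ball 0 e" and t: "t \<in> cbox 0 1"
      then have "has_pd (k (\<gamma> t)) b (partial_deriv b (k (\<gamma> t)) (x + s *\<^sub>R b)) (x + s *\<^sub>R b)"
        by (intro ker_fam_has_pd [OF k] qf_nonzero [OF \<gamma>] e) (auto simp: dist_commute)
      then have "((\<lambda>s. k (\<gamma> t) (x + s *\<^sub>R b)) has_vector_derivative
          partial_deriv b (k (\<gamma> t)) (x + s *\<^sub>R b)) (at s)"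
        by (rule has_pd_shift)
      then show "((\<lambda>s. k (\<gamma> t) (x + s *\<^sub>R b) * c \<gamma> t) has_vector_derivative
          partial_deriv b (k (\<gamma> t)) (x + s *\<^sub>R b) * c \<gamma> t) (at s within ball 0 e)"
        by (rule bounded_linear.has_vector_derivative
            [OF cl_mult.bounded_linear_left has_vector_derivative_at_within])
    next
      fix s :: real assume "s \<in> ball 0 e"
      then show "(\<lambda>t. k (\<gamma> t) (x + s *\<^sub>R b) * c \<gamma> t) integrable_on cbox 0 1"
        using integrable_integrand [OF k \<gamma> e(2), of s] by (simp add: dist_commute)
    next
      have "continuous_on (ball 0 e \<times> {0..1}) (\<lambda>p. (x + fst p *\<^sub>R b, snd p :: real))"
        by (intro continuous_intros)
      moreover have "(\<lambda>p. (x + fst p *\<^sub>R b, snd p :: real)) ` (ball 0 e \<times> {0..1}) \<subseteq> X \<times> {0..1}"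
        using e(2) by (auto simp: dist_commute)
      ultimately have "continuous_on (ball 0 e \<times> {0..1}) (\<lambda>p. case (x + fst p *\<^sub>R b, snd p) of
          (x, t) \<Rightarrow> partial_deriv b (k (\<gamma> t)) x * c \<gamma> t)"
        by (rule continuous_on_compose2 [OF continuous_integrand [OF ker_fam_pd [OF k] \<gamma>]])
      then show "continuous_on (ball 0 e \<times> cbox 0 1) (\<lambda>(s, t). partial_deriv b (k (\<gamma> t)) (x + s *\<^sub>R b) * c \<gamma> t)"
        by (simp add: case_prod_unfold)
    qed (use e(1) in auto)
    moreover have "at 0 within ball 0 e = at (0 :: real)"
      by (rule at_within_open) (use e(1) in auto)
    ultimately show ?thesis by (simp only: cbox_interval scaleR_zero_left add_0_right)
  qed
  then show ?thesis
    unfolding has_pd_def T_def by (rule has_vector_derivative_sum)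
qed

lemma partial_deriv_T: "ker_fam I k \<Longrightarrow> x \<in> X \<Longrightarrow> partial_deriv b (T k) x = T (\<lambda>w. partial_deriv b (k w)) x"
  by (rule has_pd_partial_deriv [OF has_pd_T])

lemma C_diff_on_T: "ker_fam I k \<Longrightarrow> C_diff_on N (T k) X"
proof (induction N arbitrary: k)
  case (Suc N)
  have "C_diff_on N (partial_deriv b (T k)) X" for b
    using Suc.IH [OF ker_fam_pd [OF Suc.prems, of b]] partial_deriv_T [OF Suc.prems]
      C_diff_on_cong [OF open_X, of "partial_deriv b (T k)" "T (\<lambda>w. partial_deriv b (k w))" N]
    by blast
  moreover have "(\<lambda>t. T k (x + t *\<^sub>R b)) differentiable at 0" if "x \<in> X" for x b
    using has_pd_T [OF Suc.prems that] unfolding has_pd_def by (rule differentiableI_vector)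
  ultimately show ?case using continuous_T [OF Suc.prems] by simp
qed (simp add: continuous_T)

lemma T_add:
  assumes "ker_fam I k" "ker_fam I k'" "x \<in> X"
  shows "T (\<lambda>w x. k w x + k' w x) x = T k x + T k' x"
  unfolding T_def sum.distrib [symmetric]
  by (intro sum.cong refl)
     (simp add: distrib_right Henstock_Kurzweil_Integration.integral_add integrable_integrand assms)

lemma T_zero: "T (\<lambda>w x. 0) x = 0"
  by (simp add: T_def)

lemma T_sum:
  assumes "finite A" "\<And>i. i \<in> A \<Longrightarrow> ker_fam I (k i)" "x \<in> X"
  shows "T (\<lambda>w x. \<Sum>i\<in>A. k i w x) x = (\<Sum>i\<in>A. T (k i) x)"
  using assms by (induction A rule: finite_induct) (simp_all add: T_zero T_add ker_fam_sum)

lemma T_mult_left: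
  assumes "ker_fam I k" "x \<in> X"
  shows "T (\<lambda>w x. a * k w x) x = a * T k x"
proof -
  have "integral {0..1} (\<lambda>t. a * k (\<gamma> t) x * c \<gamma> t) = a * integral {0..1} (\<lambda>t. k (\<gamma> t) x * c \<gamma> t)"
    if "\<gamma> \<in> \<Gamma>" for \<gamma>
    using integral_linear [OF integrable_integrand [OF assms(1) that assms(2)]
        cl_mult.bounded_linear_right [of a]]
    by (simp add: comp_def mult.assoc)
  then show ?thesis by (simp add: T_def sum_distrib_left)
qed

lemma cl_op_T:
  assumes "ker_fam I k" "x \<in> X"
  shows "cl_op C (T k) x = T (\<lambda>w. cl_op C (k w)) x"
  unfolding cl_op_def
  by (simp add: T_sum T_mult_left ker_fam_mult_left ker_fam_pd partial_deriv_T assms)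

lemma Laplacian_T:
  assumes k: "ker_fam I k" and x: "x \<in> X"
  shows "Laplacian (T k) x = T (\<lambda>w. Laplacian (k w)) x"
proof -
  have "partial_deriv b (partial_deriv b (T k)) x = T (\<lambda>w. partial_deriv b (partial_deriv b (k w))) x" for b
    using partial_deriv_cong_open [OF open_X x partial_deriv_T [OF k]] partial_deriv_T [OF ker_fam_pd [OF k] x]
    by simp
  then show ?thesis
    unfolding Laplacian_def by (simp add: T_sum ker_fam_pd k x)
qed

text \<open>Stated for any g that agrees with a transform on \<open>X\<close>, since in the
  applications g is f or the result of applying operators to it. Membership of the iterated kernel
  is carried along because the next step differentiates it.\<close>

lemma cl_op_funpow_T:
  assumes "ker_fam I k" "\<And>x. x \<in> X \<Longrightarrow> g x = T k x" "x \<in> X"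
  shows "(cl_op C ^^ j) g x = T (\<lambda>w. (cl_op C ^^ j) (k w)) x" "ker_fam I (\<lambda>w. (cl_op C ^^ j) (k w))"
proof -
  have "ker_fam I (\<lambda>w. (cl_op C ^^ j) (k w)) \<and> (\<forall>x\<in>X. (cl_op C ^^ j) g x = T (\<lambda>w. (cl_op C ^^ j) (k w)) x)"
  proof (induction j)
    case (Suc j)
    have "cl_op C ((cl_op C ^^ j) g) x = T (\<lambda>w. cl_op C ((cl_op C ^^ j) (k w))) x" if "x \<in> X" for x
      using cl_op_cong_open [OF open_X that, of "(cl_op C ^^ j) g" "T (\<lambda>w. (cl_op C ^^ j) (k w))" C] Suc
        cl_op_T [of "\<lambda>w. (cl_op C ^^ j) (k w)", OF _ that] by simp
    then show ?case using Suc by (simp add: ker_fam_cl_op)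
  qed (use assms in auto)
  then show "(cl_op C ^^ j) g x = T (\<lambda>w. (cl_op C ^^ j) (k w)) x" "ker_fam I (\<lambda>w. (cl_op C ^^ j) (k w))"
    using assms(3) by auto
qed

lemma Laplacian_funpow_T:
  assumes "ker_fam I k" "\<And>x. x \<in> X \<Longrightarrow> g x = T k x" "x \<in> X"
  shows "(Laplacian ^^ j) g x = T (\<lambda>w. (Laplacian ^^ j) (k w)) x" "ker_fam I (\<lambda>w. (Laplacian ^^ j) (k w))"
proof -
  have "ker_fam I (\<lambda>w. (Laplacian ^^ j) (k w)) \<and> (\<forall>x\<in>X. (Laplacian ^^ j) g x = T (\<lambda>w. (Laplacian ^^ j) (k w)) x)"
  proof (induction j)
    case (Suc j)
    have "Laplacian ((Laplacian ^^ j) g) x = T (\<lambda>w. Laplacian ((Laplacian ^^ j) (k w))) x" if "x \<in> X" for x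
      using Laplacian_cong_open [OF open_X that, of "(Laplacian ^^ j) g" "T (\<lambda>w. (Laplacian ^^ j) (k w))"] Suc
        Laplacian_T [of "\<lambda>w. (Laplacian ^^ j) (k w)", OF _ that] by simp
    then show ?case using Suc by (simp add: ker_fam_Laplacian)
  qed (use assms in auto)
  then show "(Laplacian ^^ j) g x = T (\<lambda>w. (Laplacian ^^ j) (k w)) x" "ker_fam I (\<lambda>w. (Laplacian ^^ j) (k w))"
    using assms(3) by auto
qed

end

section \<open>Holomorphic components\<close>

text \<open>\<open>C_diff_on\<close> speaks of partial derivatives only. Their continuity gives a
  total derivative, and the Cauchy-Riemann equations make it multiplication by the complex number
  \<open>d\<close>, built from the derivatives in the first variable.\<close>

lemma cauchy_riemann_holomorphic:
  fixes A B :: "real \<times> real \<Rightarrow> 'b::euclidean_space"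
  assumes "open V" and CR: "cauchy_riemann_on V A B"
  shows "(\<lambda>z. Complex (A (Re z, Im z) \<bullet> E) (B (Re z, Im z) \<bullet> E)) holomorphic_on {z. (Re z, Im z) \<in> V}"
proof -
  define F where "F u v = Complex (A (u, v) \<bullet> E) (B (u, v) \<bullet> E)" for u v
  define d where "d p = Complex (partial_deriv (1, 0) A p \<bullet> E) (partial_deriv (1, 0) B p \<bullet> E)" for p
  have Basis2: "(1, 0) \<in> (Basis :: (real \<times> real) set)" "(0, 1) \<in> (Basis :: (real \<times> real) set)"
    by (auto simp: Basis_prod_def)
  have pd: "has_pd A b (partial_deriv b A p) p" "has_pd B b (partial_deriv b B p) p"
    if "p \<in> V" "b \<in> Basis" for p b
    using CR that unfolding cauchy_riemann_on_def has_pd_def partial_deriv_def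
    by (auto simp flip: vector_derivative_works)
  have cpd: "continuous_on V (partial_deriv b A)" "continuous_on V (partial_deriv b B)" if "b \<in> Basis" for b
    using CR that unfolding cauchy_riemann_on_def by auto
  have Complex_eq: "Complex a b = of_real a + \<i> * of_real b" for a b
    by (rule Complex_eq)
  have pdF: "has_pd (\<lambda>p. F (fst p) (snd p)) (1, 0) (d p) p"
    "has_pd (\<lambda>p. F (fst p) (snd p)) (0, 1) (\<i> * d p) p" if "p \<in> V" for p
  proof -
    have "has_pd (\<lambda>p. of_real (A p \<bullet> E) + \<i> * of_real (B p \<bullet> E)) b
        (of_real (partial_deriv b A p \<bullet> E) + \<i> * of_real (partial_deriv b B p \<bullet> E)) p" if "b \<in> Basis" for b
      by (intro has_pd_add has_pd_bounded_linear [OF bounded_linear_compose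
            [OF bounded_linear_of_real bounded_linear_inner_left]]
          has_pd_bounded_linear [OF bounded_linear_compose [OF bounded_linear_mult_right bounded_linear_compose
            [OF bounded_linear_of_real bounded_linear_inner_left]]] pd \<open>p \<in> V\<close> that)
    then have *: "has_pd (\<lambda>p. F (fst p) (snd p)) b
        (of_real (partial_deriv b A p \<bullet> E) + \<i> * of_real (partial_deriv b B p \<bullet> E)) p" if "b \<in> Basis" for b
      using that by (simp add: F_def Complex_eq)
    show "has_pd (\<lambda>p. F (fst p) (snd p)) (1, 0) (d p) p"
      using * [OF Basis2(1)] by (simp add: d_def Complex_eq)
    have "partial_deriv (0, 1) A p = - partial_deriv (1, 0) B p" "partial_deriv (0, 1) B p = partial_deriv (1, 0) A p"
      using CR that by (auto simp: cauchy_riemann_on_def)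
    then show "has_pd (\<lambda>p. F (fst p) (snd p)) (0, 1) (\<i> * d p) p"
      using * [OF Basis2(2)] by (simp add: d_def Complex_eq algebra_simps)
  qed
  have contd: "continuous_on V d"
    unfolding d_def Complex_eq by (intro continuous_intros cpd Basis2)
  have "((\<lambda>z. F (Re z) (Im z)) has_field_derivative d (Re z, Im z)) (at z)" if z: "(Re z, Im z) \<in> V" for z
  proof -
    obtain P Q where PQ: "open P" "open Q" "Re z \<in> P" "Im z \<in> Q" "P \<times> Q \<subseteq> V"
      using open_prod_elim [OF assms(1) z] by (metis mem_Sigma_iff)
    obtain e where e: "e > 0" "ball (Im z) e \<subseteq> Q" using PQ(2,4) open_contains_ball by blast
    \<comment> \<open>The passage from partial to total derivatives works on a product whose second
      factor is convex, hence the ball.\<close>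
    define Y where "Y = ball (Im z) e"
    have XY: "P \<times> Y \<subseteq> V" using PQ(5) e(2) by (auto simp: Y_def)
    have dx: "((\<lambda>u. F u v) has_vector_derivative d (u, v)) (at u)"
      and dy: "((\<lambda>v. F u v) has_vector_derivative \<i> * d (u, v)) (at v)" if "u \<in> P" "v \<in> Y" for u v
    proof -
      have "(u, v) \<in> V" using that XY by blast
      with pdF [of "(u, v)"] show "((\<lambda>u. F u v) has_vector_derivative d (u, v)) (at u)"
        "((\<lambda>v. F u v) has_vector_derivative \<i> * d (u, v)) (at v)"
        using has_pd_shift [of "\<lambda>p. F (fst p) (snd p)" "(1, 0)" "d (u, v)" "(0, v)" u]
          has_pd_shift [of "\<lambda>p. F (fst p) (snd p)" "(0, 1)" "\<i> * d (u, v)" "(u, 0)" v] by auto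
    qed
    have "((\<lambda>(u, v). F u v) has_derivative (\<lambda>(s, t). s *\<^sub>R d (Re z, Im z) +
        blinfun_apply (blinfun_scaleR_left (\<i> * d (Re z, Im z))) t)) (at (Re z, Im z) within P \<times> Y)"
    proof (rule has_derivative_partialsI)
      show "((\<lambda>u. F u (Im z)) has_derivative (\<lambda>s. s *\<^sub>R d (Re z, Im z))) (at (Re z) within P)"
        using dx [of "Re z" "Im z"] PQ e
        by (auto simp: Y_def has_vector_derivative_def intro: has_derivative_at_withinI)
      show "((\<lambda>v. F u v) has_derivative blinfun_apply (blinfun_scaleR_left (\<i> * d (u, v)))) (at v within Y)"
        if "u \<in> P" "v \<in> Y" for u v
        using dy [OF that] by (auto simp: has_vector_derivative_def intro: has_derivative_at_withinI)
      have "continuous_on (P \<times> Y) (\<lambda>p. blinfun_scaleR_left (\<i> * d p))"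
        by (intro bounded_linear.continuous_on [OF bounded_linear_blinfun_scaleR_left] continuous_intros
            continuous_on_subset [OF contd XY])
      then show "continuous (at (Re z, Im z) within P \<times> Y) (\<lambda>(u, v). blinfun_scaleR_left (\<i> * d (u, v)))"
        using PQ e by (auto simp: continuous_on_eq_continuous_within Y_def case_prod_unfold)
    qed (use e in \<open>auto simp: Y_def\<close>)
    note D0 = this
    have D: "((\<lambda>p. F (fst p) (snd p)) has_derivative (\<lambda>p. fst p *\<^sub>R d (Re z, Im z) + snd p *\<^sub>R (\<i> * d (Re z, Im z))))
        (at (Re z, Im z))"
    proof -
      have "at (Re z, Im z) within P \<times> Y = at (Re z, Im z)"
        by (rule at_within_open) (use PQ e in \<open>simp_all add: Y_def open_Times\<close>)
      then show ?thesis
        using D0 unfolding case_prod_unfold blinfun_scaleR_left.rep_eq by (simp only:)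
    qed
    have "((\<lambda>z. (Re z, Im z)) has_derivative (\<lambda>z. (Re z, Im z))) (at z)"
      by (rule bounded_linear_imp_has_derivative [OF bounded_linear_Pair [OF bounded_linear_Re bounded_linear_Im]])
    from has_derivative_compose [OF this D]
    have "((\<lambda>z. F (Re z) (Im z)) has_derivative (\<lambda>h. Re h *\<^sub>R d (Re z, Im z) + Im h *\<^sub>R (\<i> * d (Re z, Im z)))) (at z)"
      by simp
    moreover have "(\<lambda>h. Re h *\<^sub>R d (Re z, Im z) + Im h *\<^sub>R (\<i> * d (Re z, Im z))) = (*) (d (Re z, Im z))"
      by (simp add: fun_eq_iff scaleR_conv_of_real complex_eq_iff)
    ultimately show ?thesis by (simp add: has_field_derivative_def)
  qed
  then have "(\<lambda>z. F (Re z) (Im z)) holomorphic_on {z. (Re z, Im z) \<in> V}"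
    by (auto simp: holomorphic_on_def field_differentiable_def intro: has_field_derivative_at_within)
  then show ?thesis by (simp add: F_def)
qed

section \<open>Axially symmetric sets in one complex coordinate\<close>

lemma mem_plane_domain:
  assumes "axially_symmetric G" "norm I = 1"
  shows "(u, v) \<in> plane_domain G \<longleftrightarrow> (u, v *\<^sub>R I) \<in> G"
proof
  assume *: "(u, v *\<^sub>R I) \<in> G"
  have "(u, v *\<^sub>R J) \<in> G" if "norm J = 1" for J
  proof (cases "v = 0")
    case False
    \<comment> \<open>\<open>axial_sphere\<close> works with a nonnegative radius, so the sign of v
      is moved into the unit vector.\<close>
    have "v *\<^sub>R J = norm (v *\<^sub>R I) *\<^sub>R (sgn v *\<^sub>R J)"
      using assms(2) by (simp add: sgn_real_def)
    moreover have "norm (sgn v *\<^sub>R J) = 1" using that False by (simp add: sgn_real_def)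
    ultimately have "(u, v *\<^sub>R J) \<in> axial_sphere (u, v *\<^sub>R I)"
      unfolding axial_sphere_def fst_conv snd_conv mem_Collect_eq by metis
    with * assms(1) show ?thesis unfolding axially_symmetric_def by blast
  qed (use * in simp)
  then show "(u, v) \<in> plane_domain G" by (simp add: plane_domain_def)
qed (use assms in \<open>simp add: plane_domain_def\<close>)

text \<open>For axially symmetric G all slices \<open>slice_of I G\<close> with unit I are this one
  set, which frees the complex analysis from the choice of I.\<close>

definition slice_dom :: "('n::finite) point set \<Rightarrow> complex set"
  where "slice_dom G = {z. (Re z, Im z) \<in> plane_domain G}"

lemma slice_of_eq: "axially_symmetric G \<Longrightarrow> norm I = 1 \<Longrightarrow> slice_of I G = slice_dom G"
  by (auto simp: slice_of_def slice_dom_def slice_point_def mem_plane_domain)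

lemma unit_exists: obtains I :: "real ^ ('n::finite)" where "norm I = 1"
  using vector_choose_size [of 1] by auto

lemma open_plane_domain:
  assumes "open G" "axially_symmetric G"
  shows "open (plane_domain G)"
proof -
  obtain I :: "real ^ 'a" where I: "norm I = 1" by (rule unit_exists)
  have "plane_domain G = (\<lambda>p. (fst p, snd p *\<^sub>R I)) -` G"
    using mem_plane_domain [OF assms(2) I] by auto
  moreover have "open ((\<lambda>p. (fst p, snd p *\<^sub>R I)) -` G)"
    by (intro open_vimage assms continuous_intros)
  ultimately show ?thesis by simp
qed

lemma open_slice_dom:
  assumes "open G" "axially_symmetric G"
  shows "open (slice_dom G)"
proof -
  have "slice_dom G = (\<lambda>z. (Re z, Im z)) -` plane_domain G" by (auto simp: slice_dom_def)
  moreover have "open ((\<lambda>z. (Re z, Im z)) -` plane_domain G)"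
    by (intro open_vimage open_plane_domain assms continuous_intros)
  ultimately show ?thesis by simp
qed

lemma cnj_slice_dom: "axially_symmetric G \<Longrightarrow> cnj z \<in> slice_dom G \<longleftrightarrow> z \<in> slice_dom G"
proof -
  assume G: "axially_symmetric G"
  obtain I :: "real ^ 'a" where I: "norm I = 1" by (rule unit_exists)
  then have "norm (- I) = 1" by simp
  from mem_plane_domain [OF G this] mem_plane_domain [OF G I]
  show ?thesis by (simp add: slice_dom_def)
qed

text \<open>The representative of the sphere of x in the closed upper half-plane. Together with its
  conjugate it gives the zeros of \<open>qf\<close> in the parameter.\<close>

definition slice_coord :: "('n::finite) point \<Rightarrow> complex"
  where "slice_coord x = Complex (fst x) (norm (snd x))"

lemma slice_coord_mem:
  fixes x :: "('n::finite) point"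
  assumes "axially_symmetric G"
  shows "slice_coord x \<in> slice_dom G \<longleftrightarrow> x \<in> G"
proof -
  obtain J :: "real ^ 'n" where J: "norm J = 1" "snd x = norm (snd x) *\<^sub>R J"
  proof (cases "snd x = 0")
    case True
    with unit_exists that show ?thesis by (metis norm_zero scale_eq_0_iff)
  next
    case False
    then have "norm (sgn (snd x)) = 1" "snd x = norm (snd x) *\<^sub>R sgn (snd x)"
      by (simp_all add: norm_sgn sgn_div_norm)
    with that show ?thesis by blast
  qed
  have "(fst x, norm (snd x) *\<^sub>R J) = x" using J(2) by (simp add: prod_eq_iff)
  with mem_plane_domain [OF assms J(1), of "fst x" "norm (snd x)"]
  show ?thesis by (simp add: slice_dom_def slice_coord_def)
qed

lemma qf_slice_coord: "qf w x = (w - slice_coord x) * (w - cnj (slice_coord x))"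
  by (simp add: qf_factor slice_coord_def complex_cnj)

lemma continuous_on_slice_coord: "continuous_on S slice_coord"
  unfolding slice_coord_def Complex_eq by (intro continuous_intros)

text \<open>
  The components \<open>A + i B\<close> of a slice hyperholomorphic function with respect to a real basis of the
  Clifford algebra are ordinary holomorphic functions.
\<close>

lemma slice_hyperholomorphic_components:
  fixes f :: "('n::{finite,linorder}) cl_fun"
  assumes f: "slice_hyperholomorphic_left G f" and G: "open G" "axially_symmetric G"
  obtains F where "\<And>E. F E holomorphic_on slice_dom G"
    "\<And>E z. z \<in> slice_dom G \<Longrightarrow> F E (cnj z) = cnj (F E z)"
    "\<And>J z. norm J = 1 \<Longrightarrow> z \<in> slice_dom G \<Longrightarrow> f (slice_point J z) = (\<Sum>E\<in>Basis. cl_complex J (F E z) * E)"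
    "\<And>x. x \<in> G \<Longrightarrow> f x = (\<Sum>E\<in>Basis. (of_real (Re (F E (slice_coord x))) +
        of_real (Im (F E (slice_coord x))) * paravector (0, sgn (snd x))) * E)"
proof -
  obtain A B where ax: "axial_form_left G f A B" and CR: "cauchy_riemann_on (plane_domain G) A B"
    using f unfolding slice_hyperholomorphic_left_def by blast
  define F where "F E z = Complex (A (Re z, Im z) \<bullet> E) (B (Re z, Im z) \<bullet> E)" for E z
  have hol: "F E holomorphic_on slice_dom G" for E
    unfolding F_def [abs_def] slice_dom_def
    by (rule cauchy_riemann_holomorphic [OF open_plane_domain [OF G] CR])
  have eo: "A (u, - v) = A (u, v)" "B (u, - v) = - B (u, v)" if "(u, v) \<in> plane_domain G" for u v
    using ax that unfolding axial_form_left_def even_odd_pair_def by auto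
  have fx: "f x = A (fst x, norm (snd x)) + paravector (0, sgn (snd x)) * B (fst x, norm (snd x))" if "x \<in> G" for x
    using ax that unfolding axial_form_left_def by blast
  have expand: "A p + paravector (0, J) * B p =
      (\<Sum>E\<in>Basis. (of_real (A p \<bullet> E) + of_real (B p \<bullet> E) * paravector (0, J)) * E)" for J p
  proof -
    have "A p + paravector (0, J) * B p =
        (\<Sum>E\<in>Basis. (A p \<bullet> E) *\<^sub>R E) + paravector (0, J) * (\<Sum>E\<in>Basis. (B p \<bullet> E) *\<^sub>R E)"
      by (simp add: euclidean_representation)
    then show ?thesis
      by (simp add: sum_distrib_left distrib_right sum.distrib of_real_def)
  qed
  have cnj: "F E (cnj z) = cnj (F E z)" if "z \<in> slice_dom G" for E z
    using eo [of "Re z" "Im z"] that by (simp add: F_def slice_dom_def complex_eq_iff)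
  have slice: "f (slice_point J z) = (\<Sum>E\<in>Basis. cl_complex J (F E z) * E)"
    if J: "norm J = 1" and z: "z \<in> slice_dom G" for J z
  proof -
    have zp: "(Re z, Im z) \<in> plane_domain G" using z by (simp add: slice_dom_def)
    have "slice_point J z \<in> G"
      using zp J by (simp add: plane_domain_def slice_point_def)
    then have 1: "f (slice_point J z) = A (Re z, \<bar>Im z\<bar>) + paravector (0, sgn (Im z *\<^sub>R J)) * B (Re z, \<bar>Im z\<bar>)"
      using J by (simp add: fx slice_point_def)
    \<comment> \<open>The sign of \<open>Im z\<close> passes from the unit vector to
      \<open>B\<close> by oddness. On the real axis oddness forces \<open>B\<close> to vanish, in
      agreement with \<open>sgn 0 = 0\<close>.\<close>
    also have "\<dots> = A (Re z, Im z) + paravector (0, J) * B (Re z, Im z)"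
    proof -
      consider "Im z > 0" | "Im z < 0" | "Im z = 0" by linarith
      then show ?thesis
      proof cases
        case 1
        then show ?thesis using J by (simp add: sgn_div_norm)
      next
        case 2
        have "sgn (Im z *\<^sub>R J) = - J" using 2 J by (simp add: sgn_div_norm)
        then show ?thesis using 2 eo [OF zp] paravector_minus [of "(0, J)"] by simp
      next
        case 3
        then have "B (Re z, 0) = - B (Re z, 0)" using eo(2) [OF zp] by simp
        then have "B (Re z, 0) + B (Re z, 0) = 0" by (metis add.right_inverse)
        then have "2 *\<^sub>R B (Re z, 0) = 0" by (simp only: scaleR_2)
        then have "B (Re z, 0) = 0" by simp
        with 3 show ?thesis by simp
      qed
    qed
    finally show ?thesis
      unfolding expand by (simp add: F_def cl_complex_def of_real_def)
  qed
  show ?thesis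
    by (rule that [OF hol cnj slice]) (simp_all add: fx expand F_def slice_coord_def)
qed

section \<open>Clifford integrals as contour integrals\<close>

text \<open>The form ds(-I) is the image of - i dw. Kernel, form and components all lie in one
  commutative copy of the complex numbers, and the basis element E stands at the far right; hence
  the integral is a combination of ordinary contour integrals.\<close>

lemma has_integral_slice_component:
  fixes f :: "('n::{finite,linorder}) cl_fun"
  assumes I: "norm I = 1" and \<gamma>: "path_image \<gamma> \<subseteq> W"
    and f: "\<And>z. z \<in> W \<Longrightarrow> f (slice_point I z) = (\<Sum>E\<in>Basis. cl_complex I (F E z) * E)"
    and int: "\<And>E. (\<lambda>w. a w * F E w) contour_integrable_on \<gamma>"
  shows "((\<lambda>t. cl_complex I (a (\<gamma> t)) * (ds_slice I \<gamma> t * f (slice_point I (\<gamma> t)))) has_integral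
    (\<Sum>E\<in>Basis. cl_complex I (- \<i> * contour_integral \<gamma> (\<lambda>w. a w * F E w)) * E)) {0..1}"
proof -
  have "((\<lambda>t. cl_complex I (- \<i> * (a (\<gamma> t) * F E (\<gamma> t) * vector_derivative \<gamma> (at t within {0..1}))) * E) has_integral
      cl_complex I (- \<i> * contour_integral \<gamma> (\<lambda>w. a w * F E w)) * E) {0..1}" for E
  proof -
    have L: "bounded_linear (\<lambda>z. cl_complex I (- \<i> * z) * E)"
      by (rule bounded_linear_compose [OF cl_mult.bounded_linear_left bounded_linear_compose
            [OF bounded_linear_cl_complex bounded_linear_mult_right]])
    have "((\<lambda>t. a (\<gamma> t) * F E (\<gamma> t) * vector_derivative \<gamma> (at t within {0..1})) has_integral
        contour_integral \<gamma> (\<lambda>w. a w * F E w)) {0..1}"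
      using has_contour_integral_integral [OF int] unfolding has_contour_integral_def .
    from has_integral_linear [OF this L] show ?thesis by (simp add: comp_def)
  qed
  then have "((\<lambda>t. \<Sum>E\<in>Basis. cl_complex I (- \<i> * (a (\<gamma> t) * F E (\<gamma> t) * vector_derivative \<gamma> (at t within {0..1}))) * E)
      has_integral (\<Sum>E\<in>Basis. cl_complex I (- \<i> * contour_integral \<gamma> (\<lambda>w. a w * F E w)) * E)) {0..1}"
    by (intro has_integral_sum) auto
  then show ?thesis
  proof (rule has_integral_eq [rotated])
    fix t :: real assume t: "t \<in> {0..1}"
    define g' where "g' = vector_derivative \<gamma> (at t within {0..1})"
    have "\<gamma> t \<in> W" using \<gamma> t by (auto simp: path_image_def)
    moreover have "ds_slice I \<gamma> t = cl_complex I (- \<i> * g')"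
      by (simp only: ds_slice_def g'_def paravector_slice_point mult.commute [of "- \<i>"]
          cl_complex_minus cl_complex_i cl_complex_mult [OF I])
    ultimately have "cl_complex I (a (\<gamma> t)) * (ds_slice I \<gamma> t * f (slice_point I (\<gamma> t))) =
        (\<Sum>E\<in>Basis. cl_complex I (a (\<gamma> t) * (- \<i> * g' * F E (\<gamma> t))) * E)"
      by (simp only: f sum_distrib_left cl_complex_mult [OF I] mult.assoc)
    also have "\<dots> = (\<Sum>E\<in>Basis. cl_complex I (- \<i> * (a (\<gamma> t) * F E (\<gamma> t) * g')) * E)"
      by (simp only: mult_ac)
    finally show "(\<Sum>E\<in>Basis. cl_complex I (- \<i> * (a (\<gamma> t) * F E (\<gamma> t) * vector_derivative \<gamma> (at t within {0..1}))) * E) =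
      cl_complex I (a (\<gamma> t)) * (ds_slice I \<gamma> t * f (slice_point I (\<gamma> t)))"
      by (simp add: g'_def)
  qed
qed

lemma homologous_cycles:
  fixes g :: "complex \<Rightarrow> complex"
  assumes "open S" "g holomorphic_on S" "finite \<Gamma>" "finite \<Gamma>'"
    and loops: "\<And>\<gamma>. \<gamma> \<in> \<Gamma> \<union> \<Gamma>' \<Longrightarrow> valid_path \<gamma> \<and> pathfinish \<gamma> = pathstart \<gamma> \<and> path_image \<gamma> \<subseteq> S"
    and wn: "\<And>w. w \<notin> S \<Longrightarrow> (\<Sum>\<gamma>\<in>\<Gamma>. winding_number \<gamma> w) = (\<Sum>\<gamma>\<in>\<Gamma>'. winding_number \<gamma> w)"
  shows "(\<Sum>\<gamma>\<in>\<Gamma>. contour_integral \<gamma> g) = (\<Sum>\<gamma>\<in>\<Gamma>'. contour_integral \<gamma> g)"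
proof -
  \<comment> \<open>The difference of the two cycles as a weighted family; a curve that lies in both
    sets gets the weight 0.\<close>
  define c where "c \<gamma> = (of_bool (\<gamma> \<in> \<Gamma>) - of_bool (\<gamma> \<in> \<Gamma>') :: complex)" for \<gamma>
  have eq: "(\<Sum>\<gamma>\<in>\<Gamma> \<union> \<Gamma>'. c \<gamma> * u \<gamma>) = (\<Sum>\<gamma>\<in>\<Gamma>. u \<gamma>) - (\<Sum>\<gamma>\<in>\<Gamma>'. u \<gamma>)" for u
  proof -
    have "(\<Sum>\<gamma>\<in>\<Gamma> \<union> \<Gamma>'. of_bool (\<gamma> \<in> \<Gamma>) * u \<gamma>) = (\<Sum>\<gamma>\<in>\<Gamma>. u \<gamma>)"
      by (rule sum.mono_neutral_cong_right) (use assms in auto)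
    moreover have "(\<Sum>\<gamma>\<in>\<Gamma> \<union> \<Gamma>'. of_bool (\<gamma> \<in> \<Gamma>') * u \<gamma>) = (\<Sum>\<gamma>\<in>\<Gamma>'. u \<gamma>)"
      by (rule sum.mono_neutral_cong_right) (use assms in auto)
    ultimately show ?thesis by (simp add: c_def left_diff_distrib sum_subtractf)
  qed
  have "(\<Sum>\<gamma>\<in>\<Gamma> \<union> \<Gamma>'. c \<gamma> * contour_integral \<gamma> g) = 0"
    by (rule Cauchy_theorem_cycle [OF assms(1,2)]) (use assms(3,4) loops wn in \<open>auto simp: eq\<close>)
  then show ?thesis by (simp add: eq)
qed

lemma tq_holomorphic:
  assumes "\<And>w. w \<in> S \<Longrightarrow> qf w x \<noteq> 0"
  shows "(\<lambda>w. tq i l w x) holomorphic_on S"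
proof -
  have "(\<lambda>w. (w - of_real (fst x)) ^ i * inverse ((w - of_real (fst x))\<^sup>2 + of_real ((norm (snd x))\<^sup>2)) ^ l) holomorphic_on S"
    using assms by (intro holomorphic_intros) (auto simp: qf_def)
  then show ?thesis by (simp add: tq_def qf_def)
qed

text \<open>
  For a fixed point \<open>x\<close>, the integrals of the kernels are combinations of contour integrals of
  functions holomorphic off the two points \<open>x\<^sub>0 \<plusminus> i |v|\<close>, \<open>v\<close> the vector part of \<open>x\<close>, so only the homology class of the cycle
  matters.
\<close>

lemma axial_fam_cycle_independent:
  fixes f :: "('n::{finite,linorder}) cl_fun"
  assumes k: "axial_fam I k" and I: "norm I = 1" and W: "open W" and F: "\<And>E. F E holomorphic_on W"
    and f: "\<And>z. z \<in> W \<Longrightarrow> f (slice_point I z) = (\<Sum>E\<in>Basis. cl_complex I (F E z) * E)"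
    and fin: "finite \<Gamma>" "finite \<Gamma>'"
    and loops: "\<And>\<gamma>. \<gamma> \<in> \<Gamma> \<union> \<Gamma>' \<Longrightarrow> valid_path \<gamma> \<and> pathfinish \<gamma> = pathstart \<gamma> \<and> path_image \<gamma> \<subseteq> W \<inter> {w. qf w x \<noteq> 0}"
    and wn: "\<And>w. w \<notin> W \<or> qf w x = 0 \<Longrightarrow> (\<Sum>\<gamma>\<in>\<Gamma>. winding_number \<gamma> w) = (\<Sum>\<gamma>\<in>\<Gamma>'. winding_number \<gamma> w)"
  defines "d \<equiv> \<lambda>k \<gamma> t. k (\<gamma> t) x * (ds_slice I \<gamma> t * f (slice_point I (\<gamma> t)))"
  shows "\<gamma> \<in> \<Gamma> \<Longrightarrow> d k \<gamma> integrable_on {0..1}"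
    and "(\<Sum>\<gamma>\<in>\<Gamma>. integral {0..1} (d k \<gamma>)) = (\<Sum>\<gamma>\<in>\<Gamma>'. integral {0..1} (d k \<gamma>))"
proof -
  define S where "S = W \<inter> {w. qf w x \<noteq> 0}"
  have "open {w. qf w x \<noteq> 0}"
    unfolding qf_def by (intro open_Collect_neq continuous_intros)
  then have S: "open S" using W by (auto simp: S_def)
  have hol: "(\<lambda>w. tq i l w x * F E w) holomorphic_on S" for i l E
    by (intro holomorphic_intros tq_holomorphic holomorphic_on_subset [OF F]) (auto simp: S_def)
  have base: "((\<lambda>t. cl_complex I (tq i l (\<gamma> t) x) * (ds_slice I \<gamma> t * f (slice_point I (\<gamma> t)))) has_integral
    (\<Sum>E\<in>Basis. cl_complex I (- \<i> * contour_integral \<gamma> (\<lambda>w. tq i l w x * F E w)) * E)) {0..1}"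
    if "\<gamma> \<in> \<Gamma> \<union> \<Gamma>'" for i l \<gamma>
    using loops [OF that]
    by (intro has_integral_slice_component [where W = W] I f contour_integrable_holomorphic_simple [OF hol S])
       (auto simp: S_def)
  have base_sum: "(\<Sum>\<gamma>\<in>\<Gamma>. \<Sum>E\<in>Basis. cl_complex I (- \<i> * contour_integral \<gamma> (\<lambda>w. tq i l w x * F E w)) * E) =
      (\<Sum>\<gamma>\<in>\<Gamma>'. \<Sum>E\<in>Basis. cl_complex I (- \<i> * contour_integral \<gamma> (\<lambda>w. tq i l w x * F E w)) * E)" for i l
  proof -
    have "(\<Sum>\<gamma>\<in>G. \<Sum>E\<in>Basis. cl_complex I (- \<i> * contour_integral \<gamma> (\<lambda>w. tq i l w x * F E w)) * E) =
        (\<Sum>E\<in>Basis. cl_complex I (- \<i> * (\<Sum>\<gamma>\<in>G. contour_integral \<gamma> (\<lambda>w. tq i l w x * F E w))) * E)" for G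
      unfolding sum_distrib_left cl_complex_sum sum_distrib_right by (rule sum.swap)
    moreover have "(\<Sum>\<gamma>\<in>\<Gamma>. contour_integral \<gamma> (\<lambda>w. tq i l w x * F E w)) =
        (\<Sum>\<gamma>\<in>\<Gamma>'. contour_integral \<gamma> (\<lambda>w. tq i l w x * F E w))" for E
      using loops wn by (intro homologous_cycles [OF S hol fin]) (auto simp: S_def)
    ultimately show ?thesis by simp
  qed
  \<comment> \<open>Integrability and equality of the sums are carried together: the integral of a
    sum or a multiple can only be computed once the parts are known to be integrable.\<close>
  have main: "\<exists>J. (\<forall>\<gamma>\<in>\<Gamma> \<union> \<Gamma>'. (d k \<gamma> has_integral J \<gamma>) {0..1}) \<and> sum J \<Gamma> = sum J \<Gamma>'"
    using k
  proof (induction rule: axial_fam.induct)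
    case (axial_fam_scal i l)
    show ?case
      by (rule exI [of _ "\<lambda>\<gamma>. \<Sum>E\<in>Basis. cl_complex I (- \<i> * contour_integral \<gamma> (\<lambda>w. tq i l w x * F E w)) * E"])
         (use base base_sum in \<open>auto simp: d_def\<close>)
  next
    case (axial_fam_vec i l)
    show ?case
    proof (rule exI [of _ "\<lambda>\<gamma>. paravector (0, snd x) *
        (\<Sum>E\<in>Basis. cl_complex I (- \<i> * contour_integral \<gamma> (\<lambda>w. tq i l w x * F E w)) * E)"], intro conjI ballI)
      fix \<gamma> assume "\<gamma> \<in> \<Gamma> \<union> \<Gamma>'"
      from has_integral_linear [OF base [OF this] cl_mult.bounded_linear_right [of "paravector (0, snd x)"]]
      show "(d (\<lambda>w x. paravector (0, snd x) * cl_complex I (tq i l w x)) \<gamma> has_integral paravector (0, snd x) *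
        (\<Sum>E\<in>Basis. cl_complex I (- \<i> * contour_integral \<gamma> (\<lambda>w. tq i l w x * F E w)) * E)) {0..1}"
        by (simp add: d_def comp_def mult.assoc)
    qed (simp only: base_sum flip: sum_distrib_left)
  next
    case (axial_fam_add k k')
    then obtain J J' where "\<forall>\<gamma>\<in>\<Gamma> \<union> \<Gamma>'. (d k \<gamma> has_integral J \<gamma>) {0..1}" "sum J \<Gamma> = sum J \<Gamma>'"
      "\<forall>\<gamma>\<in>\<Gamma> \<union> \<Gamma>'. (d k' \<gamma> has_integral J' \<gamma>) {0..1}" "sum J' \<Gamma> = sum J' \<Gamma>'" by blast
    then show ?case
      by (intro exI [of _ "\<lambda>\<gamma>. J \<gamma> + J' \<gamma>"]) (auto simp: d_def distrib_right sum.distrib intro!: has_integral_add)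
  next
    case (axial_fam_scaleR k r)
    then obtain J where "\<forall>\<gamma>\<in>\<Gamma> \<union> \<Gamma>'. (d k \<gamma> has_integral J \<gamma>) {0..1}" "sum J \<Gamma> = sum J \<Gamma>'" by blast
    then show ?case
      by (intro exI [of _ "\<lambda>\<gamma>. r *\<^sub>R J \<gamma>"]) (auto simp: d_def simp flip: scaleR_sum_right intro!: has_integral_cmul)
  next
    case (axial_fam_cong k k')
    then obtain J where J: "\<forall>\<gamma>\<in>\<Gamma> \<union> \<Gamma>'. (d k \<gamma> has_integral J \<gamma>) {0..1}" "sum J \<Gamma> = sum J \<Gamma>'" by blast
    have "(d k' \<gamma> has_integral J \<gamma>) {0..1}" if "\<gamma> \<in> \<Gamma> \<union> \<Gamma>'" for \<gamma>
    proof (rule has_integral_eq)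
      show "(d k \<gamma> has_integral J \<gamma>) {0..1}" using J that by blast
      show "d k \<gamma> t = d k' \<gamma> t" if "t \<in> {0..1}" for t
      proof -
        have "\<gamma> t \<in> path_image \<gamma>" using that by (simp add: path_image_def)
        then have "qf (\<gamma> t) x \<noteq> 0" using loops [OF \<open>\<gamma> \<in> _\<close>] by blast
        then show ?thesis by (simp add: d_def axial_fam_cong.hyps(2))
      qed
    qed
    with J(2) show ?case by blast
  qed
  then obtain J where J: "\<And>\<gamma>. \<gamma> \<in> \<Gamma> \<union> \<Gamma>' \<Longrightarrow> (d k \<gamma> has_integral J \<gamma>) {0..1}" "sum J \<Gamma> = sum J \<Gamma>'" by blast
  show "\<gamma> \<in> \<Gamma> \<Longrightarrow> d k \<gamma> integrable_on {0..1}" using J(1) by blast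
  have "integral {0..1} (d k \<gamma>) = J \<gamma>" if "\<gamma> \<in> \<Gamma> \<union> \<Gamma>'" for \<gamma>
    using J(1) [OF that] by (rule integral_unique)
  then show "(\<Sum>\<gamma>\<in>\<Gamma>. integral {0..1} (d k \<gamma>)) = (\<Sum>\<gamma>\<in>\<Gamma>'. integral {0..1} (d k \<gamma>))"
    using J(2) by simp
qed

section \<open>Local representation by circles\<close>

text \<open>The representation formula of slice analysis, for kernels. \<open>tq\<close> has the
  same value at all three points. The weights add up to 1, which settles scalar generators; for
  vector ones their difference is - \<omega> J, and - \<omega> J J = \<omega>.\<close>

lemma axial_fam_representation:
  assumes "axial_fam I k" and J: "norm J = 1" and \<omega>: "norm \<omega> = 1" and "qf w (u, r *\<^sub>R \<omega>) \<noteq> 0"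
  shows "k w (u, r *\<^sub>R \<omega>) =
    ((1 / 2) *\<^sub>R (1 - paravector (0, \<omega>) * paravector (0, J))) * k w (u, r *\<^sub>R J) +
    ((1 / 2) *\<^sub>R (1 + paravector (0, \<omega>) * paravector (0, J))) * k w (u, (- r) *\<^sub>R J)"
  using assms(1,4)
proof (induction rule: axial_fam.induct)
  case (axial_fam_scal i l)
  have t: "tq i l w (u, r *\<^sub>R J) = tq i l w (u, r *\<^sub>R \<omega>)" "tq i l w (u, (- r) *\<^sub>R J) = tq i l w (u, r *\<^sub>R \<omega>)"
    using J \<omega> by (simp_all add: tq_def qf_def)
  have "((1 / 2) *\<^sub>R (1 - p)) * q + ((1 / 2) *\<^sub>R (1 + p)) * q = q" for p q :: "'a clifford"
  proof -
    have "((1 / 2) *\<^sub>R (1 - p)) * q + ((1 / 2) *\<^sub>R (1 + p)) * q = (1 / 2 + 1 / 2) *\<^sub>R q"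
      by (simp only: scaleR_add_left) (simp add: algebra_simps)
    then show ?thesis by simp
  qed
  then show ?case unfolding t by simp
next
  case (axial_fam_vec i l)
  have t: "tq i l w (u, r *\<^sub>R J) = tq i l w (u, r *\<^sub>R \<omega>)" "tq i l w (u, (- r) *\<^sub>R J) = tq i l w (u, r *\<^sub>R \<omega>)"
    using J \<omega> by (simp_all add: tq_def qf_def)
  define j where "j = paravector (0, J)"
  define o' where "o' = paravector (0, \<omega>)"
  define a where "a = cl_complex I (tq i l w (u, r *\<^sub>R \<omega>))"
  have p: "paravector (0, r *\<^sub>R v) = r *\<^sub>R paravector (0, v)" for r and v :: "(real, 'a) vec"
    using paravector_scaleR [of r "(0, v)"] by simp
  have jj: "j * j = - 1" using paravector_square [of J] J by (simp add: j_def)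
  have jja: "j * (j * a) = - a" using jj by (simp flip: mult.assoc)
  have "((1 / 2) *\<^sub>R (1 - o' * j)) * (r *\<^sub>R j * a) + ((1 / 2) *\<^sub>R (1 + o' * j)) * ((- r) *\<^sub>R j * a) =
      - r *\<^sub>R (o' * (j * (j * a)))"
  proof -
    have "((1 / 2) *\<^sub>R (1 - o' * j)) * (r *\<^sub>R j * a) + ((1 / 2) *\<^sub>R (1 + o' * j)) * ((- r) *\<^sub>R j * a) =
        (- (r / 2) - r / 2) *\<^sub>R (o' * (j * (j * a)))"
      by (simp only: scaleR_diff_left) (simp add: algebra_simps)
    then show ?thesis by simp
  qed
  also have "\<dots> = r *\<^sub>R o' * a" by (simp add: jja)
  finally show ?case
    unfolding t snd_conv p by (simp only: a_def j_def o'_def)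
next
  case (axial_fam_add k k')
  then show ?case by (simp add: distrib_left add_ac)
next
  case (axial_fam_scaleR k s)
  then show ?case by (simp add: scaleR_add_right)
next
  case (axial_fam_cong k k')
  have q: "qf w (u, r *\<^sub>R J) \<noteq> 0" "qf w (u, (- r) *\<^sub>R J) \<noteq> 0"
    using J \<omega> axial_fam_cong.prems by (simp_all add: qf_def)
  show ?case
    using axial_fam_cong.IH [OF axial_fam_cong.prems]
    by (simp only: axial_fam_cong.hyps(2) [OF q(1)] axial_fam_cong.hyps(2) [OF q(2)]
        axial_fam_cong.hyps(2) [OF axial_fam_cong.prems])
qed

text \<open>If the centre is real the two circles are the same element of the set and count once;
  otherwise the discs are disjoint. In both cases an interior point is encircled exactly
  once.\<close>

lemma winding_number_two_circles:
  assumes e: "e > 0" "Im z = 0 \<or> cball z e \<inter> cball (cnj z) e = {}"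
  shows "w \<in> ball z e \<union> ball (cnj z) e \<Longrightarrow> (\<Sum>\<gamma>\<in>{circlepath z e, circlepath (cnj z) e}. winding_number \<gamma> w) = 1"
    and "w \<notin> cball z e \<union> cball (cnj z) e \<Longrightarrow> (\<Sum>\<gamma>\<in>{circlepath z e, circlepath (cnj z) e}. winding_number \<gamma> w) = 0"
proof -
  have in1: "winding_number (circlepath a e) w = 1" if "w \<in> ball a e" for a
    using that by (intro winding_number_circlepath) (simp add: dist_norm norm_minus_commute)
  have out0: "winding_number (circlepath a e) w = 0" if "w \<notin> cball a e" for a
    by (rule winding_number_zero_outside [where s = "cball a e"])
       (use that e(1) in \<open>auto simp: valid_path_imp_path\<close>)
  show "(\<Sum>\<gamma>\<in>{circlepath z e, circlepath (cnj z) e}. winding_number \<gamma> w) = 1" if "w \<in> ball z e \<union> ball (cnj z) e"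
  proof (cases "Im z = 0")
    case True
    then have "cnj z = z" by (simp add: complex_eq_iff)
    then show ?thesis using that in1 by simp
  next
    case False
    then have "circlepath z e \<noteq> circlepath (cnj z) e"
      by (metis add_right_cancel complex_cnj_cancel_iff complex_cnj_cnj complex_eq_iff equal_neg_zero cnj.simps(2) pathstart_circlepath)
    moreover have "w \<in> ball z e \<and> w \<notin> cball (cnj z) e \<or> w \<notin> cball z e \<and> w \<in> ball (cnj z) e"
      using that e(2) False ball_subset_cball by blast
    ultimately show ?thesis using in1 out0 by auto
  qed
  show "(\<Sum>\<gamma>\<in>{circlepath z e, circlepath (cnj z) e}. winding_number \<gamma> w) = 0" if "w \<notin> cball z e \<union> cball (cnj z) e"
    using that out0 by (intro sum.neutral) auto
qed

text \<open>f together with its holomorphic components and one slice of integration.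
  \<open>f_slice\<close> gives f on that slice, where the integrals live; \<open>f_eq\<close> gives
  f at arbitrary points, where it is to be recovered.\<close>

locale slice_function =
  fixes I :: "real ^ ('n::{finite,linorder})" and f :: "'n cl_fun" and G :: "'n point set"
    and F :: "'n clifford \<Rightarrow> complex \<Rightarrow> complex"
  assumes I: "norm I = 1" and open_G: "open G" and axial_G: "axially_symmetric G"
    and hol_F: "F E holomorphic_on slice_dom G"
    and cnj_F: "z \<in> slice_dom G \<Longrightarrow> F E (cnj z) = cnj (F E z)"
    and f_slice: "z \<in> slice_dom G \<Longrightarrow> f (slice_point I z) = (\<Sum>E\<in>Basis. cl_complex I (F E z) * E)"
    and f_eq: "x \<in> G \<Longrightarrow> f x = (\<Sum>E\<in>Basis. (of_real (Re (F E (slice_coord x))) +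
        of_real (Im (F E (slice_coord x))) * paravector (0, sgn (snd x))) * E)"
begin

definition dens :: "(real \<Rightarrow> complex) \<Rightarrow> real \<Rightarrow> 'n clifford"
  where "dens \<gamma> t = (1 / (2 * pi)) *\<^sub>R (ds_slice I \<gamma> t * f (slice_point I (\<gamma> t)))"

text \<open>Let \<zeta> be the slice coordinate of y and r = |v|. Partial fractions express t/Q and
  r/Q through 1/(w - \<zeta>) and 1/(w - cnj \<zeta>). By the symmetry of F, Cauchy's formula at the
  two points turns these into the real and the imaginary part of F(\<zeta>), the coefficients of 1
  and \<omega> in f(y).\<close>

lemma Cauchy_representation:
  assumes fin: "finite \<Gamma>"
    and loops: "\<And>\<gamma>. \<gamma> \<in> \<Gamma> \<Longrightarrow> valid_path \<gamma> \<and> pathfinish \<gamma> = pathstart \<gamma> \<and> path_image \<gamma> \<subseteq> slice_dom G"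
    and out: "\<And>w. w \<notin> slice_dom G \<Longrightarrow> (\<Sum>\<gamma>\<in>\<Gamma>. winding_number \<gamma> w) = 0"
    and y: "y \<in> G"
    and ins: "\<And>w. qf w y = 0 \<Longrightarrow> (\<Sum>\<gamma>\<in>\<Gamma>. winding_number \<gamma> w) = 1 \<and> w \<notin> (\<Union>\<gamma>\<in>\<Gamma>. path_image \<gamma>)"
  shows "f y = (\<Sum>\<gamma>\<in>\<Gamma>. integral {0..1} (\<lambda>t. kern I (\<gamma> t) y * dens \<gamma> t))"
proof -
  define \<zeta> where "\<zeta> = slice_coord y"
  define r where "r = norm (snd y)"
  define W where "W = slice_dom G"
  have W: "open W" unfolding W_def by (rule open_slice_dom [OF open_G axial_G])
  have q: "qf w y = (w - \<zeta>) * (w - cnj \<zeta>)" for w by (simp add: qf_slice_coord \<zeta>_def)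
  have \<zeta>W: "\<zeta> \<in> W" "cnj \<zeta> \<in> W"
    using slice_coord_mem [OF axial_G] cnj_slice_dom [OF axial_G] y by (simp_all add: \<zeta>_def W_def)
  have \<zeta>im: "\<zeta> \<notin> path_image \<gamma>" "cnj \<zeta> \<notin> path_image \<gamma>" if "\<gamma> \<in> \<Gamma>" for \<gamma>
    using ins [of \<zeta>] ins [of "cnj \<zeta>"] that by (auto simp: q)
  have cint: "(\<lambda>w. F E w / (w - a)) contour_integrable_on \<gamma>" if "\<gamma> \<in> \<Gamma>" "a = \<zeta> \<or> a = cnj \<zeta>" for E \<gamma> a
  proof (rule contour_integrable_holomorphic_simple [of _ "W - {a}"])
    show "(\<lambda>w. F E w / (w - a)) holomorphic_on W - {a}"
      by (intro holomorphic_intros holomorphic_on_subset [OF hol_F]) (auto simp: W_def)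
  qed (use loops that \<zeta>im W in \<open>auto simp: W_def open_delete\<close>)
  have Cauchy: "(\<Sum>\<gamma>\<in>\<Gamma>. contour_integral \<gamma> (\<lambda>w. F E w / (w - a))) = 2 * pi * \<i> * F E a" if "a = \<zeta> \<or> a = cnj \<zeta>" for E a
    using Cauchy_integral_formula_cycle [OF W, of "F E" \<Gamma> "\<lambda>_. 1" a] fin loops out ins [of a] hol_F [of E] that \<zeta>W \<zeta>im
    by (auto simp: W_def q)
  \<comment> \<open>The second identity carries the factor r, so that it also holds on the real
    axis, where the two poles merge and both sides are zero.\<close>
  have tq1: "tq 1 1 w y * F E w = (1 / 2) * (F E w / (w - \<zeta>)) + (1 / 2) * (F E w / (w - cnj \<zeta>))"
    and tq0: "of_real r * (tq 0 1 w y * F E w) = (1 / (2 * \<i>)) * (F E w / (w - \<zeta>) - F E w / (w - cnj \<zeta>))"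
    if "w \<noteq> \<zeta>" "w \<noteq> cnj \<zeta>" for w E
  proof -
    have x: "\<zeta> = of_real (fst y) + \<i> * of_real r" "cnj \<zeta> = of_real (fst y) - \<i> * of_real r"
      by (simp_all add: \<zeta>_def slice_coord_def r_def complex_eq_iff)
    have t: "w - of_real (fst y) = ((w - \<zeta>) + (w - cnj \<zeta>)) / 2" unfolding x by simp
    show "tq 1 1 w y * F E w = (1 / 2) * (F E w / (w - \<zeta>)) + (1 / 2) * (F E w / (w - cnj \<zeta>))"
      unfolding tq_def t q using that by (simp add: divide_simps) (simp add: algebra_simps)
    have "2 * \<i> * of_real r = (w - cnj \<zeta>) - (w - \<zeta>)" unfolding x by simp
    then have r: "of_real r = ((w - cnj \<zeta>) - (w - \<zeta>)) / (2 * \<i>)" by (simp add: field_simps)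
    show "of_real r * (tq 0 1 w y * F E w) = (1 / (2 * \<i>)) * (F E w / (w - \<zeta>) - F E w / (w - cnj \<zeta>))"
      unfolding r tq_def q using that by (simp add: divide_simps) (simp add: algebra_simps)
  qed
  have off: "w \<noteq> \<zeta>" "w \<noteq> cnj \<zeta>" "qf w y \<noteq> 0" if "w \<in> path_image \<gamma>" "\<gamma> \<in> \<Gamma>" for w \<gamma>
    using \<zeta>im [OF that(2)] that(1) by (auto simp: q)
  have int_tq: "(\<lambda>w. tq i 1 w y * F E w) contour_integrable_on \<gamma>" if "\<gamma> \<in> \<Gamma>" for i \<gamma> E
  proof (rule contour_integrable_holomorphic_simple [of _ "W - {\<zeta>, cnj \<zeta>}"])
    show "(\<lambda>w. tq i 1 w y * F E w) holomorphic_on W - {\<zeta>, cnj \<zeta>}"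
      by (intro holomorphic_intros tq_holomorphic holomorphic_on_subset [OF hol_F]) (auto simp: W_def q)
  qed (use loops that \<zeta>im W in \<open>auto simp: W_def intro: open_Diff finite_imp_closed\<close>)
  have sum1: "(\<Sum>\<gamma>\<in>\<Gamma>. contour_integral \<gamma> (\<lambda>w. tq 1 1 w y * F E w)) = 2 * pi * \<i> * Re (F E \<zeta>)" for E
  proof -
    have ci: "contour_integral \<gamma> (\<lambda>w. tq 1 1 w y * F E w) =
        (1 / 2) * contour_integral \<gamma> (\<lambda>w. F E w / (w - \<zeta>)) + (1 / 2) * contour_integral \<gamma> (\<lambda>w. F E w / (w - cnj \<zeta>))"
      if \<gamma>: "\<gamma> \<in> \<Gamma>" for \<gamma>
    proof -
      have "contour_integral \<gamma> (\<lambda>w. tq 1 1 w y * F E w) =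
          contour_integral \<gamma> (\<lambda>w. (1 / 2) * (F E w / (w - \<zeta>)) + (1 / 2) * (F E w / (w - cnj \<zeta>)))"
        by (rule contour_integral_eq) (use tq1 off \<gamma> in blast)
      then show ?thesis
        using cint [OF \<gamma>]
        by (simp only: contour_integral_add contour_integrable_lmul contour_integral_lmul simp_thms)
    qed
    have "(\<Sum>\<gamma>\<in>\<Gamma>. contour_integral \<gamma> (\<lambda>w. tq 1 1 w y * F E w)) =
        (\<Sum>\<gamma>\<in>\<Gamma>. (1 / 2) * contour_integral \<gamma> (\<lambda>w. F E w / (w - \<zeta>)) +
          (1 / 2) * contour_integral \<gamma> (\<lambda>w. F E w / (w - cnj \<zeta>)))"
      by (rule sum.cong [OF refl ci])
    also have "\<dots> = (1 / 2) * (2 * pi * \<i> * F E \<zeta>) + (1 / 2) * (2 * pi * \<i> * F E (cnj \<zeta>))"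
      by (simp only: sum.distrib Cauchy simp_thms flip: sum_distrib_left)
    also have "\<dots> = 2 * pi * \<i> * Re (F E \<zeta>)"
      using cnj_F [of \<zeta> E] \<zeta>W(1) by (simp add: W_def complex_eq_iff)
    finally show ?thesis .
  qed
  have sum0: "of_real r * (\<Sum>\<gamma>\<in>\<Gamma>. contour_integral \<gamma> (\<lambda>w. tq 0 1 w y * F E w)) = 2 * pi * \<i> * Im (F E \<zeta>)" for E
  proof -
    have ci: "of_real r * contour_integral \<gamma> (\<lambda>w. tq 0 1 w y * F E w) =
        (1 / (2 * \<i>)) * (contour_integral \<gamma> (\<lambda>w. F E w / (w - \<zeta>)) - contour_integral \<gamma> (\<lambda>w. F E w / (w - cnj \<zeta>)))"
      if \<gamma>: "\<gamma> \<in> \<Gamma>" for \<gamma>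
    proof -
      have "of_real r * contour_integral \<gamma> (\<lambda>w. tq 0 1 w y * F E w) =
          contour_integral \<gamma> (\<lambda>w. of_real r * (tq 0 1 w y * F E w))"
        by (rule contour_integral_lmul [OF int_tq [OF \<gamma>], symmetric])
      also have "\<dots> = contour_integral \<gamma> (\<lambda>w. (1 / (2 * \<i>)) * (F E w / (w - \<zeta>) - F E w / (w - cnj \<zeta>)))"
        by (rule contour_integral_eq) (use tq0 off \<gamma> in blast)
      finally show ?thesis
        using cint [OF \<gamma>]
        by (simp only: contour_integral_diff contour_integrable_diff contour_integral_lmul simp_thms)
    qed
    have "of_real r * (\<Sum>\<gamma>\<in>\<Gamma>. contour_integral \<gamma> (\<lambda>w. tq 0 1 w y * F E w)) =
        (\<Sum>\<gamma>\<in>\<Gamma>. (1 / (2 * \<i>)) * (contour_integral \<gamma> (\<lambda>w. F E w / (w - \<zeta>)) -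
          contour_integral \<gamma> (\<lambda>w. F E w / (w - cnj \<zeta>))))"
      unfolding sum_distrib_left by (rule sum.cong [OF refl ci])
    also have "\<dots> = (1 / (2 * \<i>)) * (2 * pi * \<i> * F E \<zeta> - 2 * pi * \<i> * F E (cnj \<zeta>))"
      by (simp only: sum_subtractf Cauchy simp_thms flip: sum_distrib_left)
    also have "\<dots> = 2 * pi * \<i> * Im (F E \<zeta>)"
      using cnj_F [of \<zeta> E] \<zeta>W(1) by (simp add: W_def complex_eq_iff)
    finally show ?thesis .
  qed
  define C where "C i \<gamma> = (\<Sum>E\<in>Basis. cl_complex I (- \<i> * contour_integral \<gamma> (\<lambda>w. tq i 1 w y * F E w)) * E)" for i \<gamma>
  have int: "integral {0..1} (\<lambda>t. kern I (\<gamma> t) y * dens \<gamma> t) =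
      (1 / (2 * pi)) *\<^sub>R (C 1 \<gamma> + paravector (0, snd y) * C 0 \<gamma>)" if \<gamma>: "\<gamma> \<in> \<Gamma>" for \<gamma>
  proof (rule integral_unique)
    define d where "d t = ds_slice I \<gamma> t * f (slice_point I (\<gamma> t))" for t
    have hi: "((\<lambda>t. cl_complex I (tq i 1 (\<gamma> t) y) * d t) has_integral C i \<gamma>) {0..1}" for i
      unfolding d_def C_def
      by (rule has_integral_slice_component [OF I _ f_slice int_tq [OF \<gamma>], of "slice_dom G"]) (use loops [OF \<gamma>] in auto)
    have "((\<lambda>t. (1 / (2 * pi)) *\<^sub>R (cl_complex I (tq 1 1 (\<gamma> t) y) * d t +
        paravector (0, snd y) * (cl_complex I (tq 0 1 (\<gamma> t) y) * d t))) has_integral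
        (1 / (2 * pi)) *\<^sub>R (C 1 \<gamma> + paravector (0, snd y) * C 0 \<gamma>)) {0..1}"
      using has_integral_linear [OF hi cl_mult.bounded_linear_right, of "paravector (0, snd y)" 0]
      by (intro has_integral_cmul has_integral_add hi) (simp add: comp_def)
    then show "((\<lambda>t. kern I (\<gamma> t) y * dens \<gamma> t) has_integral
        (1 / (2 * pi)) *\<^sub>R (C 1 \<gamma> + paravector (0, snd y) * C 0 \<gamma>)) {0..1}"
    proof (rule has_integral_eq [rotated])
      fix t :: real assume "t \<in> {0..1}"
      then have "qf (\<gamma> t) y \<noteq> 0" using off(3) [OF _ \<gamma>] by (simp add: path_image_def)
      then show "(1 / (2 * pi)) *\<^sub>R (cl_complex I (tq 1 1 (\<gamma> t) y) * d t +
        paravector (0, snd y) * (cl_complex I (tq 0 1 (\<gamma> t) y) * d t)) = kern I (\<gamma> t) y * dens \<gamma> t"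
        by (simp add: kern_eq [OF I] dens_def d_def distrib_right mult.assoc)
    qed
  qed
  have C_sum: "(\<Sum>\<gamma>\<in>\<Gamma>. C i \<gamma>) =
      (\<Sum>E\<in>Basis. cl_complex I (- \<i> * (\<Sum>\<gamma>\<in>\<Gamma>. contour_integral \<gamma> (\<lambda>w. tq i 1 w y * F E w))) * E)" for i
    unfolding C_def sum_distrib_left cl_complex_sum sum_distrib_right by (rule sum.swap)
  \<comment> \<open>The factor - i of the form turns the 2 \<pi> i of Cauchy's formula into 2 \<pi>,
    which the factor in \<open>dens\<close> cancels.\<close>
  have re: "cl_complex I (- \<i> * (2 * pi * \<i> * of_real a)) = (2 * pi) *\<^sub>R of_real a" for a
  proof -
    have "- \<i> * (2 * pi * \<i> * of_real a) = of_real (2 * pi * a)" by (simp add: complex_eq_iff)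
    then show ?thesis by (simp only: cl_complex_of_real) (simp add: of_real_def)
  qed
  have s1: "(\<Sum>\<gamma>\<in>\<Gamma>. C 1 \<gamma>) = (2 * pi) *\<^sub>R (\<Sum>E\<in>Basis. of_real (Re (F E \<zeta>)) * E)"
    unfolding C_sum sum1 re by (simp add: scaleR_sum_right)
  have s0: "paravector (0, snd y) * (\<Sum>\<gamma>\<in>\<Gamma>. C 0 \<gamma>) =
      (2 * pi) *\<^sub>R (\<Sum>E\<in>Basis. of_real (Im (F E \<zeta>)) * paravector (0, sgn (snd y)) * E)"
  proof -
    have "snd y = r *\<^sub>R sgn (snd y)" by (cases "snd y = 0") (simp_all add: r_def sgn_div_norm)
    then have p: "paravector (0, snd y) = r *\<^sub>R paravector (0, sgn (snd y))"
      using paravector_scaleR [of r "(0, sgn (snd y))"] by simp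
    have "r *\<^sub>R cl_complex I (- \<i> * z) = cl_complex I (- \<i> * (of_real r * z))" for z
      using cl_complex_scaleR [of I r "- \<i> * z"] by (simp add: scaleR_conv_of_real mult_ac)
    then have "r *\<^sub>R (\<Sum>\<gamma>\<in>\<Gamma>. C 0 \<gamma>) = (\<Sum>E\<in>Basis. cl_complex I (- \<i> * (2 * pi * \<i> * of_real (Im (F E \<zeta>)))) * E)"
      unfolding C_sum sum0 [symmetric] scaleR_sum_right by (simp only: mult_scaleR_left [symmetric])
    then have "r *\<^sub>R (\<Sum>\<gamma>\<in>\<Gamma>. C 0 \<gamma>) = (2 * pi) *\<^sub>R (\<Sum>E\<in>Basis. of_real (Im (F E \<zeta>)) * E)"
      unfolding re by (simp add: scaleR_sum_right)
    then have "paravector (0, snd y) * (\<Sum>\<gamma>\<in>\<Gamma>. C 0 \<gamma>) =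
        paravector (0, sgn (snd y)) * ((2 * pi) *\<^sub>R (\<Sum>E\<in>Basis. of_real (Im (F E \<zeta>)) * E))"
      unfolding p by (simp only: mult_scaleR_left flip: mult_scaleR_right)
    then show ?thesis by (simp add: sum_distrib_left of_real_def)
  qed
  have "(\<Sum>\<gamma>\<in>\<Gamma>. integral {0..1} (\<lambda>t. kern I (\<gamma> t) y * dens \<gamma> t)) =
      (1 / (2 * pi)) *\<^sub>R ((\<Sum>\<gamma>\<in>\<Gamma>. C 1 \<gamma>) + paravector (0, snd y) * (\<Sum>\<gamma>\<in>\<Gamma>. C 0 \<gamma>))"
    by (simp add: int sum.distrib sum_distrib_left scaleR_sum_right scaleR_add_right)
  also have "\<dots> = f y"
    unfolding s1 s0 f_eq [OF y] by (simp add: \<zeta>_def distrib_right sum.distrib flip: scaleR_add_right)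
  finally show ?thesis by simp
qed

end

context slice_function
begin

text \<open>
  Near a sphere the function is represented by two circles (one, if the sphere is a point). This gives
  all local statements; it avoids the boundary curves of the theorem, whose derivatives may be unbounded.
\<close>

lemma local_representation:
  assumes x: "x \<in> G"
  obtains X \<Gamma> where "open X" "X \<subseteq> G" "\<And>y. slice_coord y = slice_coord x \<Longrightarrow> y \<in> X"
    "kernel_transform \<Gamma> dens X"
    "\<And>y. y \<in> X \<Longrightarrow> f y = kernel_transform.T \<Gamma> dens (kern I) y"
    "\<And>\<gamma>. \<gamma> \<in> \<Gamma> \<Longrightarrow> valid_path \<gamma> \<and> pathfinish \<gamma> = pathstart \<gamma> \<and> path_image \<gamma> \<subseteq> slice_dom G"
    "\<And>w. w \<notin> slice_dom G \<Longrightarrow> (\<Sum>\<gamma>\<in>\<Gamma>. winding_number \<gamma> w) = 0"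
    "\<And>w. qf w x = 0 \<Longrightarrow> (\<Sum>\<gamma>\<in>\<Gamma>. winding_number \<gamma> w) = 1"
proof -
  define z where "z = slice_coord x"
  define W where "W = slice_dom G"
  have W: "open W" unfolding W_def by (rule open_slice_dom [OF open_G axial_G])
  have cW: "cnj w \<in> W \<longleftrightarrow> w \<in> W" for w unfolding W_def by (rule cnj_slice_dom [OF axial_G])
  have "z \<in> W" using x slice_coord_mem [OF axial_G] by (simp add: z_def W_def)
  then obtain e' where e': "e' > 0" "cball z e' \<subseteq> W" using W open_contains_cball by blast
  \<comment> \<open>Off the real axis, half of \<open>Im z\<close> as an upper bound for the radius
    keeps the discs around \<open>z\<close> and \<open>cnj z\<close> apart.\<close>
  define e where "e = (if Im z = 0 then e' else min e' (Im z / 2))"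
  have Imz: "Im z \<ge> 0" by (simp add: z_def slice_coord_def)
  have e0: "e > 0" using e'(1) Imz by (auto simp: e_def)
  have zW: "cball z e \<subseteq> W" using e'(2) by (auto simp: e_def)
  have cnj_cball: "w \<in> cball (cnj z) e \<longleftrightarrow> cnj w \<in> cball z e" for w
    by (metis complex_cnj_cnj complex_cnj_diff complex_mod_cnj dist_norm mem_cball)
  have zW': "cball (cnj z) e \<subseteq> W" using zW cnj_cball cW by blast
  have disj: "Im z = 0 \<or> cball z e \<inter> cball (cnj z) e = {}"
  proof (cases "Im z = 0")
    case False
    have "2 * Im z \<le> cmod (z - cnj z)" using abs_Im_le_cmod [of "z - cnj z"] by simp
    then have "2 * Im z \<le> dist z w + dist (cnj z) w" for w
      using dist_triangle2 [of z "cnj z" w] by (simp add: dist_norm)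
    moreover have "e < Im z" using False Imz by (auto simp: e_def)
    ultimately show ?thesis by (smt (verit) disjoint_iff mem_cball)
  qed simp
  define \<Gamma> where "\<Gamma> = {circlepath z e, circlepath (cnj z) e}"
  \<comment> \<open>A full preimage under the slice coordinate contains the whole sphere of each of
    its points; the axial form is later obtained by comparing points of one sphere.\<close>
  define X :: "'n point set" where "X = slice_coord -` ball z e"
  have im: "path_image \<gamma> \<subseteq> sphere z e \<union> sphere (cnj z) e" if "\<gamma> \<in> \<Gamma>" for \<gamma>
    using that e0 by (auto simp: \<Gamma>_def)
  have loops: "valid_path \<gamma> \<and> pathfinish \<gamma> = pathstart \<gamma> \<and> path_image \<gamma> \<subseteq> W" if "\<gamma> \<in> \<Gamma>" for \<gamma>
  proof -
    have "sphere z e \<union> sphere (cnj z) e \<subseteq> W" using zW zW' sphere_cball by blast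
    then show ?thesis using im [OF that] that by (auto simp: \<Gamma>_def)
  qed
  have openX: "open X"
    unfolding X_def by (intro open_vimage continuous_on_slice_coord) auto
  have XG: "X \<subseteq> G"
  proof
    fix y assume "y \<in> X"
    then have "slice_coord y \<in> W" using zW ball_subset_cball by (auto simp: X_def)
    then show "y \<in> G" using slice_coord_mem [OF axial_G] by (simp add: W_def)
  qed
  have qf0: "w \<in> ball z e \<union> ball (cnj z) e" if "qf w y = 0" "y \<in> X" for w y
  proof -
    have y: "slice_coord y \<in> ball z e" using that(2) by (simp add: X_def)
    have "dist (cnj z) (cnj (slice_coord y)) = dist z (slice_coord y)"
      by (metis complex_cnj_diff complex_mod_cnj dist_norm)
    with y have "cnj (slice_coord y) \<in> ball (cnj z) e" by simp
    with y that(1) show ?thesis by (auto simp: qf_slice_coord)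
  qed
  have no_im: "w \<notin> sphere z e \<union> sphere (cnj z) e" if "w \<in> ball z e \<union> ball (cnj z) e" for w
  proof (cases "Im z = 0")
    case True
    then have "cnj z = z" by (simp add: complex_eq_iff)
    with that show ?thesis by auto
  next
    case False
    with disj have "v \<in> cball z e \<Longrightarrow> v \<notin> cball (cnj z) e" for v by blast
    from this [of w] that show ?thesis by auto
  qed
  have wn: "(\<Sum>\<gamma>\<in>\<Gamma>. winding_number \<gamma> w) = 1" if "w \<in> ball z e \<union> ball (cnj z) e" for w
    unfolding \<Gamma>_def by (rule winding_number_two_circles(1) [OF e0 disj that])
  have wn0: "(\<Sum>\<gamma>\<in>\<Gamma>. winding_number \<gamma> w) = 0" if "w \<notin> W" for w
    unfolding \<Gamma>_def by (rule winding_number_two_circles(2) [OF e0 disj]) (use that zW zW' in blast)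
  have kt: "kernel_transform \<Gamma> dens X"
  proof
    show "finite \<Gamma>" by (simp add: \<Gamma>_def)
    show "continuous_on {0..1} \<gamma>" if "\<gamma> \<in> \<Gamma>" for \<gamma>
      using loops [OF that] valid_path_imp_path by (auto simp: path_def)
    show "continuous_on {0..1} (dens \<gamma>)" if \<gamma>: "\<gamma> \<in> \<Gamma>" for \<gamma>
    proof -
      obtain a where a: "\<gamma> = circlepath a e" using \<gamma> by (auto simp: \<Gamma>_def)
      have "continuous_on {0..1} (\<lambda>t. vector_derivative \<gamma> (at t within {0..1}))"
      proof (rule continuous_on_eq)
        show "continuous_on {0..1} (\<lambda>t. 2 * pi * \<i> * e * exp (2 * of_real pi * \<i> * of_real t))"
          by (intro continuous_intros)
        show "2 * pi * \<i> * e * exp (2 * of_real pi * \<i> * of_real t) = vector_derivative \<gamma> (at t within {0..1})"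
          if "t \<in> {0..1}" for t
          unfolding a using that by (intro vector_derivative_circlepath01 [symmetric]) auto
      qed
      then have 1: "continuous_on {0..1} (\<lambda>t. cl_complex I (vector_derivative \<gamma> (at t within {0..1})) * (- paravector (0, I)))"
        by (intro cl_mult.continuous_on continuous_on_const bounded_linear.continuous_on [OF bounded_linear_cl_complex])
      have "continuous_on {0..1} (\<lambda>t. F E (\<gamma> t))" for E
        using loops [OF \<gamma>] valid_path_imp_path [of \<gamma>]
        by (intro continuous_on_compose2 [OF holomorphic_on_imp_continuous_on [OF hol_F]])
           (auto simp: path_def path_image_def W_def)
      then have "continuous_on {0..1} (\<lambda>t. \<Sum>E\<in>Basis. cl_complex I (F E (\<gamma> t)) * E)"
        by (intro continuous_on_sum cl_mult.continuous_on continuous_on_const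
            bounded_linear.continuous_on [OF bounded_linear_cl_complex])
      then have 2: "continuous_on {0..1} (\<lambda>t. f (slice_point I (\<gamma> t)))"
      proof (rule continuous_on_eq)
        fix t :: real assume "t \<in> {0..1}"
        then have "\<gamma> t \<in> path_image \<gamma>" by (simp add: path_image_def)
        then have "\<gamma> t \<in> slice_dom G" using loops [OF \<gamma>] by (auto simp: W_def)
        then show "(\<Sum>E\<in>Basis. cl_complex I (F E (\<gamma> t)) * E) = f (slice_point I (\<gamma> t))"
          by (rule f_slice [symmetric])
      qed
      show ?thesis
        using continuous_on_scaleR [OF continuous_on_const cl_mult.continuous_on [OF 1 2]]
        by (simp add: dens_def [abs_def] ds_slice_def paravector_slice_point)
    qed
    show "open X" by (rule openX)
    show "qf (\<gamma> t) y \<noteq> 0" if "\<gamma> \<in> \<Gamma>" "t \<in> {0..1}" "y \<in> X" for \<gamma> t y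
      using qf0 [OF _ that(3)] no_im im [OF that(1)] that(2) by (fastforce simp: path_image_def)
  qed
  have fy: "f y = kernel_transform.T \<Gamma> dens (kern I) y" if y: "y \<in> X" for y
    unfolding kernel_transform.T_def [OF kt]
  proof (rule Cauchy_representation)
    show "(\<Sum>\<gamma>\<in>\<Gamma>. winding_number \<gamma> w) = 1 \<and> w \<notin> (\<Union>\<gamma>\<in>\<Gamma>. path_image \<gamma>)" if "qf w y = 0" for w
      using wn [OF qf0 [OF that y]] no_im [OF qf0 [OF that y]] im by blast
  qed (use loops wn0 XG y in \<open>auto simp: W_def \<Gamma>_def\<close>)
  have xX: "y \<in> X" if "slice_coord y = slice_coord x" for y
    using that e0 by (simp add: X_def z_def)
  show ?thesis
    by (rule that [OF openX XG xX kt fy])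
       (use loops wn0 wn [OF qf0 [OF _ xX [OF refl]]] in \<open>auto simp: W_def\<close>)
qed

section \<open>Transfer from the kernel to the function\<close>

text \<open>The third claim, that both orders of composition agree on f, is inherited from the
  kernel. It serves the right-sided theory, where D acts before the Laplacians.\<close>

lemma DLap_T:
  assumes kt: "kernel_transform \<Gamma> dens X" and fT: "\<And>y. y \<in> X \<Longrightarrow> f y = kernel_transform.T \<Gamma> dens (kern I) y"
    and "x \<in> X"
  shows "DLap_left \<beta> m f x = kernel_transform.T \<Gamma> dens (\<lambda>w. DLap_left \<beta> m (kern I w)) x"
    and "ker_fam I (\<lambda>w. DLap_left \<beta> m (kern I w))"
    and "(Laplacian ^^ m) ((Dirac_left ^^ \<beta>) f) x = DLap_left \<beta> m f x"
proof -
  interpret kernel_transform I \<Gamma> dens X by (rule kt)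
  have k: "ker_fam I (kern I)" by (rule axial_fam_imp_ker_fam [OF axial_fam_kern [OF I]])
  have L: "ker_fam I (\<lambda>w. (Laplacian ^^ m) (kern I w))"
    by (rule Laplacian_funpow_T(2) [OF k fT assms(3)])
  have LT: "(Laplacian ^^ m) f y = T (\<lambda>w. (Laplacian ^^ m) (kern I w)) y" if "y \<in> X" for y
    by (rule Laplacian_funpow_T(1) [OF k fT that])
  have D: "ker_fam I (\<lambda>w. (Dirac_left ^^ \<beta>) (kern I w))"
    unfolding Dirac_left_eq by (rule cl_op_funpow_T(2) [OF k fT assms(3)])
  have DT: "(Dirac_left ^^ \<beta>) f y = T (\<lambda>w. (Dirac_left ^^ \<beta>) (kern I w)) y" if "y \<in> X" for y
    unfolding Dirac_left_eq by (rule cl_op_funpow_T(1) [OF k fT that])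
  show 1: "DLap_left \<beta> m f x = T (\<lambda>w. DLap_left \<beta> m (kern I w)) x"
    unfolding DLap_left_def Dirac_left_eq by (rule cl_op_funpow_T(1) [OF L LT assms(3)])
  show "ker_fam I (\<lambda>w. DLap_left \<beta> m (kern I w))"
    unfolding DLap_left_def Dirac_left_eq by (rule cl_op_funpow_T(2) [OF L LT assms(3)])
  have "(Laplacian ^^ m) ((Dirac_left ^^ \<beta>) f) x = T (\<lambda>w. (Laplacian ^^ m) ((Dirac_left ^^ \<beta>) (kern I w))) x"
    by (rule Laplacian_funpow_T(1) [OF D DT assms(3)])
  also have "\<dots> = T (\<lambda>w. DLap_left \<beta> m (kern I w)) x"
    by (rule T_cong [OF _ assms(3)]) (simp add: DLap_left_def Dirac_left_eq cl_op_funpow_Laplacian [OF k])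
  finally show "(Laplacian ^^ m) ((Dirac_left ^^ \<beta>) f) x = DLap_left \<beta> m f x"
    using 1 by simp
qed

lemma Laplacian_Dirac_funpow_commute:
  assumes "x \<in> G"
  shows "(Laplacian ^^ m) ((Dirac_left ^^ \<beta>) f) x = DLap_left \<beta> m f x"
proof -
  obtain X \<Gamma> where "\<And>y. slice_coord y = slice_coord x \<Longrightarrow> y \<in> X" "kernel_transform \<Gamma> dens X"
    "\<And>y. y \<in> X \<Longrightarrow> f y = kernel_transform.T \<Gamma> dens (kern I) y"
    using local_representation [OF assms] by metis
  note X = this
  show ?thesis by (rule DLap_T(3) [OF X(2,3) X(1) [OF refl]])
qed

lemma C_diff_on_DLap: "C_diff_on N (DLap_left \<beta> m f) G"
proof (rule C_diff_on_local)
  fix x assume "x \<in> G"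
  obtain X \<Gamma> where X0: "open X" "\<And>y. slice_coord y = slice_coord x \<Longrightarrow> y \<in> X" and X34: "kernel_transform \<Gamma> dens X"
    "\<And>y. y \<in> X \<Longrightarrow> f y = kernel_transform.T \<Gamma> dens (kern I) y"
    using local_representation [OF \<open>x \<in> G\<close>] by metis
  note X = X0(1) X0(2) [OF refl] X34
  have "C_diff_on N (kernel_transform.T \<Gamma> dens (\<lambda>w. DLap_left \<beta> m (kern I w))) X"
    by (rule kernel_transform.C_diff_on_T [OF X(3) DLap_T(2) [OF X(3,4,2)]])
  then have "C_diff_on N (DLap_left \<beta> m f) X"
    using C_diff_on_cong [OF X(1), of "DLap_left \<beta> m f" "kernel_transform.T \<Gamma> dens (\<lambda>w. DLap_left \<beta> m (kern I w))" N]
      DLap_T(1) [OF X(3,4)] by blast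
  with X show "\<exists>X. open X \<and> x \<in> X \<and> C_diff_on N (DLap_left \<beta> m f) X" by blast
qed

lemma anti_analytic_harmonic_DLap:
  assumes "x \<in> G" "CARD('n) = 2 * h + 1" "1 \<le> h" "p + m + b = h"
  shows "(Dirac_conj_left ^^ b) ((Laplacian ^^ p) (DLap_left (Suc b) m f)) x = 0"
proof -
  obtain X \<Gamma> where X0: "\<And>y. slice_coord y = slice_coord x \<Longrightarrow> y \<in> X"
    and X23: "kernel_transform \<Gamma> dens X" "\<And>y. y \<in> X \<Longrightarrow> f y = kernel_transform.T \<Gamma> dens (kern I) y"
    using local_representation [OF assms(1)] by metis
  note X = X0 [OF refl] X23
  interpret kernel_transform I \<Gamma> dens X by (rule X(2))
  define K where "K w = DLap_left (Suc b) m (kern I w)" for w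
  have K: "ker_fam I K" "DLap_left (Suc b) m f y = T K y" if "y \<in> X" for y
    using DLap_T(1,2) [OF X(2,3) that] that by (simp_all add: K_def [abs_def])
  have "(Dirac_conj_left ^^ b) ((Laplacian ^^ p) (DLap_left (Suc b) m f)) x =
      T (\<lambda>w. (Dirac_conj_left ^^ b) ((Laplacian ^^ p) (K w))) x"
    unfolding Dirac_conj_left_eq
    by (rule cl_op_funpow_T(1) [OF Laplacian_funpow_T(2) [OF K(1) K(2)] Laplacian_funpow_T(1) [OF K(1) K(2)]])
       (rule X(1) | assumption)+
  also have "\<dots> = T (\<lambda>w x. 0) x"
    by (rule T_cong [OF _ X(1)]) (use anti_analytic_harmonic_kern [OF I _ assms(2-4)] in \<open>simp add: K_def\<close>)
  finally show ?thesis by (simp add: T_zero)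
qed

text \<open>The three points lie on one sphere, so the same circles represent f at all of them, and
  the formula for the kernel can be integrated.\<close>

lemma DLap_representation:
  assumes "1 \<le> \<beta>" and J: "norm J = 1" and \<omega>: "norm \<omega> = 1" and "(u, r *\<^sub>R \<omega>) \<in> G"
  shows "DLap_left \<beta> m f (u, r *\<^sub>R \<omega>) =
    ((1 / 2) *\<^sub>R (1 - paravector (0, \<omega>) * paravector (0, J))) * DLap_left \<beta> m f (u, r *\<^sub>R J) +
    ((1 / 2) *\<^sub>R (1 + paravector (0, \<omega>) * paravector (0, J))) * DLap_left \<beta> m f (u, (- r) *\<^sub>R J)"
proof -
  obtain X \<Gamma> where X: "\<And>y. slice_coord y = slice_coord (u, r *\<^sub>R \<omega>) \<Longrightarrow> y \<in> X" "kernel_transform \<Gamma> dens X"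
    "\<And>y. y \<in> X \<Longrightarrow> f y = kernel_transform.T \<Gamma> dens (kern I) y"
    using local_representation [OF assms(4)] by metis
  interpret kernel_transform I \<Gamma> dens X by (rule X(2))
  define K where "K w = DLap_left \<beta> m (kern I w)" for w
  have mem: "(u, r *\<^sub>R \<omega>) \<in> X" "(u, r *\<^sub>R J) \<in> X" "(u, (- r) *\<^sub>R J) \<in> X"
    by (rule X(1); use J \<omega> in \<open>simp add: slice_coord_def\<close>)+
  have K: "ker_fam I K" using DLap_T(2) [OF X(2,3) mem(1)] by (simp add: K_def [abs_def])
  have DK: "DLap_left \<beta> m f y = T K y" if "y \<in> X" for y
    using DLap_T(1) [OF X(2,3) that] by (simp add: K_def [abs_def])
  have aK: "axial_fam I K" unfolding K_def [abs_def] by (rule axial_fam_DLap_kern [OF I assms(1)])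
  define a where "a = (1 / 2) *\<^sub>R (1 - paravector (0, \<omega>) * paravector (0, J))"
  define a' where "a' = (1 / 2) *\<^sub>R (1 + paravector (0, \<omega>) * paravector (0, J))"
  have "integral {0..1} (\<lambda>t. K (\<gamma> t) (u, r *\<^sub>R \<omega>) * dens \<gamma> t) =
      a * integral {0..1} (\<lambda>t. K (\<gamma> t) (u, r *\<^sub>R J) * dens \<gamma> t) +
      a' * integral {0..1} (\<lambda>t. K (\<gamma> t) (u, (- r) *\<^sub>R J) * dens \<gamma> t)" if \<gamma>: "\<gamma> \<in> \<Gamma>" for \<gamma>
  proof (rule integral_unique)
    have hi: "((\<lambda>t. c * (K (\<gamma> t) y * dens \<gamma> t)) has_integral c * integral {0..1} (\<lambda>t. K (\<gamma> t) y * dens \<gamma> t)) {0..1}"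
      if "y \<in> X" for y c
      using has_integral_linear [OF integrable_integral [OF integrable_integrand [OF K \<gamma> that]]
          cl_mult.bounded_linear_right [of c]] by (simp add: comp_def)
    have "((\<lambda>t. a * (K (\<gamma> t) (u, r *\<^sub>R J) * dens \<gamma> t) + a' * (K (\<gamma> t) (u, (- r) *\<^sub>R J) * dens \<gamma> t)) has_integral
      (a * integral {0..1} (\<lambda>t. K (\<gamma> t) (u, r *\<^sub>R J) * dens \<gamma> t) +
      a' * integral {0..1} (\<lambda>t. K (\<gamma> t) (u, (- r) *\<^sub>R J) * dens \<gamma> t))) {0..1}"
      by (intro has_integral_add hi mem)
    then show "((\<lambda>t. K (\<gamma> t) (u, r *\<^sub>R \<omega>) * dens \<gamma> t) has_integral
      (a * integral {0..1} (\<lambda>t. K (\<gamma> t) (u, r *\<^sub>R J) * dens \<gamma> t) +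
      a' * integral {0..1} (\<lambda>t. K (\<gamma> t) (u, (- r) *\<^sub>R J) * dens \<gamma> t))) {0..1}"
    proof (rule has_integral_eq [rotated])
      fix t :: real assume "t \<in> {0..1}"
      then have "K (\<gamma> t) (u, r *\<^sub>R \<omega>) = a * K (\<gamma> t) (u, r *\<^sub>R J) + a' * K (\<gamma> t) (u, (- r) *\<^sub>R J)"
        unfolding a_def a'_def using qf_nonzero [OF \<gamma> _ mem(1)]
        by (intro axial_fam_representation [OF aK J \<omega>]) auto
      then show "a * (K (\<gamma> t) (u, r *\<^sub>R J) * dens \<gamma> t) + a' * (K (\<gamma> t) (u, (- r) *\<^sub>R J) * dens \<gamma> t) =
          K (\<gamma> t) (u, r *\<^sub>R \<omega>) * dens \<gamma> t"
        by (simp only: distrib_right mult.assoc)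
    qed
  qed
  then have "T K (u, r *\<^sub>R \<omega>) = a * T K (u, r *\<^sub>R J) + a' * T K (u, (- r) *\<^sub>R J)"
    by (simp add: T_def sum.distrib sum_distrib_left)
  then show ?thesis by (simp only: DK mem a_def a'_def)
qed

lemma axial_form_DLap:
  assumes "1 \<le> \<beta>" "U \<subseteq> G"
  shows "\<exists>A B. axial_form_left U (DLap_left \<beta> m f) A B"
proof -
  define g where "g = DLap_left \<beta> m f"
  \<comment> \<open>\<open>A\<close> and \<open>B\<close> are obtained from the representation
    formula with J = I, by collecting the terms without and with a left factor \<omega>.\<close>
  define A where "A p = (1 / 2) *\<^sub>R (g (fst p, snd p *\<^sub>R I) + g (fst p, (- snd p) *\<^sub>R I))" for p
  define B where "B p = - (1 / 2) *\<^sub>R (paravector (0, I) * (g (fst p, snd p *\<^sub>R I) - g (fst p, (- snd p) *\<^sub>R I)))" for p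
  have "even_odd_pair U A B"
    by (auto simp: even_odd_pair_def A_def B_def add.commute algebra_simps)
  moreover have "g x = A (fst x, norm (snd x)) + paravector (0, sgn (snd x)) * B (fst x, norm (snd x))" if "x \<in> U" for x
  proof (cases "snd x = 0")
    case True
    have "(1 / 2) *\<^sub>R (g x + g x) = g x" by (simp flip: scaleR_2)
    moreover have "(fst x, 0) = x" using True by (simp add: prod_eq_iff)
    moreover have "paravector (0, 0 :: (real, 'n) vec) = 0"
      using paravector_zero [where 'a = 'n] by (simp add: zero_prod_def)
    ultimately show ?thesis using True by (simp add: A_def)
  next
    case False
    have x: "x = (fst x, norm (snd x) *\<^sub>R sgn (snd x))"
      using False by (simp add: prod_eq_iff sgn_div_norm)
    have "g (fst x, norm (snd x) *\<^sub>R sgn (snd x)) =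
      ((1 / 2) *\<^sub>R (1 - paravector (0, sgn (snd x)) * paravector (0, I))) * g (fst x, norm (snd x) *\<^sub>R I) +
      ((1 / 2) *\<^sub>R (1 + paravector (0, sgn (snd x)) * paravector (0, I))) * g (fst x, (- norm (snd x)) *\<^sub>R I)"
      unfolding g_def
      by (rule DLap_representation [OF assms(1) I]) (use False that assms(2) x in \<open>auto simp: norm_sgn\<close>)
    then have "g x =
      ((1 / 2) *\<^sub>R (1 - paravector (0, sgn (snd x)) * paravector (0, I))) * g (fst x, norm (snd x) *\<^sub>R I) +
      ((1 / 2) *\<^sub>R (1 + paravector (0, sgn (snd x)) * paravector (0, I))) * g (fst x, (- norm (snd x)) *\<^sub>R I)"
      using x by metis
    then show ?thesis
      by (simp add: A_def B_def algebra_simps)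
  qed
  ultimately show ?thesis unfolding axial_form_left_def g_def by blast
qed

text \<open>The local circles and the boundary curves are homologous in the slice of
  \<open>G\<close> without the zeros of \<open>qf\<close>: both have winding number 1 about the
  zeros and 0 about points outside the slice of \<open>G\<close>.\<close>

lemma slice_integral_DLap:
  assumes \<beta>: "1 \<le> \<beta>" and U: "open U" "axially_symmetric U" "closure U \<subseteq> G"
    and \<Gamma>: "oriented_boundary (slice_of I U) \<Gamma>" and x: "x \<in> U"
  shows "slice_integrable I \<Gamma> (\<lambda>s. DLap_kernel_left \<beta> m s x) f"
    and "DLap_left \<beta> m f x = (1 / (2 * pi)) *\<^sub>R slice_integral I \<Gamma> (\<lambda>s. DLap_kernel_left \<beta> m s x) f"
proof -
  have xG: "x \<in> G" using x U(3) closure_subset by blast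
  obtain X \<Gamma>0 where X: "\<And>y. slice_coord y = slice_coord x \<Longrightarrow> y \<in> X"
    "kernel_transform \<Gamma>0 dens X"
    "\<And>y. y \<in> X \<Longrightarrow> f y = kernel_transform.T \<Gamma>0 dens (kern I) y"
    "\<And>\<gamma>. \<gamma> \<in> \<Gamma>0 \<Longrightarrow> valid_path \<gamma> \<and> pathfinish \<gamma> = pathstart \<gamma> \<and> path_image \<gamma> \<subseteq> slice_dom G"
    "\<And>w. w \<notin> slice_dom G \<Longrightarrow> (\<Sum>\<gamma>\<in>\<Gamma>0. winding_number \<gamma> w) = 0"
    "\<And>w. qf w x = 0 \<Longrightarrow> (\<Sum>\<gamma>\<in>\<Gamma>0. winding_number \<gamma> w) = 1"
    using local_representation [OF xG] by metis
  interpret kernel_transform I \<Gamma>0 dens X by (rule X(2))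
  have xX: "x \<in> X" by (rule X(1)) simp
  define K where "K w = DLap_left \<beta> m (kern I w)" for w
  define d where "d \<gamma> t = K (\<gamma> t) x * (ds_slice I \<gamma> t * f (slice_point I (\<gamma> t)))" for \<gamma> t
  have aK: "axial_fam I K" unfolding K_def [abs_def] by (rule axial_fam_DLap_kern [OF I \<beta>])
  have sU: "slice_of I U = slice_dom U" by (rule slice_of_eq [OF U(2) I])
  have clos: "closure (slice_of I U) \<subseteq> slice_dom G"
  proof -
    have "continuous_on (closure (slice_of I U)) (slice_point I)"
      unfolding slice_point_def by (intro continuous_intros)
    then have "slice_point I ` closure (slice_of I U) \<subseteq> closure U"
      by (rule image_closure_subset) (auto simp: slice_of_def intro: subsetD [OF closure_subset])
    then show ?thesis
      using U(3) slice_of_eq [OF axial_G I] by (auto simp: slice_of_def)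
  qed
  have root: "w \<in> slice_of I U" if "qf w x = 0" for w
    using that slice_coord_mem [OF U(2), of x] cnj_slice_dom [OF U(2)] x unfolding sU by (auto simp: qf_slice_coord)
  \<comment> \<open>An open set is disjoint from its frontier; therefore the boundary curves miss
    the zeros of \<open>qf\<close>, which lie inside.\<close>
  have "open (slice_of I U)" unfolding sU by (rule open_slice_dom [OF U(1,2)])
  then have fr: "frontier (slice_of I U) = closure (slice_of I U) - slice_of I U"
    by (simp add: frontier_def interior_open)
  have \<Gamma>im: "path_image \<gamma> \<subseteq> slice_dom G \<inter> {w. qf w x \<noteq> 0}" if "\<gamma> \<in> \<Gamma>" for \<gamma>
    using \<Gamma> that clos root unfolding oriented_boundary_def fr by blast
  have fin: "finite \<Gamma>" "finite \<Gamma>0"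
    using \<Gamma> finite_\<Gamma> by (auto simp: oriented_boundary_def jordan_curves_def)
  have loops: "valid_path \<gamma> \<and> pathfinish \<gamma> = pathstart \<gamma> \<and> path_image \<gamma> \<subseteq> slice_dom G \<inter> {w. qf w x \<noteq> 0}"
    if "\<gamma> \<in> \<Gamma> \<union> \<Gamma>0" for \<gamma>
  proof (cases "\<gamma> \<in> \<Gamma>")
    case True
    then show ?thesis using \<Gamma> \<Gamma>im [OF True] by (auto simp: oriented_boundary_def jordan_curves_def)
  next
    case False
    then have "\<gamma> \<in> \<Gamma>0" using that by blast
    then show ?thesis using X(4) qf_nonzero [OF _ _ xX] by (fastforce simp: path_image_def)
  qed
  have wn: "(\<Sum>\<gamma>\<in>\<Gamma>. winding_number \<gamma> w) = (\<Sum>\<gamma>\<in>\<Gamma>0. winding_number \<gamma> w)" if "w \<notin> slice_dom G \<or> qf w x = 0" for w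
  proof (cases "qf w x = 0")
    case True
    then show ?thesis using root [OF True] \<Gamma> X(6) by (simp add: oriented_boundary_def)
  next
    case False
    then have "w \<notin> slice_dom G" using that by blast
    moreover from this have "w \<notin> closure (slice_of I U)" using clos by blast
    ultimately show ?thesis using \<Gamma> X(5) by (simp add: oriented_boundary_def)
  qed
  have W: "open (slice_dom G)" by (rule open_slice_dom [OF open_G axial_G])
  note indep = axial_fam_cycle_independent [OF aK I W hol_F f_slice fin loops wn, folded d_def]
  have integrand: "slice_integrand I (\<lambda>s. DLap_kernel_left \<beta> m s x) f \<gamma> = d \<gamma>" for \<gamma>
    by (simp add: fun_eq_iff slice_integrand_def DLap_kernel_left_def d_def K_def kern_def mult.assoc)
  show "slice_integrable I \<Gamma> (\<lambda>s. DLap_kernel_left \<beta> m s x) f"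
    using indep(1) by (simp add: slice_integrable_def integrand d_def [abs_def])
  have "DLap_left \<beta> m f x = T K x"
    using DLap_T(1) [OF X(2,3) xX] by (simp add: K_def [abs_def])
  also have "\<dots> = (1 / (2 * pi)) *\<^sub>R (\<Sum>\<gamma>\<in>\<Gamma>0. integral {0..1} (d \<gamma>))"
    by (simp add: T_def dens_def d_def [abs_def] scaleR_sum_right)
  also have "(\<Sum>\<gamma>\<in>\<Gamma>0. integral {0..1} (d \<gamma>)) = (\<Sum>\<gamma>\<in>\<Gamma>. integral {0..1} (d \<gamma>))"
    using indep(2) by (simp add: d_def [abs_def])
  finally show "DLap_left \<beta> m f x = (1 / (2 * pi)) *\<^sub>R slice_integral I \<Gamma> (\<lambda>s. DLap_kernel_left \<beta> m s x) f"
    by (simp add: slice_integral_def integrand)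
qed

end

section \<open>Reversion\<close>

text \<open>The sign of the permutation that reverses the factors of \<open>e_A\<close>, that is, \<open>(-1) ^ (card A choose 2)\<close>.\<close>

definition rev_sign :: "('n::{finite,linorder}) set \<Rightarrow> real"
  where "rev_sign A = cl_sign A A * (-1) ^ card A"

lemma cl_sign_square: "cl_sign A B * cl_sign A B = 1"
  by (simp add: cl_sign_def flip: power_add mult_2)

lemma rev_sign_square: "rev_sign A * rev_sign A = 1"
proof -
  have "rev_sign A * rev_sign A = (cl_sign A A * cl_sign A A) * ((-1) ^ card A * (-1) ^ card A)"
    by (simp only: rev_sign_def mult_ac)
  then show ?thesis by (simp add: cl_sign_square flip: power_add mult_2)
qed

lemma rev_sign_empty: "rev_sign {} = 1"
  by (simp add: rev_sign_def)

lemma rev_sign_singleton: "rev_sign {i} = 1"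
  by (simp add: rev_sign_def cl_sign_prod)

text \<open>In terms of signs, this says that reversing the product of two basis elements gives the
  product of the reversed elements in the opposite order.\<close>

lemma rev_sign_sym_diff: "rev_sign (sym_diff A B) * cl_sign A B = rev_sign A * rev_sign B * cl_sign B A"
proof -
  have "(- 1 :: real) ^ card (sym_diff A B) = (- 1) ^ card A * (- 1) ^ card B"
    using prod_sym_diff [of A B "\<lambda>_. - 1"] by simp
  then have "rev_sign (sym_diff A B) * cl_sign A B =
      (cl_sign A A * cl_sign B A * (cl_sign A B * cl_sign B B)) * ((- 1) ^ card A * (- 1) ^ card B) * cl_sign A B"
    by (simp only: rev_sign_def cl_sign_sym_diff_left cl_sign_sym_diff_right)
  also have "\<dots> = rev_sign A * rev_sign B * cl_sign B A * (cl_sign A B * cl_sign A B)"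
    by (simp only: rev_sign_def mult_ac)
  finally show ?thesis by (simp add: cl_sign_square)
qed

text \<open>An anti-automorphism fixing the paravectors, which therefore exchanges the left and the right theory.\<close>

lift_definition cl_rev :: "('n::{finite,linorder}) clifford \<Rightarrow> 'n clifford"
  is "\<lambda>a. \<chi> A. rev_sign A * a $ A" .

lemma cl_rev_add: "cl_rev (a + b) = cl_rev a + cl_rev b"
  by transfer (simp add: vec_eq_iff distrib_left)

lemma cl_rev_scaleR: "cl_rev (r *\<^sub>R a) = r *\<^sub>R cl_rev a"
  by transfer (simp add: vec_eq_iff)

lemma cl_rev_rev [simp]: "cl_rev (cl_rev a) = a"
  by transfer (simp add: vec_eq_iff rev_sign_square flip: mult.assoc)

lemma linear_cl_rev: "linear cl_rev"
  by (rule linearI) (simp_all add: cl_rev_add cl_rev_scaleR)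

lemma bounded_linear_cl_rev: "bounded_linear cl_rev"
  by (rule linear_conv_bounded_linear [THEN iffD1, OF linear_cl_rev])

lemmas cl_rev_diff = linear_diff [OF linear_cl_rev]
  and cl_rev_minus = linear_neg [OF linear_cl_rev]
  and cl_rev_sum = linear_sum [OF linear_cl_rev]
  and cl_rev_0 = linear_0 [OF linear_cl_rev]

lemma cl_rev_mult: "cl_rev (a * b) = cl_rev b * cl_rev a"
proof (transfer, simp only: vec_eq_iff vec_lambda_beta, rule allI)
  fix a b :: "(real, 'a set) vec" and C :: "'a set"
  let ?d = "\<lambda>A B :: 'a set. sym_diff A B"
  \<comment> \<open>Replacing the summation index by its symmetric difference with \<open>C\<close>
    exchanges the roles of the two factors.\<close>
  have "(\<Sum>B\<in>UNIV. cl_sign B (?d B C) * (rev_sign B * b $ B) * (rev_sign (?d B C) * a $ ?d B C)) =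
      (\<Sum>A\<in>UNIV. cl_sign (?d C A) (?d (?d C A) C) * (rev_sign (?d C A) * b $ ?d C A) *
        (rev_sign (?d (?d C A) C) * a $ ?d (?d C A) C))"
    by (rule sum.reindex_bij_betw [OF bij_sym_diff, symmetric])
  also have "\<dots> = (\<Sum>A\<in>UNIV. rev_sign C * (cl_sign A (?d A C) * a $ A * b $ ?d A C))"
  proof (intro sum.cong refl)
    fix A
    have eq: "?d (?d A C) C = A" "?d C A = ?d A C" by auto
    have "rev_sign C * cl_sign A (?d A C) = rev_sign A * rev_sign (?d A C) * cl_sign (?d A C) A"
      using rev_sign_sym_diff [of A "?d A C"] by (simp only: sym_diff_cancel)
    then have "rev_sign C * cl_sign A (?d A C) * (a $ A * b $ ?d A C) =
        rev_sign A * rev_sign (?d A C) * cl_sign (?d A C) A * (a $ A * b $ ?d A C)"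
      by (simp only:)
    then show "cl_sign (?d C A) (?d (?d C A) C) * (rev_sign (?d C A) * b $ ?d C A) *
        (rev_sign (?d (?d C A) C) * a $ ?d (?d C A) C) = rev_sign C * (cl_sign A (?d A C) * a $ A * b $ ?d A C)"
      unfolding eq by (simp only: mult_ac)
  qed
  finally show "rev_sign C * (\<Sum>A\<in>UNIV. cl_sign A (?d A C) * a $ A * b $ ?d A C) =
      (\<Sum>B\<in>UNIV. cl_sign B (?d B C) * (rev_sign B * b $ B) * (rev_sign (?d B C) * a $ ?d B C))"
    by (simp only: sum_distrib_left)
qed

lemma cl_rev_basis: "cl_rev (cl_basis A) = rev_sign A *\<^sub>R cl_basis A"
  by transfer (auto simp: vec_eq_iff axis_def)

lemma cl_rev_1: "cl_rev 1 = 1"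
  using cl_rev_basis [of "{}"] by (simp add: cl_basis_empty rev_sign_empty)

lemma cl_rev_of_real: "cl_rev (of_real r) = of_real r"
  by (simp add: of_real_def cl_rev_scaleR cl_rev_1)

lemma cl_rev_e: "cl_rev (cl_e i) = cl_e i"
  by (simp add: cl_e_def cl_rev_basis rev_sign_singleton)

lemma cl_rev_paravector: "cl_rev (paravector x) = paravector x"
  by (simp add: paravector_def cl_rev_add cl_rev_of_real cl_rev_sum cl_rev_scaleR cl_rev_e)

lemma cl_rev_cl_complex: "cl_rev (cl_complex I z) = cl_complex I z"
  by (simp flip: paravector_slice_point add: cl_rev_paravector)

section \<open>Smooth functions and operators intertwined by reversion\<close>

text \<open>Reversion passes through \<open>partial_deriv\<close> where a derivative exists. For
  iterated operators this has to be known at every stage, hence a notion closed under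
  differentiation.\<close>

definition smooth_on :: "'a::euclidean_space set \<Rightarrow> ('a \<Rightarrow> 'b::real_normed_vector) \<Rightarrow> bool"
  where "smooth_on X f \<longleftrightarrow> (\<forall>N. C_diff_on N f X)"

lemma smooth_on_has_pd: "smooth_on X f \<Longrightarrow> x \<in> X \<Longrightarrow> b \<in> Basis \<Longrightarrow> has_pd f b (partial_deriv b f x) x"
  unfolding smooth_on_def has_pd_def partial_deriv_def
  by (drule spec [of _ "Suc 0"]) (simp flip: vector_derivative_works)

lemma smooth_on_pd: "smooth_on X f \<Longrightarrow> b \<in> Basis \<Longrightarrow> smooth_on X (partial_deriv b f)"
  unfolding smooth_on_def
proof
  fix N
  assume "\<forall>N. C_diff_on N f X" "b \<in> Basis"
  from spec [OF this(1), of "Suc N"] this(2) show "C_diff_on N (partial_deriv b f) X" by simp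
qed

lemma smooth_on_cong:
  assumes "open X" "\<And>x. x \<in> X \<Longrightarrow> f x = g x"
  shows "smooth_on X f \<longleftrightarrow> smooth_on X g"
proof -
  have "C_diff_on N f X \<longleftrightarrow> C_diff_on N g X" for N
    by (rule C_diff_on_cong [OF assms])
  then show ?thesis by (simp add: smooth_on_def)
qed

text \<open>Coinduction for smoothness: \<open>P\<close> is a property of continuous functions whose
  partial derivatives agree on \<open>X\<close> with functions having \<open>P\<close>. The
  induction on the order is thereby done once.\<close>

lemma smooth_on_coinduct:
  assumes "open X" and "P f"
    and cont: "\<And>f. P f \<Longrightarrow> continuous_on X f"
    and pd: "\<And>f b. P f \<Longrightarrow> b \<in> Basis \<Longrightarrow> \<exists>g. P g \<and> (\<forall>x\<in>X. has_pd f b (g x) x)"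
  shows "smooth_on X f"
proof -
  have "C_diff_on N f X" if "P f" for N f
    using that
  proof (induction N arbitrary: f)
    case (Suc N)
    have "(\<forall>x\<in>X. (\<lambda>t. f (x + t *\<^sub>R b)) differentiable at 0) \<and> C_diff_on N (partial_deriv b f) X"
      if "b \<in> Basis" for b
    proof -
      from pd [OF Suc.prems that] obtain g where g: "P g" "\<And>x. x \<in> X \<Longrightarrow> has_pd f b (g x) x" by blast
      have "C_diff_on N (partial_deriv b f) X \<longleftrightarrow> C_diff_on N g X"
        by (rule C_diff_on_cong [OF assms(1)]) (rule has_pd_partial_deriv [OF g(2)])
      with Suc.IH [OF g(1)] g(2) show ?thesis using differentiable_iff_has_pd by blast
    qed
    with cont [OF Suc.prems] show ?case by simp
  qed (simp add: cont)
  with assms(2) show ?thesis by (simp add: smooth_on_def)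
qed

lemma smooth_on_continuous: "smooth_on X f \<Longrightarrow> continuous_on X f"
  unfolding smooth_on_def by (drule spec [of _ 0]) simp

lemma smooth_on_bounded_linear:
  fixes X :: "'a::euclidean_space set"
  assumes "open X" "bounded_linear L" "smooth_on X f"
  shows "smooth_on X (\<lambda>x. L (f x))"
proof (rule smooth_on_coinduct [OF assms(1), of "\<lambda>g. \<exists>f. smooth_on X f \<and> g = (\<lambda>x. L (f x))"])
  fix g b assume "\<exists>f. smooth_on X f \<and> g = (\<lambda>x. L (f x))" and b: "b \<in> (Basis :: 'a set)"
  then obtain f where f: "smooth_on X f" "g = (\<lambda>x. L (f x))" by blast
  show "\<exists>h. (\<exists>f. smooth_on X f \<and> h = (\<lambda>x. L (f x))) \<and> (\<forall>x\<in>X. has_pd g b (h x) x)"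
    unfolding f(2) using smooth_on_pd [OF f(1) b] has_pd_bounded_linear [OF assms(2) smooth_on_has_pd [OF f(1) _ b]]
    by blast
next
  fix g assume "\<exists>f. smooth_on X f \<and> g = (\<lambda>x. L (f x))"
  then show "continuous_on X g"
    using bounded_linear.continuous_on [OF assms(2)] smooth_on_continuous by blast
qed (use assms(3) in blast)

lemma smooth_on_sum:
  fixes X :: "'a::euclidean_space set" and f :: "'i \<Rightarrow> 'a \<Rightarrow> 'b::real_normed_vector"
  assumes "open X" "\<And>i. i \<in> A \<Longrightarrow> smooth_on X (f i)"
  shows "smooth_on X (\<lambda>x. \<Sum>i\<in>A. f i x)"
proof (rule smooth_on_coinduct [OF assms(1), of "\<lambda>g. \<exists>f. (\<forall>i\<in>A. smooth_on X (f i)) \<and> g = (\<lambda>x. \<Sum>i\<in>A. f i x)"])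
  fix g b assume "\<exists>f. (\<forall>i\<in>A. smooth_on X (f i)) \<and> g = (\<lambda>x. \<Sum>i\<in>A. f i x)" and b: "b \<in> (Basis :: 'a set)"
  then obtain f where f: "\<And>i. i \<in> A \<Longrightarrow> smooth_on X (f i)" "g = (\<lambda>x. \<Sum>i\<in>A. f i x)" by blast
  have "has_pd g b (\<Sum>i\<in>A. partial_deriv b (f i) x) x" if "x \<in> X" for x
    unfolding f(2) by (rule has_pd_sum) (rule smooth_on_has_pd [OF f(1) that b])
  then show "\<exists>h. (\<exists>f. (\<forall>i\<in>A. smooth_on X (f i)) \<and> h = (\<lambda>x. \<Sum>i\<in>A. f i x)) \<and> (\<forall>x\<in>X. has_pd g b (h x) x)"
    using smooth_on_pd [OF f(1) b]
    by (intro exI [of _ "\<lambda>x. \<Sum>i\<in>A. partial_deriv b (f i) x"] conjI exI [of _ "\<lambda>i. partial_deriv b (f i)"]) auto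
next
  fix g assume "\<exists>f. (\<forall>i\<in>A. smooth_on X (f i)) \<and> g = (\<lambda>x. \<Sum>i\<in>A. f i x)"
  then show "continuous_on X g"
    using smooth_on_continuous by (auto intro!: continuous_on_sum)
qed (use assms(2) in blast)

lemma smooth_on_cl_op: "open X \<Longrightarrow> smooth_on X f \<Longrightarrow> smooth_on X (cl_op C f)"
  unfolding cl_op_def [abs_def]
  by (intro smooth_on_sum smooth_on_bounded_linear [OF _ cl_mult.bounded_linear_right] smooth_on_pd)

lemma smooth_on_Laplacian: "open X \<Longrightarrow> smooth_on X f \<Longrightarrow> smooth_on X (Laplacian f)"
  unfolding Laplacian_def [abs_def] by (intro smooth_on_sum smooth_on_pd)

lemma smooth_on_ker_fam:
  assumes "ker_fam I k"
  shows "smooth_on {x. qf w x \<noteq> 0} (k w)"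
proof (rule smooth_on_coinduct [OF open_qf, of "\<lambda>g. \<exists>k. ker_fam I k \<and> g = k w"])
  fix g b assume "\<exists>k. ker_fam I k \<and> g = k w"
  then obtain k where k: "ker_fam I k" "g = k w" by blast
  show "\<exists>h. (\<exists>k. ker_fam I k \<and> h = k w) \<and> (\<forall>x\<in>{x. qf w x \<noteq> 0}. has_pd g b (h x) x)"
    unfolding k(2)
    by (intro exI [of _ "partial_deriv b (k w)"] conjI exI [of _ "\<lambda>w. partial_deriv b (k w)"])
       (use ker_fam_pd [OF k(1)] ker_fam_has_pd [OF k(1)] in auto)
next
  fix g assume "\<exists>k. ker_fam I k \<and> g = k w"
  then obtain k where k: "ker_fam I k" "g = k w" by blast
  have "continuous_on {x. qf w x \<noteq> 0} (\<lambda>x. (w, x))" by (intro continuous_intros)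
  moreover have "Pair w ` {x. qf w x \<noteq> 0} \<subseteq> {p. qf (fst p) (snd p) \<noteq> 0}" by auto
  ultimately have "continuous_on {x. qf w x \<noteq> 0} (\<lambda>x. k (fst (w, x)) (snd (w, x)))"
    by (rule continuous_on_compose2 [OF ker_fam_continuous [OF k(1)]])
  then show "continuous_on {x. qf w x \<noteq> 0} g" by (simp add: k(2))
qed (use assms in blast)

lemma partial_deriv_cl_rev:
  assumes "smooth_on X g" "x \<in> X" "b \<in> Basis"
  shows "partial_deriv b (\<lambda>x. cl_rev (g x)) x = cl_rev (partial_deriv b g x)"
  by (rule has_pd_partial_deriv [OF has_pd_bounded_linear [OF bounded_linear_cl_rev smooth_on_has_pd [OF assms]]])

text \<open>\<open>L\<close> is the left operator and \<open>R\<close> its right counterpart.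
  Locality of \<open>R\<close> and preservation of smoothness by \<open>L\<close> are included
  because they make the relation survive iteration.\<close>

definition rev_ops ::
    "'n point set \<Rightarrow> ('n cl_fun \<Rightarrow> 'n cl_fun) \<Rightarrow> (('n::{finite,linorder}) cl_fun \<Rightarrow> 'n cl_fun) \<Rightarrow> bool"
  where "rev_ops X L R \<longleftrightarrow> local_op R \<and> (\<forall>g. smooth_on X g \<longrightarrow> smooth_on X (L g) \<and>
    (\<forall>x\<in>X. R (\<lambda>x. cl_rev (g x)) x = cl_rev (L g x)))"

lemma cl_rev_funpow:
  assumes X: "open X" and ops: "rev_ops X L R" and g: "smooth_on X g" and h: "\<forall>x\<in>X. h x = cl_rev (g x)"
  shows "smooth_on X ((L ^^ j) g)" and "\<forall>x\<in>X. (R ^^ j) h x = cl_rev ((L ^^ j) g x)"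
proof -
  have loc: "local_op R" using ops by (simp add: rev_ops_def)
  have "smooth_on X ((L ^^ j) g) \<and> (\<forall>x\<in>X. (R ^^ j) h x = cl_rev ((L ^^ j) g x))"
  proof (induction j)
    case (Suc j)
    have "R ((R ^^ j) h) x = cl_rev (L ((L ^^ j) g) x)" if "x \<in> X" for x
      using local_opD [OF loc X that, of "(R ^^ j) h" "\<lambda>x. cl_rev ((L ^^ j) g x)"] Suc ops that
      by (simp add: rev_ops_def)
    with Suc ops show ?case by (simp add: rev_ops_def)
  qed (use g h in simp)
  then show "smooth_on X ((L ^^ j) g)" "\<forall>x\<in>X. (R ^^ j) h x = cl_rev ((L ^^ j) g x)" by auto
qed

lemma Laplacian_cl_rev:
  assumes "open X" "smooth_on X g" "x \<in> X"
  shows "Laplacian (\<lambda>x. cl_rev (g x)) x = cl_rev (Laplacian g x)"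
  unfolding Laplacian_def cl_rev_sum
proof (intro sum.cong refl)
  fix b :: "'a point" assume b: "b \<in> Basis"
  have "partial_deriv b (partial_deriv b (\<lambda>x. cl_rev (g x))) x = partial_deriv b (\<lambda>x. cl_rev (partial_deriv b g x)) x"
    by (rule partial_deriv_cong_open [OF assms(1,3)]) (rule partial_deriv_cl_rev [OF assms(2) _ b])
  also have "\<dots> = cl_rev (partial_deriv b (partial_deriv b g) x)"
    by (rule partial_deriv_cl_rev [OF smooth_on_pd [OF assms(2) b] assms(3) b])
  finally show "partial_deriv b (partial_deriv b (\<lambda>x. cl_rev (g x))) x = cl_rev (partial_deriv b (partial_deriv b g) x)" .
qed

lemma Basis_point_mem: "(1, 0) \<in> (Basis :: ('n::finite) point set)" "(0, axis i 1) \<in> (Basis :: ('n::finite) point set)"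
  by (auto simp: Basis_point)

lemma Dirac_right_cl_rev:
  assumes "smooth_on X g" "x \<in> X"
  shows "Dirac_right (\<lambda>x. cl_rev (g x)) x = cl_rev (Dirac_left g x)"
  by (simp add: Dirac_right_def Dirac_left_def partial_deriv_cl_rev [OF assms] Basis_point_mem
      cl_rev_add cl_rev_sum cl_rev_mult cl_rev_e)

lemma Dirac_conj_right_cl_rev:
  assumes "smooth_on X g" "x \<in> X"
  shows "Dirac_conj_right (\<lambda>x. cl_rev (g x)) x = cl_rev (Dirac_conj_left g x)"
  by (simp add: Dirac_conj_right_def Dirac_conj_left_def partial_deriv_cl_rev [OF assms] Basis_point_mem
      cl_rev_diff cl_rev_sum cl_rev_mult cl_rev_e)

lemma local_op_Dirac_right:
  "local_op (Dirac_right :: ('n::{finite,linorder}) cl_fun \<Rightarrow> 'n cl_fun)"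
  "local_op (Dirac_conj_right :: 'n cl_fun \<Rightarrow> 'n cl_fun)"
proof -
  have "Dirac_right f x = Dirac_right g x \<and> Dirac_conj_right f x = Dirac_conj_right g x"
    if "open S" "x \<in> S" "\<forall>y\<in>S. f y = g y" for S f x and g :: "'n cl_fun"
  proof -
    have "partial_deriv b f x = partial_deriv b g x" for b
      by (rule partial_deriv_cong_open [OF that(1,2)]) (use that(3) in blast)
    then show ?thesis by (simp add: Dirac_right_def Dirac_conj_right_def)
  qed
  then show "local_op (Dirac_right :: 'n cl_fun \<Rightarrow> 'n cl_fun)" "local_op (Dirac_conj_right :: 'n cl_fun \<Rightarrow> 'n cl_fun)"
    unfolding local_op_def by blast+
qed

lemma rev_ops:
  assumes "open X"
  shows "rev_ops X Laplacian Laplacian" "rev_ops X Dirac_left Dirac_right"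
    "rev_ops X Dirac_conj_left Dirac_conj_right"
  using assms Laplacian_cl_rev [OF assms] Dirac_right_cl_rev [of X] Dirac_conj_right_cl_rev [of X]
  by (simp_all add: rev_ops_def local_op_Laplacian local_op_Dirac_right smooth_on_Laplacian
      smooth_on_cl_op Dirac_left_eq Dirac_conj_left_eq)

lemma DLap_right_cl_rev:
  assumes "open X" "smooth_on X g" "\<forall>x\<in>X. h x = cl_rev (g x)" "x \<in> X"
  shows "DLap_right \<beta> m h x = cl_rev ((Laplacian ^^ m) ((Dirac_left ^^ \<beta>) g) x)"
proof -
  note D = cl_rev_funpow [OF assms(1) rev_ops(2) [OF assms(1)] assms(2,3), of \<beta>]
  from cl_rev_funpow(2) [OF assms(1) rev_ops(1) [OF assms(1)] D, of m] assms(4)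
  show ?thesis by (simp add: DLap_right_def)
qed

text \<open>Reversion fixes paravectors and the elements of a slice, and it exchanges the factors,
  so it maps \<open>S_left\<close> to \<open>S_right\<close>. The operators then appear in the
  opposite order, and their commutation on the kernel restores it.\<close>

lemma DLap_kernel_right_eq:
  assumes I: "norm I = 1" and qf: "qf w x \<noteq> 0"
  shows "DLap_kernel_right \<beta> m (slice_point I w) x = cl_rev (DLap_kernel_left \<beta> m (slice_point I w) x)"
proof -
  have k: "ker_fam I (kern I)" by (rule axial_fam_imp_ker_fam [OF axial_fam_kern [OF I]])
  have "S_right (slice_point I w) y = cl_rev (kern I w y)" if "qf w y \<noteq> 0" for y
    by (simp add: S_right_def kern_def S_left_def cl_rev_mult cl_rev_diff cl_rev_paravector
        Q_c_slice_point [OF I] cl_inverse_cl_complex [OF I that] cl_rev_cl_complex)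
  then have "DLap_kernel_right \<beta> m (slice_point I w) x = cl_rev ((Laplacian ^^ m) ((Dirac_left ^^ \<beta>) (kern I w)) x)"
    unfolding DLap_kernel_right_def
    using DLap_right_cl_rev [OF open_qf smooth_on_ker_fam [OF k, of w], of "\<lambda>y. S_right (slice_point I w) y" x] qf by simp
  also have "(Laplacian ^^ m) ((Dirac_left ^^ \<beta>) (kern I w)) x = DLap_left \<beta> m (kern I w) x"
    unfolding DLap_left_def Dirac_left_eq by (rule cl_op_funpow_Laplacian [OF k qf, symmetric])
  finally show ?thesis by (simp add: DLap_kernel_left_def kern_def)
qed

lemma C_diff_on_1_has_pd:
  assumes "C_diff_on 1 A V" "p \<in> V" "b \<in> Basis"
  shows "has_pd A b (partial_deriv b A p) p"
  using assms by (auto simp: has_pd_def partial_deriv_def simp flip: vector_derivative_works)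

lemma C_diff_on_1_cl_rev:
  assumes "open V" "C_diff_on 1 A V"
  shows "C_diff_on 1 (\<lambda>x. cl_rev (A x)) V"
proof -
  have hp: "has_pd (\<lambda>x. cl_rev (A x)) b (cl_rev (partial_deriv b A p)) p" if "p \<in> V" "b \<in> Basis" for p b
    by (rule has_pd_bounded_linear [OF bounded_linear_cl_rev C_diff_on_1_has_pd [OF assms(2) that]])
  have "continuous_on V (partial_deriv b (\<lambda>x. cl_rev (A x)))" if "b \<in> Basis" for b
  proof (rule continuous_on_eq)
    show "continuous_on V (\<lambda>p. cl_rev (partial_deriv b A p))"
      using assms(2) that by (intro bounded_linear.continuous_on [OF bounded_linear_cl_rev]) simp
  qed (rule has_pd_partial_deriv [OF hp [OF _ that], symmetric])
  moreover have "continuous_on V (\<lambda>x. cl_rev (A x))"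
    using assms(2) by (intro bounded_linear.continuous_on [OF bounded_linear_cl_rev]) simp
  ultimately show ?thesis using hp differentiable_iff_has_pd by fastforce
qed

section \<open>The right-sided theory by reversion\<close>

lemma slice_hyperholomorphic_right_rev:
  assumes G: "open G" "axially_symmetric G" and "slice_hyperholomorphic_right G f"
  shows "slice_hyperholomorphic_left G (\<lambda>x. cl_rev (f x))"
proof -
  obtain A B where ax: "axial_form_right G f A B" and CR: "cauchy_riemann_on (plane_domain G) A B"
    using assms(3) unfolding slice_hyperholomorphic_right_def by blast
  have "axial_form_left G (\<lambda>x. cl_rev (f x)) (\<lambda>p. cl_rev (A p)) (\<lambda>p. cl_rev (B p))"
    using ax unfolding axial_form_left_def axial_form_right_def even_odd_pair_def
    by (auto simp: cl_rev_add cl_rev_mult cl_rev_paravector cl_rev_minus)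
  moreover have "cauchy_riemann_on (plane_domain G) (\<lambda>p. cl_rev (A p)) (\<lambda>p. cl_rev (B p))"
  proof -
    have V: "open (plane_domain G)" by (rule open_plane_domain [OF G])
    have C: "C_diff_on 1 A (plane_domain G)" "C_diff_on 1 B (plane_domain G)"
      and eq: "\<And>p. p \<in> plane_domain G \<Longrightarrow> partial_deriv (1, 0) A p = partial_deriv (0, 1) B p \<and>
        partial_deriv (0, 1) A p = - partial_deriv (1, 0) B p"
      using CR unfolding cauchy_riemann_on_def by auto
    have "partial_deriv b (\<lambda>p. cl_rev (h p)) p = cl_rev (partial_deriv b h p)"
      if "C_diff_on 1 h (plane_domain G)" "p \<in> plane_domain G" "b \<in> Basis" for h :: "real \<times> real \<Rightarrow> 'a clifford" and b p
      by (rule has_pd_partial_deriv [OF has_pd_bounded_linear [OF bounded_linear_cl_rev C_diff_on_1_has_pd [OF that]]])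
    moreover have "(1, 0) \<in> (Basis :: (real \<times> real) set)" "(0, 1) \<in> (Basis :: (real \<times> real) set)"
      by (auto simp: Basis_prod_def)
    ultimately show ?thesis
      using C_diff_on_1_cl_rev [OF V C(1)] C_diff_on_1_cl_rev [OF V C(2)] C eq
      by (simp add: cauchy_riemann_on_def cl_rev_minus)
  qed
  ultimately show ?thesis unfolding slice_hyperholomorphic_left_def by blast
qed

lemma slice_function_exists:
  assumes "norm I = 1" "open G" "axially_symmetric G" "slice_hyperholomorphic_left G f"
  obtains F where "slice_function I f G F"
proof -
  obtain F where F: "\<And>E. F E holomorphic_on slice_dom G"
    "\<And>E z. z \<in> slice_dom G \<Longrightarrow> F E (cnj z) = cnj (F E z)"
    "\<And>J z. norm J = 1 \<Longrightarrow> z \<in> slice_dom G \<Longrightarrow> f (slice_point J z) = (\<Sum>E\<in>Basis. cl_complex J (F E z) * E)"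
    "\<And>x. x \<in> G \<Longrightarrow> f x = (\<Sum>E\<in>Basis. (of_real (Re (F E (slice_coord x))) +
        of_real (Im (F E (slice_coord x))) * paravector (0, sgn (snd x))) * E)"
    by (rule slice_hyperholomorphic_components [OF assms(4,2,3)]) (rule that; assumption)
  have "slice_function I f G F"
    by unfold_locales (fact assms F(1) F(2) F(3) [OF assms(1)] F(4))+
  then show ?thesis by (rule that)
qed

lemma anti_analytic_harmonic_left:
  fixes f :: "('n::{finite,linorder}) cl_fun"
  assumes "CARD('n) = 2 * h + 1" "1 \<le> \<beta>" "\<beta> + m \<le> h" "open G" "axially_symmetric G" "U \<subseteq> G"
    "slice_hyperholomorphic_left G f"
  shows "axially_anti_analytic_harmonic_left (\<beta> - 1) (h - m - \<beta> + 1) U (DLap_left \<beta> m f)"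
proof -
  obtain I :: "(real, 'n) vec" where I: "norm I = 1" by (rule unit_exists)
  obtain F where "slice_function I f G F" using slice_function_exists [OF I assms(4,5,7)] .
  then interpret slice_function I f G F .
  obtain b where b: "\<beta> = Suc b" using assms(2) by (cases \<beta>) auto
  \<comment> \<open>Because of \<beta> + m \<le> h no subtraction is truncated, and the exponents
    satisfy (h - m - \<beta> + 1) + m + (\<beta> - 1) = h.\<close>
  have "(Dirac_conj_left ^^ b) ((Laplacian ^^ (h - m - \<beta> + 1)) (DLap_left (Suc b) m f)) x = 0" if "x \<in> U" for x
    by (rule anti_analytic_harmonic_DLap [where h = h]) (use assms that b in auto)
  then show ?thesis
    unfolding axially_anti_analytic_harmonic_left_def
    using axial_form_DLap [OF assms(2,6)] C_diff_on_subset [OF C_diff_on_DLap assms(6)] b by simp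
qed

text \<open>Reversion turns the right operators into left ones with D acting first; the commutation
  for the reversed function brings them into the order of \<open>DLap_left\<close>.\<close>

lemma DLap_right_eq:
  assumes "open G" "axially_symmetric G" "slice_hyperholomorphic_right G f" "x \<in> G"
  shows "DLap_right \<beta> m f x = cl_rev (DLap_left \<beta> m (\<lambda>x. cl_rev (f x)) x)"
    and "smooth_on G (DLap_left \<beta> m (\<lambda>x. cl_rev (f x)))"
proof -
  define g where "g = (\<lambda>x. cl_rev (f x))"
  obtain I :: "(real, 'a) vec" where I: "norm I = 1" by (rule unit_exists)
  obtain F where "slice_function I g G F"
    using slice_function_exists [OF I assms(1,2) slice_hyperholomorphic_right_rev [OF assms(1-3)]]
    unfolding g_def .
  then interpret slice_function I g G F .
  have smooth: "smooth_on G (DLap_left \<beta> m g)" for \<beta> m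
    unfolding smooth_on_def using C_diff_on_DLap by blast
  show "smooth_on G (DLap_left \<beta> m (\<lambda>x. cl_rev (f x)))" using smooth by (simp add: g_def)
  \<comment> \<open>The case of no operators at all: \<open>DLap_left 0 0\<close> is the
    identity.\<close>
  have "smooth_on G g" using smooth [of 0 0] by (simp add: DLap_left_def)
  from DLap_right_cl_rev [OF assms(1) this _ assms(4), of f \<beta> m] Laplacian_Dirac_funpow_commute [OF assms(4)]
  show "DLap_right \<beta> m f x = cl_rev (DLap_left \<beta> m (\<lambda>x. cl_rev (f x)) x)" by (simp add: g_def)
qed

lemma anti_analytic_harmonic_right:
  fixes f :: "('n::{finite,linorder}) cl_fun"
  assumes "CARD('n) = 2 * h + 1" "1 \<le> \<beta>" "\<beta> + m \<le> h" "open G" "axially_symmetric G" "open U" "U \<subseteq> G"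
    "slice_hyperholomorphic_right G f"
  shows "axially_anti_analytic_harmonic_right (\<beta> - 1) (h - m - \<beta> + 1) U (DLap_right \<beta> m f)"
proof -
  define g where "g = DLap_left \<beta> m (\<lambda>x. cl_rev (f x))"
  define p where "p = h - m - \<beta> + 1"
  have left: "axially_anti_analytic_harmonic_left (\<beta> - 1) p U g"
    unfolding g_def p_def
    by (rule anti_analytic_harmonic_left [OF assms(1-5,7) slice_hyperholomorphic_right_rev [OF assms(4,5,8)]])
  have eq: "DLap_right \<beta> m f x = cl_rev (g x)" if "x \<in> G" for x
    unfolding g_def by (rule DLap_right_eq(1) [OF assms(4,5,8) that])
  obtain A B where AB: "axial_form_left U g A B"
    using left unfolding axially_anti_analytic_harmonic_left_def by blast
  have "axial_form_right U (DLap_right \<beta> m f) (\<lambda>q. cl_rev (A q)) (\<lambda>q. cl_rev (B q))"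
    unfolding axial_form_right_def
  proof (intro conjI ballI)
    show "even_odd_pair U (\<lambda>q. cl_rev (A q)) (\<lambda>q. cl_rev (B q))"
      using AB unfolding axial_form_left_def even_odd_pair_def by (auto simp: cl_rev_minus)
    fix x assume x: "x \<in> U"
    then have "g x = A (fst x, norm (snd x)) + paravector (0, sgn (snd x)) * B (fst x, norm (snd x))"
      using AB unfolding axial_form_left_def by blast
    with eq [of x] x assms(7) show "DLap_right \<beta> m f x = cl_rev (A (fst x, norm (snd x))) +
        cl_rev (B (fst x, norm (snd x))) * paravector (0, sgn (snd x))"
      by (simp add: cl_rev_add cl_rev_mult cl_rev_paravector subset_eq)
  qed
  moreover have smooth: "smooth_on U g" if "x \<in> U" for x
    using DLap_right_eq(2) [OF assms(4,5,8), of x] that assms(7) C_diff_on_subset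
    unfolding smooth_on_def g_def by blast
  have "C_diff_on N (DLap_right \<beta> m f) U" for N
  proof (rule C_diff_on_local)
    fix x assume x: "x \<in> U"
    have "smooth_on U (DLap_right \<beta> m f) \<longleftrightarrow> smooth_on U (\<lambda>x. cl_rev (g x))"
      by (rule smooth_on_cong [OF assms(6)]) (use eq assms(7) in blast)
    with smooth_on_bounded_linear [OF assms(6) bounded_linear_cl_rev smooth [OF x]]
    show "\<exists>T. open T \<and> x \<in> T \<and> C_diff_on N (DLap_right \<beta> m f) T"
      using assms(6) x unfolding smooth_on_def by blast
  qed
  moreover have "(Dirac_conj_right ^^ (\<beta> - 1)) ((Laplacian ^^ p) (DLap_right \<beta> m f)) x = 0" if x: "x \<in> U" for x
  proof -
    note sm = smooth [OF x]
    have "\<forall>x\<in>U. DLap_right \<beta> m f x = cl_rev (g x)"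
      using eq assms(7) by blast
    note L = cl_rev_funpow [OF assms(6) rev_ops(1) [OF assms(6)] sm this, of p]
    have "(Dirac_conj_right ^^ (\<beta> - 1)) ((Laplacian ^^ p) (DLap_right \<beta> m f)) x =
        cl_rev ((Dirac_conj_left ^^ (\<beta> - 1)) ((Laplacian ^^ p) g) x)"
      using cl_rev_funpow(2) [OF assms(6) rev_ops(3) [OF assms(6)] L] x by blast
    then show ?thesis
      using left x by (simp add: axially_anti_analytic_harmonic_left_def cl_rev_0)
  qed
  ultimately show ?thesis
    unfolding axially_anti_analytic_harmonic_right_def p_def by blast
qed

lemma integral_representation_left:
  assumes "1 \<le> \<beta>" "slice_Cauchy_domain U" "norm I = 1" "open G" "axially_symmetric G" "closure U \<subseteq> G"
    "slice_hyperholomorphic_left G f" "oriented_boundary (slice_of I U) \<Gamma>" "x \<in> U"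
  shows "slice_integrable I \<Gamma> (\<lambda>s. DLap_kernel_left \<beta> m s x) f"
    and "slice_integral I \<Gamma> (\<lambda>s. DLap_kernel_left \<beta> m s x) f = (2 * pi) *\<^sub>R DLap_left \<beta> m f x"
proof -
  obtain F where "slice_function I f G F" using slice_function_exists [OF assms(3,4,5,7)] .
  then interpret slice_function I f G F .
  have U: "open U" "axially_symmetric U" using assms(2) by (auto simp: slice_Cauchy_domain_def)
  show "slice_integrable I \<Gamma> (\<lambda>s. DLap_kernel_left \<beta> m s x) f"
    by (rule slice_integral_DLap(1) [OF assms(1) U assms(6,8,9)])
  show "slice_integral I \<Gamma> (\<lambda>s. DLap_kernel_left \<beta> m s x) f = (2 * pi) *\<^sub>R DLap_left \<beta> m f x"
    unfolding slice_integral_DLap(2) [OF assms(1) U assms(6,8,9)] by simp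
qed

text \<open>The form takes values in the slice and is fixed by reversion, so reversing the
  left-sided integrand reverses the order of its three factors and gives the right-sided one, with f
  in front.\<close>

lemma integral_representation_right:
  assumes "1 \<le> \<beta>" "slice_Cauchy_domain U" "norm I = 1" "open G" "axially_symmetric G" "closure U \<subseteq> G"
    "slice_hyperholomorphic_right G f" "oriented_boundary (slice_of I U) \<Gamma>" "x \<in> U"
  shows "slice_integrable I \<Gamma> f (\<lambda>s. DLap_kernel_right \<beta> m s x)"
    and "slice_integral I \<Gamma> f (\<lambda>s. DLap_kernel_right \<beta> m s x) = (2 * pi) *\<^sub>R DLap_right \<beta> m f x"
proof -
  define g where "g = (\<lambda>x. cl_rev (f x))"
  let ?k = "\<lambda>s. DLap_kernel_left \<beta> m s x"
  have U: "open U" "axially_symmetric U" using assms(2) by (auto simp: slice_Cauchy_domain_def)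
  note left = integral_representation_left [OF assms(1-6)
      slice_hyperholomorphic_right_rev [OF assms(4,5,7)] assms(8,9), of m, folded g_def]
  \<comment> \<open>Left and right kernels are related only off the zeros of \<open>qf\<close>.
    These lie in the open slice of \<open>U\<close>, the curves on its frontier.\<close>
  have qf: "qf (\<gamma> t) x \<noteq> 0" if "\<gamma> \<in> \<Gamma>" "t \<in> {0..1}" for \<gamma> t
  proof
    assume "qf (\<gamma> t) x = 0"
    have "\<gamma> t \<in> slice_dom U"
    proof -
      have "slice_coord x \<in> slice_dom U" using slice_coord_mem [OF U(2)] assms(9) by blast
      moreover from this have "cnj (slice_coord x) \<in> slice_dom U" using cnj_slice_dom [OF U(2)] by blast
      moreover have "\<gamma> t = slice_coord x \<or> \<gamma> t = cnj (slice_coord x)"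
        using \<open>qf (\<gamma> t) x = 0\<close> by (simp add: qf_slice_coord)
      ultimately show ?thesis by metis
    qed
    moreover have "\<gamma> t \<in> frontier (slice_of I U)"
    proof -
      have "\<gamma> t \<in> path_image \<gamma>" using that(2) by (simp add: path_image_def)
      then show ?thesis using assms(8) that(1) unfolding oriented_boundary_def by blast
    qed
    ultimately show False
      using open_slice_dom [OF U] slice_of_eq [OF U(2) assms(3)] by (simp add: frontier_def interior_open)
  qed
  have ds: "cl_rev (ds_slice I \<gamma> t) = ds_slice I \<gamma> t" for \<gamma> t
  proof -
    have "ds_slice I \<gamma> t = cl_complex I (vector_derivative \<gamma> (at t within {0..1}) * (- \<i>))"
      by (simp only: ds_slice_def paravector_slice_point cl_complex_mult [OF assms(3)] cl_complex_minus cl_complex_i)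
    then show ?thesis by (simp only: cl_rev_cl_complex)
  qed
  have integrand: "slice_integrand I f (\<lambda>s. DLap_kernel_right \<beta> m s x) \<gamma> t = cl_rev (slice_integrand I ?k g \<gamma> t)"
    if "\<gamma> \<in> \<Gamma>" "t \<in> {0..1}" for \<gamma> t
    by (simp add: slice_integrand_def DLap_kernel_right_eq [OF assms(3) qf [OF that]] cl_rev_mult ds g_def mult.assoc)
  have int: "(slice_integrand I f (\<lambda>s. DLap_kernel_right \<beta> m s x) \<gamma> has_integral
      cl_rev (integral {0..1} (slice_integrand I ?k g \<gamma>))) {0..1}" if "\<gamma> \<in> \<Gamma>" for \<gamma>
  proof (rule has_integral_eq)
    show "((\<lambda>t. cl_rev (slice_integrand I ?k g \<gamma> t)) has_integral
        cl_rev (integral {0..1} (slice_integrand I ?k g \<gamma>))) {0..1}"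
      using has_integral_linear [OF integrable_integral bounded_linear_cl_rev, of "slice_integrand I ?k g \<gamma>" "{0..1}"]
        left(1) that by (simp add: slice_integrable_def comp_def)
  qed (use integrand [OF that] in simp)
  show "slice_integrable I \<Gamma> f (\<lambda>s. DLap_kernel_right \<beta> m s x)"
    unfolding slice_integrable_def using int by blast
  have "slice_integral I \<Gamma> f (\<lambda>s. DLap_kernel_right \<beta> m s x) = cl_rev (slice_integral I \<Gamma> ?k g)"
    unfolding slice_integral_def cl_rev_sum by (intro sum.cong refl integral_unique int)
  also have "\<dots> = (2 * pi) *\<^sub>R DLap_right \<beta> m f x"
  proof -
    have "x \<in> G" using assms(6,9) closure_subset by blast
    from DLap_right_eq(1) [OF assms(4,5,7) this] show ?thesis
      unfolding left(2) cl_rev_scaleR by (simp add: g_def)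
  qed
  finally show "slice_integral I \<Gamma> f (\<lambda>s. DLap_kernel_right \<beta> m s x) = (2 * pi) *\<^sub>R DLap_right \<beta> m f x" .
qed

theorem theorem4p10:
  fixes U G :: "('n::{finite,linorder}) point set"
    and f :: "'n cl_fun"
    and I :: "real ^ ('n::{finite,linorder})"
    and \<beta> m h :: nat
  assumes "odd CARD('n)"
    and "h = (CARD('n) - 1) div 2"
    and "1 \<le> \<beta>" and "\<beta> + m \<le> h"
    and "slice_Cauchy_domain U" and "bounded U"
    and "norm I = 1"
    and "open G" and "axially_symmetric G" and "closure U \<subseteq> G"
  shows
    "(slice_hyperholomorphic_left G f \<longrightarrow>
       (\<beta> = 1 \<longrightarrow> axially_polyharmonic_left (h - m) U (DLap_left \<beta> m f)) \<and>
       axially_anti_analytic_harmonic_left (\<beta> - 1) (h - m - \<beta> + 1) U (DLap_left \<beta> m f) \<and>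
       (\<forall>\<Gamma>. oriented_boundary (slice_of I U) \<Gamma> \<longrightarrow> (\<forall>x\<in>U.
         slice_integrable I \<Gamma> (\<lambda>s. DLap_kernel_left \<beta> m s x) f \<and>
         DLap_left \<beta> m f x =
           (1 / (2 * pi)) *\<^sub>R slice_integral I \<Gamma> (\<lambda>s. DLap_kernel_left \<beta> m s x) f)) \<and>
       (\<forall>U' G' I' \<Gamma> \<Gamma>'.
         slice_Cauchy_domain U' \<and> bounded U' \<and> norm I' = 1 \<and>
         open G' \<and> axially_symmetric G' \<and> closure U' \<subseteq> G' \<and> slice_hyperholomorphic_left G' f \<and>
         oriented_boundary (slice_of I U) \<Gamma> \<and> oriented_boundary (slice_of I' U') \<Gamma>' \<longrightarrow>
         (\<forall>x\<in>U \<inter> U'.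
           slice_integral I \<Gamma> (\<lambda>s. DLap_kernel_left \<beta> m s x) f =
           slice_integral I' \<Gamma>' (\<lambda>s. DLap_kernel_left \<beta> m s x) f)) \<and>
       (\<forall>G\<^sub>1 f\<^sub>1 \<Gamma>.
         open G\<^sub>1 \<and> axially_symmetric G\<^sub>1 \<and> closure U \<subseteq> G\<^sub>1 \<and> slice_hyperholomorphic_left G\<^sub>1 f\<^sub>1 \<and>
         (\<forall>x\<in>U. DLap_left \<beta> m f\<^sub>1 x = DLap_left \<beta> m f x) \<and>
         oriented_boundary (slice_of I U) \<Gamma> \<longrightarrow>
         (\<forall>x\<in>U.
           slice_integral I \<Gamma> (\<lambda>s. DLap_kernel_left \<beta> m s x) f\<^sub>1 =
           slice_integral I \<Gamma> (\<lambda>s. DLap_kernel_left \<beta> m s x) f)))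
     \<and>
     (slice_hyperholomorphic_right G f \<longrightarrow>
       (\<beta> = 1 \<longrightarrow> axially_polyharmonic_right (h - m) U (DLap_right \<beta> m f)) \<and>
       axially_anti_analytic_harmonic_right (\<beta> - 1) (h - m - \<beta> + 1) U (DLap_right \<beta> m f) \<and>
       (\<forall>\<Gamma>. oriented_boundary (slice_of I U) \<Gamma> \<longrightarrow> (\<forall>x\<in>U.
         slice_integrable I \<Gamma> f (\<lambda>s. DLap_kernel_right \<beta> m s x) \<and>
         DLap_right \<beta> m f x =
           (1 / (2 * pi)) *\<^sub>R slice_integral I \<Gamma> f (\<lambda>s. DLap_kernel_right \<beta> m s x))) \<and>
       (\<forall>U' G' I' \<Gamma> \<Gamma>'.
         slice_Cauchy_domain U' \<and> bounded U' \<and> norm I' = 1 \<and>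
         open G' \<and> axially_symmetric G' \<and> closure U' \<subseteq> G' \<and> slice_hyperholomorphic_right G' f \<and>
         oriented_boundary (slice_of I U) \<Gamma> \<and> oriented_boundary (slice_of I' U') \<Gamma>' \<longrightarrow>
         (\<forall>x\<in>U \<inter> U'.
           slice_integral I \<Gamma> f (\<lambda>s. DLap_kernel_right \<beta> m s x) =
           slice_integral I' \<Gamma>' f (\<lambda>s. DLap_kernel_right \<beta> m s x))) \<and>
       (\<forall>G\<^sub>1 f\<^sub>1 \<Gamma>.
         open G\<^sub>1 \<and> axially_symmetric G\<^sub>1 \<and> closure U \<subseteq> G\<^sub>1 \<and> slice_hyperholomorphic_right G\<^sub>1 f\<^sub>1 \<and>
         (\<forall>x\<in>U. DLap_right \<beta> m f\<^sub>1 x = DLap_right \<beta> m f x) \<and>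
         oriented_boundary (slice_of I U) \<Gamma> \<longrightarrow>
         (\<forall>x\<in>U.
           slice_integral I \<Gamma> f\<^sub>1 (\<lambda>s. DLap_kernel_right \<beta> m s x) =
           slice_integral I \<Gamma> f (\<lambda>s. DLap_kernel_right \<beta> m s x))))"
proof -
  have n: "CARD('n) = 2 * h + 1" using assms(1,2) by (auto elim!: oddE)
  have U: "open U" "U \<subseteq> G"
    using assms(5,10) closure_subset by (auto simp: slice_Cauchy_domain_def)
  \<comment> \<open>Without a factor of the conjugate operator the two notions coincide, so the
    polyharmonic claim is the case \<beta> = 1 of the other one.\<close>
  have poly: "axially_polyharmonic_left p U g \<longleftrightarrow> axially_anti_analytic_harmonic_left 0 p U g"
    "axially_polyharmonic_right p U g \<longleftrightarrow> axially_anti_analytic_harmonic_right 0 p U g" for p and g :: "'n cl_fun"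
    by (simp_all add: axially_polyharmonic_left_def axially_anti_analytic_harmonic_left_def
        axially_polyharmonic_right_def axially_anti_analytic_harmonic_right_def)
  have p: "h - m - \<beta> + 1 = h - m" if "\<beta> = 1" using that assms(4) by simp
  show ?thesis
  proof (intro conjI impI allI ballI)
    assume f: "slice_hyperholomorphic_left G f"
    note harm = anti_analytic_harmonic_left [OF n assms(3,4,8,9) U(2) f]
    note int = integral_representation_left [OF assms(3,5,7-10) f, where m = m]
    show "axially_polyharmonic_left (h - m) U (DLap_left \<beta> m f)" if "\<beta> = 1"
      using harm unfolding p [OF that] by (simp add: poly that)
    show "axially_anti_analytic_harmonic_left (\<beta> - 1) (h - m - \<beta> + 1) U (DLap_left \<beta> m f)"
      by (rule harm)
    show "slice_integrable I \<Gamma> (\<lambda>s. DLap_kernel_left \<beta> m s x) f"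
      if "oriented_boundary (slice_of I U) \<Gamma>" "x \<in> U" for \<Gamma> x
      by (rule int(1) [OF that])
    show "DLap_left \<beta> m f x = (1 / (2 * pi)) *\<^sub>R slice_integral I \<Gamma> (\<lambda>s. DLap_kernel_left \<beta> m s x) f"
      if "oriented_boundary (slice_of I U) \<Gamma>" "x \<in> U" for \<Gamma> x
      unfolding int(2) [OF that] by simp
    show "slice_integral I \<Gamma> (\<lambda>s. DLap_kernel_left \<beta> m s x) f =
        slice_integral I' \<Gamma>' (\<lambda>s. DLap_kernel_left \<beta> m s x) f"
      if "slice_Cauchy_domain U' \<and> bounded U' \<and> norm I' = 1 \<and>
        open G' \<and> axially_symmetric G' \<and> closure U' \<subseteq> G' \<and> slice_hyperholomorphic_left G' f \<and>
        oriented_boundary (slice_of I U) \<Gamma> \<and> oriented_boundary (slice_of I' U') \<Gamma>'"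
        "x \<in> U \<inter> U'" for U' G' I' \<Gamma> \<Gamma>' x
    proof -
      from that have "slice_integral I \<Gamma> (\<lambda>s. DLap_kernel_left \<beta> m s x) f =
          (2 * pi) *\<^sub>R DLap_left \<beta> m f x"
        by (intro int(2)) blast+
      moreover from that have "slice_integral I' \<Gamma>' (\<lambda>s. DLap_kernel_left \<beta> m s x) f =
          (2 * pi) *\<^sub>R DLap_left \<beta> m f x"
        by (intro integral_representation_left(2) [OF assms(3), where U = U' and G = G']) blast+
      ultimately show ?thesis by (rule trans_sym)
    qed
    show "slice_integral I \<Gamma> (\<lambda>s. DLap_kernel_left \<beta> m s x) f\<^sub>1 =
        slice_integral I \<Gamma> (\<lambda>s. DLap_kernel_left \<beta> m s x) f"
      if "open G\<^sub>1 \<and> axially_symmetric G\<^sub>1 \<and> closure U \<subseteq> G\<^sub>1 \<and> slice_hyperholomorphic_left G\<^sub>1 f\<^sub>1 \<and>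
        (\<forall>x\<in>U. DLap_left \<beta> m f\<^sub>1 x = DLap_left \<beta> m f x) \<and>
        oriented_boundary (slice_of I U) \<Gamma>" "x \<in> U"
      for G\<^sub>1 f\<^sub>1 \<Gamma> x
    proof -
      from that have "slice_integral I \<Gamma> (\<lambda>s. DLap_kernel_left \<beta> m s x) f\<^sub>1 =
          (2 * pi) *\<^sub>R DLap_left \<beta> m f\<^sub>1 x"
        by (intro integral_representation_left(2) [OF assms(3,5,7), where G = G\<^sub>1]) blast+
      also from that have "DLap_left \<beta> m f\<^sub>1 x = DLap_left \<beta> m f x" by blast
      also from that have "(2 * pi) *\<^sub>R DLap_left \<beta> m f x =
          slice_integral I \<Gamma> (\<lambda>s. DLap_kernel_left \<beta> m s x) f"
        by (intro int(2) [symmetric]) blast+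
      finally show ?thesis .
    qed
  next
    assume f: "slice_hyperholomorphic_right G f"
    note harm = anti_analytic_harmonic_right [OF n assms(3,4,8,9) U f]
    note int = integral_representation_right [OF assms(3,5,7-10) f, where m = m]
    show "axially_polyharmonic_right (h - m) U (DLap_right \<beta> m f)" if "\<beta> = 1"
      using harm unfolding p [OF that] by (simp add: poly that)
    show "axially_anti_analytic_harmonic_right (\<beta> - 1) (h - m - \<beta> + 1) U (DLap_right \<beta> m f)"
      by (rule harm)
    show "slice_integrable I \<Gamma> f (\<lambda>s. DLap_kernel_right \<beta> m s x)"
      if "oriented_boundary (slice_of I U) \<Gamma>" "x \<in> U" for \<Gamma> x
      by (rule int(1) [OF that])
    show "DLap_right \<beta> m f x = (1 / (2 * pi)) *\<^sub>R slice_integral I \<Gamma> f (\<lambda>s. DLap_kernel_right \<beta> m s x)"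
      if "oriented_boundary (slice_of I U) \<Gamma>" "x \<in> U" for \<Gamma> x
      unfolding int(2) [OF that] by simp
    show "slice_integral I \<Gamma> f (\<lambda>s. DLap_kernel_right \<beta> m s x) =
        slice_integral I' \<Gamma>' f (\<lambda>s. DLap_kernel_right \<beta> m s x)"
      if "slice_Cauchy_domain U' \<and> bounded U' \<and> norm I' = 1 \<and>
        open G' \<and> axially_symmetric G' \<and> closure U' \<subseteq> G' \<and> slice_hyperholomorphic_right G' f \<and>
        oriented_boundary (slice_of I U) \<Gamma> \<and> oriented_boundary (slice_of I' U') \<Gamma>'"
        "x \<in> U \<inter> U'" for U' G' I' \<Gamma> \<Gamma>' x
    proof -
      from that have "slice_integral I \<Gamma> f (\<lambda>s. DLap_kernel_right \<beta> m s x) =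
          (2 * pi) *\<^sub>R DLap_right \<beta> m f x"
        by (intro int(2)) blast+
      moreover from that have "slice_integral I' \<Gamma>' f (\<lambda>s. DLap_kernel_right \<beta> m s x) =
          (2 * pi) *\<^sub>R DLap_right \<beta> m f x"
        by (intro integral_representation_right(2) [OF assms(3), where U = U' and G = G']) blast+
      ultimately show ?thesis by (rule trans_sym)
    qed
    show "slice_integral I \<Gamma> f\<^sub>1 (\<lambda>s. DLap_kernel_right \<beta> m s x) =
        slice_integral I \<Gamma> f (\<lambda>s. DLap_kernel_right \<beta> m s x)"
      if "open G\<^sub>1 \<and> axially_symmetric G\<^sub>1 \<and> closure U \<subseteq> G\<^sub>1 \<and> slice_hyperholomorphic_right G\<^sub>1 f\<^sub>1 \<and>
        (\<forall>x\<in>U. DLap_right \<beta> m f\<^sub>1 x = DLap_right \<beta> m f x) \<and>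
        oriented_boundary (slice_of I U) \<Gamma>" "x \<in> U"
      for G\<^sub>1 f\<^sub>1 \<Gamma> x
    proof -
      from that have "slice_integral I \<Gamma> f\<^sub>1 (\<lambda>s. DLap_kernel_right \<beta> m s x) =
          (2 * pi) *\<^sub>R DLap_right \<beta> m f\<^sub>1 x"
        by (intro integral_representation_right(2) [OF assms(3,5,7), where G = G\<^sub>1]) blast+
      also from that have "DLap_right \<beta> m f\<^sub>1 x = DLap_right \<beta> m f x" by blast
      also from that have "(2 * pi) *\<^sub>R DLap_right \<beta> m f x =
          slice_integral I \<Gamma> f (\<lambda>s. DLap_kernel_right \<beta> m s x)"
        by (intro int(2) [symmetric]) blast+
      finally show ?thesis .
    qed
  qed
qed

end
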